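(* Let $0<p<1$, $q=1-p$, and let $\xi_1,\xi_2,\dots$ be i.i.d. with $P(\xi_i=1)=p=1-P(\xi_i=0)$. Let $W^{(n)}$ be the longest length of arithmetic progressions mod $n$ relative to $\xi_1,\dots,\xi_n$ (defined in the context), and put $C=-2/\ln p$, $D=1/\ln p$, and, for integers $1<r\le n$, $\mu_{n,r}=\frac{qn^2p^r}{2}$. Then the following hold. (1) As $n\to\infty$, $$\max_{1<r\le n}\left|P(W^{(n)}<r)-e^{-\mu_{n,r}}\right|\le O\!\left(\frac{\ln^7 n}{n}\right),$$ the maximum being over integers $r$. (2) For any real $a$, as $n\to\infty$, $$\max_{x\ge D\ln\ln n+a,\ C\ln n+x\in\mathbb Z}\left|\exp\!\left(\frac q2\,p^{x}\right)P(W^{(n)}<C\ln n+x)-1\right|\le O\!\left(\frac{\ln^7 n}{n^{1-\frac{qp^a}{2}}}\right),$$ the maximum being over real $x$ with $x\ge D\ln\ln n+a$ and $C\ln n+x\in\mathbb Z$. (3) As $n\to\infty$, $$\frac{W^{(n)}-C\ln n}{\ln\ln n}\to 0\quad\text{in probability}.$$ (4) Almost surely, $$\limsup_{n\to\infty}\frac{W^{(n)}}{C\ln n}=\frac32,$$ and almost surely $$\liminf_{n\to\infty}\frac{W^{(n)}-C\ln n}{\ln\ln n}=D.$$ (5) Almost surely, $$0=\liminf_{n\to\infty}\frac{W^{(2^n)}-C\ln 2^n}{\ln\ln 2^n}<\limsup_{n\to\infty}\frac{W^{(2^n)}-C\ln 2^n}{\ln\ln 2^n}=-D$$ and $$\lim_{n\to\infty}\frac{1}{n\ln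 n}\left(\sum_{k=1}^n W^{(2^k)}+\frac{\ln 2}{\ln p}\,n^2\right)=0.$$
   Context: Residues mod $n$ are taken in $\{1,\dots,n\}$, i.e. $kn \bmod n=n$ for every integer $k$. For integers $1\le a,s\le n$, let $$W^{(n)}_{a,s}=\max\Big\{1\le m\le \frac{n}{\gcd(s,n)}:\ \xi_a=1,\ \xi_{a+s\bmod n}=1,\dots,\xi_{a+(m-1)s\bmod n}=1\Big\},$$ with $W^{(n)}_{a,s}=0$ if $\xi_a=0$, and let $W^{(n)}=\max_{1\le a,s\le n}W^{(n)}_{a,s}$. All $W^{(n)}$, $n\ge1$, are built from the same infinite sequence $(\xi_i)$. $\ln$ is the natural logarithm, and $\ln^k n=(\ln n)^k$. A statement $f_n\le O(g_n)$ means that there is a constant $K$, not depending on $n$ (but possibly depending on $p$ and, in (2), on $a$), with $f_n\le K g_n$ for all sufficiently large $n$. *)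

theory Defs
  imports "HOL-Probability.Probability"
begin

definition cyc_res :: "nat \<Rightarrow> nat \<Rightarrow> nat" where
  "cyc_res n k = (if n dvd k then n else k mod n)"

(* Only the events x i = 1 matter. For 0/1-valued x the first test is "x a \<noteq> 0"; otherwise it
   guarantees that the set below contains m = 1, so that Max is meaningful. *)
definition ap_length :: "(nat \<Rightarrow> real) \<Rightarrow> nat \<Rightarrow> nat \<Rightarrow> nat \<Rightarrow> nat" where
  "ap_length x n a s =
     (if x a = 1
      then Max {m \<in> {1..n div gcd s n}. \<forall>j<m. x (cyc_res n (a + j * s)) = 1}
      else 0)"

(* Used for n \<ge> 1 only; for n = 0 the value is an unspecified constant. *)
definition longest_ap :: "(nat \<Rightarrow> real) \<Rightarrow> nat \<Rightarrow> nat" where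
  "longest_ap x n = Max ((\<lambda>(a, s). ap_length x n a s) ` ({1..n} \<times> {1..n}))"

definition tendsto_in_prob :: "'a measure \<Rightarrow> (nat \<Rightarrow> 'a \<Rightarrow> real) \<Rightarrow> ('a \<Rightarrow> real) \<Rightarrow> bool" where
  "tendsto_in_prob M X Y \<longleftrightarrow>
     (\<forall>\<epsilon>>0. (\<lambda>n. \<P>(\<omega> in M. \<bar>X n \<omega> - Y \<omega>\<bar> > \<epsilon>)) \<longlonglongrightarrow> 0)"

end

theory Submission
  imports Defs "HOL-Real_Asymp.Real_Asymp"
begin

text \<open>
  Up to reversal and up to progressions of length at least \<open>2 r\<close>, a progression of ones of length \<open>r\<close>
  exists iff one exists that is preceded by a zero. There are about \<open>n\<^sup>2 / 2\<close> such declumped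
  progressions, each of probability \<open>q p\<^sup>r\<close>; two of them either exclude each other or share at most about half of
  their points, so the sum over dependent pairs of \<open>P A\<^sub>i P A\<^sub>j + P (A\<^sub>i \<inter> A\<^sub>j)\<close> is small. Removing the
  events one at a time bounds by this sum the distance between \<open>P(no A\<^sub>i)\<close> and \<open>\<Prod>(1 - P A\<^sub>i)\<close>, which
  gives the Poisson estimate without Chen-Stein; (1)--(3) follow.

  Borel-Cantelli gives the upper bounds of the limsups and, along powers of 2, the lower bounds.
  For the lower bound of the liminf along all \<open>n\<close>, progressions that do not wrap around
  persist when \<open>n\<close> grows, so powers of 2 suffice. For the remaining bounds
  it is enough that events \<open>B\<^sub>N\<close> occur with probability tending to 1, for then infinitely many of
  them occur almost surely. Here \<open>B\<^sub>N\<close> is the existence of an exceptional modulus in a block \<open>(N, N + T]\<close>, or among powers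
  of 4, and the second moment method applies because progressions modulo different
  moduli share more than half of their points only for rare steps.
\<close>

section \<open>Overlaps of cyclic progressions\<close>

text \<open>The constants come from counting. The mean number of declumped progressions of length r
  is about q n^2 p^r / 2, of order 1 at r = C ln n. For an upper tail summable over all n it must
  beat a further factor n, so n^3 p^r decides the limsup and gives 3/2; along powers of 2 only a
  factor ln n has to be beaten, which costs -D ln ln n. Conversely W < r has probability about
  exp(-mean), which is larger than every negative power of n while the mean is (ln n)^e with e < 1;
  exceptional moduli then appear in short blocks, whence D in the liminf. The same factor ln n is
  lost in the matching lower bound, since progressions that do not wrap around have steps at most n
  / (2 r). The rate ln^7 n / n is r^5 Q^2 / n with r and a bound Q of n^2 p^r both of order ln n:
  about r^5 progressions meet a given one in two points, and p^(r/2) is about 1/n. The obstacle for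
  several moduli is that steps s and t may satisfy a relation with small coefficients although n and
  m differ; the relations that matter are collected in \<open>rare\<close> and affect few
  steps.\<close>

definition res :: "nat \<Rightarrow> int \<Rightarrow> nat" where
  "res n x = nat ((x - 1) mod int n) + 1"

text \<open>Base and step are integers, so that a progression can be walked backwards or reversed
  without truncated subtraction. Index 0 is the point before the progression in
  \<open>ap_ev\<close>, but its first term in \<open>has_ap\<close>.\<close>

definition ap_term :: "nat \<Rightarrow> int \<Rightarrow> int \<Rightarrow> nat \<Rightarrow> nat" where
  "ap_term n b s u = res n (b + int u * s)"

text \<open>The order n / gcd(s, n) of s modulo n exceeds K. Level r makes r + 1 consecutive terms
  distinct; level r^2 also covers products of two index differences, which arise when two steps are
  expressed through each other.\<close>

definition good_step :: "nat \<Rightarrow> nat \<Rightarrow> int \<Rightarrow> bool" where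
  "good_step n K s \<longleftrightarrow> (\<forall>k. 1 \<le> k \<and> k \<le> K \<longrightarrow> \<not> int n dvd int k * s)"

lemma res_range: "n \<ge> 1 \<Longrightarrow> res n x \<in> {1..n}"
  using pos_mod_bound[of "int n" "x - 1"] by (auto simp: res_def nat_less_iff Suc_le_eq)

lemma res_cong: "n \<ge> 1 \<Longrightarrow> int n dvd int (res n x) - x"
proof -
  assume n: "n \<ge> 1"
  have "int (res n x) = (x - 1) mod int n + 1" using n by (simp add: res_def)
  then have "int (res n x) - x = - (x - 1 - (x - 1) mod int n)" by simp
  then show ?thesis by (simp only: dvd_minus_iff dvd_minus_mod)
qed

lemma res_eq_iff: "n \<ge> 1 \<Longrightarrow> res n x = res n y \<longleftrightarrow> int n dvd x - y"
proof -
  assume n: "n \<ge> 1"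
  have "res n x = res n y \<longleftrightarrow> (x - 1) mod int n = (y - 1) mod int n"
    using n by (auto simp: res_def eq_nat_nat_iff)
  also have "\<dots> \<longleftrightarrow> int n dvd (x - 1) - (y - 1)" by (simp add: mod_eq_dvd_iff)
  finally show ?thesis by simp
qed

lemma res_idem: "1 \<le> x \<Longrightarrow> x \<le> int n \<Longrightarrow> res n x = nat x"
  by (simp add: res_def nat_add_distrib [symmetric] mod_pos_pos_trivial)

lemma cyc_res_eq: "n \<ge> 1 \<Longrightarrow> cyc_res n k = res n (int k)"
proof -
  assume n: "n \<ge> 1"
  have r: "cyc_res n k \<in> {1..n}"
    using n by (auto simp: cyc_res_def Suc_le_eq mod_greater_zero_iff_not_dvd intro: less_imp_le)
  have "int n dvd int (cyc_res n k) - int k"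
  proof (cases "n dvd k")
    case True
    then show ?thesis by (auto simp: cyc_res_def)
  next
    case False
    have "int k - int (k mod n) = int (k - k mod n)" by simp
    also have "\<dots> = int (n * (k div n))" by (simp add: minus_mod_eq_mult_div)
    finally have "int n dvd int k - int (k mod n)" by simp
    then show ?thesis using False by (simp add: cyc_res_def dvd_diff_commute)
  qed
  then have "res n (int (cyc_res n k)) = res n (int k)" using n by (simp add: res_eq_iff)
  moreover have "res n (int (cyc_res n k)) = cyc_res n k"
    using r by (subst res_idem) auto
  ultimately show ?thesis by simp
qed

lemma ap_term_range: "n \<ge> 1 \<Longrightarrow> ap_term n b s u \<in> {1..n}"
  unfolding ap_term_def by (rule res_range)

lemma ap_term_cong: "n \<ge> 1 \<Longrightarrow> int n dvd int (ap_term n b s u) - (b + int u * s)"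
  unfolding ap_term_def by (rule res_cong)

lemma ap_term_eq_iff:
  "n \<ge> 1 \<Longrightarrow> ap_term n b s u = ap_term n c t v \<longleftrightarrow> int n dvd (b + int u * s) - (c + int v * t)"
  unfolding ap_term_def by (rule res_eq_iff)

lemma good_step_mono: "good_step n K s \<Longrightarrow> K' \<le> K \<Longrightarrow> good_step n K' s"
  by (auto simp: good_step_def)

lemma good_step_int:
  assumes "good_step n K s" "int n dvd k * s" "\<bar>k\<bar> \<le> int K"
  shows "k = 0"
proof (rule ccontr)
  assume "k \<noteq> 0"
  have "int n dvd \<bar>k\<bar> * s" using assms(2) by (cases "k \<ge> 0") auto
  then have "int n dvd int (nat \<bar>k\<bar>) * s" by simp
  moreover have "1 \<le> nat \<bar>k\<bar>" "nat \<bar>k\<bar> \<le> K" using assms(3) \<open>k \<noteq> 0\<close> by linarith+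
  ultimately show False using assms(1) unfolding good_step_def by blast
qed

lemma good_step_inj:
  assumes n: "n \<ge> 1" and g: "good_step n r s"
  shows "inj_on (ap_term n b s) {0..r}"
proof (rule inj_onI)
  fix u v assume uv: "u \<in> {0..r}" "v \<in> {0..r}" "ap_term n b s u = ap_term n b s v"
  then have "int n dvd (int u - int v) * s"
    using n by (simp add: ap_term_eq_iff algebra_simps)
  then have "int u - int v = 0" using uv by (intro good_step_int[OF g]) auto
  then show "u = v" by simp
qed

lemma good_step_neg: "good_step n K s \<Longrightarrow> good_step n K (int n - s)"
proof -
  have "int n dvd int k * (int n - s) \<longleftrightarrow> int n dvd int k * s" for k
    by (simp add: right_diff_distrib dvd_diff_right_iff)
  then show "good_step n K s \<Longrightarrow> good_step n K (int n - s)" by (simp add: good_step_def)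
qed

text \<open>The quotient (k t - c) / m determines t, and it runs over integers in an interval of
  length less than |k|, because two solutions t differ by less than m.\<close>

lemma card_lin_cong:
  fixes k c :: int
  assumes m: "m \<ge> 1" and k: "k \<noteq> 0"
  shows "card {t\<in>{1..int m}. int m dvd k * t - c} \<le> nat \<bar>k\<bar>"
proof -
  let ?S = "{t\<in>{1..int m}. int m dvd k * t - c}"
  define S where "S = ?S"
  let ?f = "\<lambda>t. (k * t - c) div int m"
  have fin: "finite S" unfolding S_def by (rule finite_subset[of _ "{1..int m}"]) auto
  have f: "?f t * int m = k * t - c" if "t \<in> S" for t using that by (auto simp: S_def)
  have "inj_on ?f S"
  proof (rule inj_onI)
    fix x y assume "x \<in> S" "y \<in> S" "?f x = ?f y"
    then have "k * x - c = k * y - c" using f by metis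
    then show "x = y" using k by simp
  qed
  then have c: "card (?f ` S) = card S" by (rule card_image)
  show ?thesis
  proof (cases "S = {}")
    case True then show ?thesis unfolding S_def by (metis card.empty zero_le)
  next
    case False
    then have ne: "?f ` S \<noteq> {}" and fin': "finite (?f ` S)" using fin by auto
    define a where "a = Min (?f ` S)"
    define b where "b = Max (?f ` S)"
    obtain x where x: "x \<in> S" "a = ?f x" using Min_in[OF fin' ne] unfolding a_def by auto
    obtain y where y: "y \<in> S" "b = ?f y" using Max_in[OF fin' ne] unfolding b_def by auto
    have "(b - a) * int m = k * (y - x)"
      using f[OF x(1)] f[OF y(1)] unfolding x(2) y(2) by (simp add: algebra_simps)
    also have "\<dots> \<le> \<bar>k\<bar> * \<bar>y - x\<bar>" by (metis abs_ge_self abs_mult)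
    also have "\<dots> < \<bar>k\<bar> * int m"
    proof -
      have "\<bar>y - x\<bar> < int m" using x(1) y(1) unfolding S_def by auto
      then show ?thesis using k by simp
    qed
    finally have "b - a < \<bar>k\<bar>" using m by simp
    moreover have "?f ` S \<subseteq> {a..b}" using fin' unfolding a_def b_def by auto
    then have "card (?f ` S) \<le> card {a..b}" by (intro card_mono) auto
    ultimately have "card S \<le> nat \<bar>k\<bar>" using c by simp
    then show ?thesis unfolding S_def .
  qed
qed

lemma finite_lin_cong: "finite {t\<in>{1..int m}. int m dvd k * t - c}"
  by (rule finite_subset[of _ "{1..int m}"]) auto

lemma card_not_good:
  assumes "m \<ge> 1"
  shows "card {t\<in>{1..int m}. \<not> good_step m K t} \<le> K\<^sup>2"
proof -
  have "{t\<in>{1..int m}. \<not> good_step m K t} \<subseteq> (\<Union>k\<in>{1..K}. {t\<in>{1..int m}. int m dvd int k * t - 0})"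
    by (auto simp: good_step_def)
  then have "card {t\<in>{1..int m}. \<not> good_step m K t}
      \<le> card (\<Union>k\<in>{1..K}. {t\<in>{1..int m}. int m dvd int k * t - 0})"
    by (intro card_mono finite_UN_I finite_lin_cong) auto
  also have "\<dots> \<le> (\<Sum>k\<in>{1..K}. card {t\<in>{1..int m}. int m dvd int k * t - 0})"
    by (rule card_UN_le) simp
  also have "\<dots> \<le> (\<Sum>k\<in>{1..K}. K)"
  proof (rule sum_mono)
    fix k assume k: "k \<in> {1..K}"
    have "card {t\<in>{1..int m}. int m dvd int k * t - 0} \<le> nat \<bar>int k\<bar>"
      using k by (intro card_lin_cong assms) auto
    then show "card {t\<in>{1..int m}. int m dvd int k * t - 0} \<le> K" using k by simp
  qed
  also have "\<dots> = K\<^sup>2" by (simp add: power2_eq_square)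
  finally show ?thesis .
qed

text \<open>\<^term>\<open>t\<close> is rare for \<^term>\<open>n\<close> when progressions mod \<^term>\<open>m\<close> with step \<^term>\<open>t\<close> may share
  more than half of their terms with progressions mod \<^term>\<open>n\<close>.\<close>

definition rare :: "nat \<Rightarrow> nat \<Rightarrow> nat \<Rightarrow> int \<Rightarrow> bool" where
  "rare r n m t \<longleftrightarrow> (\<exists>w k. w \<noteq> 0 \<and> \<bar>w\<bar> \<le> int r \<and> \<bar>k\<bar> \<le> int (r\<^sup>2 + r) \<and> int m dvd k * t - w * int n)"

text \<open>Each of the 4 r (r^2 + r) admissible pairs (w, k) with k nonzero contributes at most |k|
  solutions t. The hypothesis \<open>d\<close>, that the moduli are close, excludes k = 0.\<close>

lemma card_rare:
  assumes m: "m \<ge> 1" and ne: "n \<noteq> m" and d: "int r * \<bar>int n - int m\<bar> < int m"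
  shows "card {t\<in>{1..int m}. rare r n m t} \<le> 16 * r ^ 5"
proof -
  define R where "R = r\<^sup>2 + r"
  define S where "S = ({- int r..int r} - {0}) \<times> ({- int R..int R} - {0})"
  have sub: "{t\<in>{1..int m}. rare r n m t}
      \<subseteq> (\<Union>(w,k)\<in>S. {t\<in>{1..int m}. int m dvd k * t - w * int n})"
  proof
    fix t assume "t \<in> {t\<in>{1..int m}. rare r n m t}"
    then obtain w k where t: "t \<in> {1..int m}" and w: "w \<noteq> 0" "\<bar>w\<bar> \<le> int r"
      and k: "\<bar>k\<bar> \<le> int R" "int m dvd k * t - w * int n"
      unfolding rare_def R_def by blast
    \<comment> \<open>With k = 0 the modulus m would divide w n, hence the nonzero number w (n - m),
      whose absolute value is below m by \<open>d\<close>.\<close>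
    have "k \<noteq> 0"
    proof
      assume "k = 0"
      then have "int m dvd w * int n" using k by simp
      then have "int m dvd w * int n - w * int m" by (simp add: dvd_diff)
      then have dv: "int m dvd w * (int n - int m)" by (simp add: algebra_simps)
      have "\<bar>w * (int n - int m)\<bar> \<le> int r * \<bar>int n - int m\<bar>"
        using w by (simp add: abs_mult mult_right_mono)
      also note d
      finally have "\<bar>w * (int n - int m)\<bar> < int m" .
      moreover have "w * (int n - int m) \<noteq> 0" using w ne by simp
      ultimately show False using dv
        by (metis abs_of_nat dvd_imp_le_int not_le)
    qed
    then show "t \<in> (\<Union>(w,k)\<in>S. {t\<in>{1..int m}. int m dvd k * t - w * int n})"
    proof -
      have "(w, k) \<in> S" using w k \<open>k \<noteq> 0\<close> by (auto simp: S_def)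
      then show ?thesis using t k by blast
    qed
  qed
  have finS: "finite S" by (simp add: S_def)
  have "card {t\<in>{1..int m}. rare r n m t}
      \<le> card (\<Union>x\<in>S. {t\<in>{1..int m}. int m dvd snd x * t - fst x * int n})"
    using sub by (intro card_mono finite_UN_I finite_lin_cong finS) (auto simp: case_prod_beta)
  also have "\<dots> \<le> (\<Sum>x\<in>S. card {t\<in>{1..int m}. int m dvd snd x * t - fst x * int n})"
    by (rule card_UN_le[OF finS])
  also have "\<dots> \<le> (\<Sum>x\<in>S. R)"
  proof (rule sum_mono)
    fix x assume x: "x \<in> S"
    have "card {t\<in>{1..int m}. int m dvd snd x * t - fst x * int n} \<le> nat \<bar>snd x\<bar>"
      using x by (intro card_lin_cong m) (auto simp: S_def)
    also have "\<dots> \<le> R" using x by (auto simp: S_def)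
    finally show "card {t\<in>{1..int m}. int m dvd snd x * t - fst x * int n} \<le> R" .
  qed
  also have "\<dots> = card S * R" by simp
  also have "card S = (2 * r) * (2 * R)"
    by (simp add: S_def card_cartesian_product card_Diff_subset nat_add_distrib nat_mult_distrib)
  also have "(2 * r) * (2 * R) * R \<le> 16 * r ^ 5"
  proof -
    have "r \<le> r\<^sup>2" by (cases r) (simp_all add: power2_eq_square)
    then have "R \<le> 2 * r\<^sup>2" by (simp add: R_def)
    then have "R * R \<le> (2 * r\<^sup>2) * (2 * r\<^sup>2)" by (intro mult_mono) auto
    then have "4 * r * (R * R) \<le> 4 * r * ((2 * r\<^sup>2) * (2 * r\<^sup>2))" by (rule mult_left_mono) simp
    also have "\<dots> = 16 * r ^ 5" by (simp add: power_numeral_reduce)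
    finally show ?thesis by (simp add: mult_ac)
  qed
  finally show ?thesis .
qed

section \<open>Progressions sharing more than half of their points\<close>

lemma no_consecutive_card:
  fixes G :: "nat set"
  assumes "G \<subseteq> {1..r}" "\<And>u. u \<in> G \<Longrightarrow> Suc u \<notin> G"
  shows "2 * card G \<le> r + 1"
proof -
  have fin: "finite G" using assms(1) finite_subset by blast
  have "G \<inter> Suc ` G = {}" using assms(2) by auto
  then have "card (G \<union> Suc ` G) = card G + card (Suc ` G)"
    using fin by (simp add: card_Un_disjoint)
  also have "card (Suc ` G) = card G" by (simp add: card_image)
  finally have "2 * card G = card (G \<union> Suc ` G)" by simp
  also have "\<dots> \<le> card {1..Suc r}" using assms(1) by (intro card_mono) auto
  finally show ?thesis by simp
qed

definition ones :: "nat \<Rightarrow> nat \<times> int \<times> int \<Rightarrow> nat set" where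
  "ones r i = (case i of (n, b, s) \<Rightarrow> ap_term n b s ` {1..r})"

definition supp :: "nat \<Rightarrow> nat \<times> int \<times> int \<Rightarrow> nat set" where
  "supp r i = (case i of (n, b, s) \<Rightarrow> ap_term n b s ` {0..r})"

text \<open>In an index \<open>(n, b, s)\<close>, \<open>b\<close> is the point before the progression. Requiring it to lie outside
  \<open>Y\<close> makes overlapping progressions with the same step incompatible.\<close>

definition ap_ev :: "nat \<Rightarrow> nat \<times> int \<times> int \<Rightarrow> nat set \<Rightarrow> bool" where
  "ap_ev r i Y \<longleftrightarrow> (case i of (n, b, s) \<Rightarrow> ap_term n b s 0 \<notin> Y) \<and> ones r i \<subseteq> Y"

text \<open>More than half of the indices cannot avoid two neighbours. Consecutive common terms turn
  an overlap into arithmetic: their difference is s modulo n and a small multiple of t modulo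
  m.\<close>

lemma overlap_consecutive:
  assumes n: "n \<ge> 1" and g: "good_step n r s" and m: "m \<ge> 1"
    and big: "r + 1 < 2 * card (ones r (n,b,s) \<inter> ones r' (m,c,t))"
  obtains u v v' where "u \<in> {1..r}" "Suc u \<in> {1..r}" "v \<in> {1..r'}" "v' \<in> {1..r'}"
    "ap_term n b s u = ap_term m c t v" "ap_term n b s (Suc u) = ap_term m c t v'"
proof -
  define G where "G = {u\<in>{1..r}. ap_term n b s u \<in> ones r' (m,c,t)}"
  have "ones r (n,b,s) \<inter> ones r' (m,c,t) = ap_term n b s ` G" by (auto simp: G_def ones_def)
  moreover have "inj_on (ap_term n b s) G"
    by (rule inj_on_subset[OF good_step_inj[OF n g]]) (auto simp: G_def)
  ultimately have "r + 1 < 2 * card G" using big by (simp add: card_image)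
  moreover have "G \<subseteq> {1..r}" by (auto simp: G_def)
  ultimately obtain u where "u \<in> G" "Suc u \<in> G" using no_consecutive_card[of G r] by fastforce
  then show thesis using that by (fastforce simp: G_def ones_def)
qed

lemma ones_sub_supp: "ones r i \<subseteq> supp r i"
  by (auto simp: ones_def supp_def split: prod.splits)

text \<open>A large overlap, read from both sides, gives s = k t and t = l s modulo n with |k|, |l|
  < r. Hence k l = 1, and \<open>2 * s < int n\<close> rules out s = -t, so the progressions are
  shifts of each other; then the zero in front of one of them is a required one of the
  other.\<close>

lemma same_modulus_overlap:
  assumes n: "n \<ge> 1" and r: "r \<ge> 2"
    and i: "b \<in> {1..int n}" "1 \<le> s" "2 * s < int n" "good_step n (r\<^sup>2) s"
    and j: "c \<in> {1..int n}" "1 \<le> t" "2 * t < int n" "good_step n (r\<^sup>2) t"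
    and ne: "(b, s) \<noteq> (c, t)"
  shows "(\<forall>Y. \<not> (ap_ev r (n,b,s) Y \<and> ap_ev r (n,c,t) Y)) \<or> 2 * card (ones r (n,b,s) \<inter> ones r (n,c,t)) \<le> r + 1"
proof (rule ccontr)
  assume neg: "\<not> ?thesis"
  then have big: "r + 1 < 2 * card (ones r (n,b,s) \<inter> ones r (n,c,t))" by auto
  have rr: "r \<le> r\<^sup>2" by (simp add: power2_eq_square)
  have g: "good_step n r s" "good_step n r t" using i j good_step_mono rr by blast+
  obtain u v v' where u: "u \<in> {1..r}" "Suc u \<in> {1..r}" "v \<in> {1..r}" "v' \<in> {1..r}"
    "ap_term n b s u = ap_term n c t v" "ap_term n b s (Suc u) = ap_term n c t v'"
    using overlap_consecutive[OF n g(1) n big] .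
  \<comment> \<open>The same overlap counted along the second progression, which expresses t through
    s.\<close>
  obtain x y y' where x: "x \<in> {1..r}" "Suc x \<in> {1..r}" "y \<in> {1..r}" "y' \<in> {1..r}"
    "ap_term n c t x = ap_term n b s y" "ap_term n c t (Suc x) = ap_term n b s y'"
    using overlap_consecutive[OF n g(2) n, of c r b s] big by (metis Int_commute)
  define k where "k = int v' - int v"
  define l where "l = int y' - int y"
  have kl: "\<bar>k\<bar> \<le> int r - 1" "\<bar>l\<bar> \<le> int r - 1" using u(3,4) x(3,4) by (auto simp: k_def l_def)
  have d1: "int n dvd s - k * t"
  proof -
    have "int n dvd (b + int (Suc u) * s - (c + int v' * t)) - (b + int u * s - (c + int v * t))"
      by (rule dvd_diff) (use u(5,6) n ap_term_eq_iff in blast)+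
    then show ?thesis by (simp add: k_def algebra_simps)
  qed
  have d2: "int n dvd t - l * s"
  proof -
    have "int n dvd (c + int (Suc x) * t - (b + int y' * s)) - (c + int x * t - (b + int y * s))"
      by (rule dvd_diff) (use x(5,6) n ap_term_eq_iff in blast)+
    then show ?thesis by (simp add: l_def algebra_simps)
  qed
  \<comment> \<open>Elimination of t. The resulting coefficient 1 - k l is at most 1 + (r - 1)^2 <=
    r^2 in absolute value, which is why steps are required to be good at level r^2.\<close>
  have "int n dvd (s - k * t) + k * (t - l * s)" using d1 d2 by (intro dvd_add dvd_mult)
  then have "int n dvd (1 - k * l) * s" by (simp add: algebra_simps)
  moreover have "\<bar>1 - k * l\<bar> \<le> int (r\<^sup>2)"
  proof -
    have "\<bar>1 - k * l\<bar> \<le> 1 + \<bar>k\<bar> * \<bar>l\<bar>" using abs_triangle_ineq4[of 1 "k * l"] by (simp add: abs_mult)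
    also have "\<bar>k\<bar> * \<bar>l\<bar> \<le> (int r - 1) * (int r - 1)" using kl by (intro mult_mono) auto
    also have "1 + (int r - 1) * (int r - 1) \<le> int (r\<^sup>2)"
      using r by (simp add: power2_eq_square algebra_simps)
    finally show ?thesis by simp
  qed
  ultimately have "1 - k * l = 0" by (rule good_step_int[OF i(4)])
  then have "k * l = 1" by simp
  then have "k = 1 \<or> k = -1" by (auto simp: zmult_eq_1_iff)
  have st: "s = t"
  proof (rule ccontr)
    assume "s \<noteq> t"
    from \<open>k = 1 \<or> k = -1\<close> show False
    proof
      assume "k = 1"
      then have "int n dvd s - t" using d1 by simp
      then have "int n \<le> \<bar>s - t\<bar>" using \<open>s \<noteq> t\<close> by (metis abs_of_nat dvd_imp_le_int right_minus_eq)
      then show False using i j by auto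
    next
      assume "k = -1"
      then have "int n dvd s + t" using d1 by simp
      moreover have "s + t \<noteq> 0" using i j by auto
      ultimately have "int n \<le> \<bar>s + t\<bar>" by (metis abs_of_nat dvd_imp_le_int)
      then show False using i j by auto
    qed
  qed
  have dc: "int n dvd b - c + (int u - int v) * s"
    using u(5) n st by (simp add: ap_term_eq_iff algebra_simps)
  have "u \<noteq> v"
  proof
    assume "u = v"
    then have "int n dvd b - c" using dc by simp
    moreover have "b \<noteq> c" using ne st by auto
    ultimately have "int n \<le> \<bar>b - c\<bar>" by (metis abs_of_nat dvd_imp_le_int right_minus_eq)
    then show False using i j by auto
  qed
  \<comment> \<open>Of two shifts of one progression, the point preceding the later one is a term of
    the earlier one.\<close>
  then consider "v < u" | "u < v" by linarith
  then have "\<forall>Y. \<not> (ap_ev r (n,b,s) Y \<and> ap_ev r (n,c,t) Y)"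
  proof cases
    case 1
    then have "ap_term n c t 0 = ap_term n b s (u - v)" using dc n
      by (simp add: ap_term_eq_iff of_nat_diff algebra_simps dvd_diff_commute)
    moreover have "ap_term n b s (u - v) \<in> ones r (n,b,s)" using 1 u by (auto simp: ones_def intro!: imageI)
    ultimately show ?thesis by (auto simp: ap_ev_def)
  next
    case 2
    then have "ap_term n b s 0 = ap_term n c t (v - u)" using dc n st
      by (simp add: ap_term_eq_iff of_nat_diff algebra_simps)
    moreover have "ap_term n c t (v - u) \<in> ones r (n,c,t)" using 2 u by (auto simp: ones_def intro!: imageI)
    ultimately show ?thesis by (auto simp: ap_ev_def)
  qed
  then show False using neg by blast
qed

text \<open>Two neighbouring common terms give s - e n = k t modulo m, the two extreme common terms,
  d apart, give d s - w n = k' t. Eliminating s yields (d k - k') t = (w - d e) n modulo m. The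
  bounds on s confine e to {0, 1} and w to 1 <= w < d, so w - d e is nonzero and t is rare.\<close>

lemma cross_modulus_overlap:
  assumes n: "n \<ge> 1" and m: "m \<ge> 1" and r: "r \<ge> 3"
    and s: "0 < s" "2 * s < int n" "2 * int n \<le> int r * s" "good_step n r s"
    and nr: "\<not> rare r n m t"
  shows "2 * card (ones r (n,b,s) \<inter> ones r (m,c,t)) \<le> r + 1"
proof (rule ccontr)
  assume "\<not> ?thesis"
  then have big: "r + 1 < 2 * card (ones r (n,b,s) \<inter> ones r (m,c,t))" by auto
  define X where "X u = int (ap_term n b s u)" for u
  have Xr: "1 \<le> X u" "X u \<le> int n" for u
    using ap_term_range[OF n, of b s u] by (auto simp: X_def)
  have Xd: "\<exists>w. X u' - X u = (int u' - int u) * s - w * int n" for u u'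
  proof -
    have "int n dvd ((int (ap_term n b s u') - (b + int u' * s)) - (int (ap_term n b s u) - (b + int u * s)))"
      by (intro dvd_diff ap_term_cong n)
    then obtain z where "(int (ap_term n b s u') - (b + int u' * s)) - (int (ap_term n b s u) - (b + int u * s))
      = int n * z" by (rule dvdE)
    then show ?thesis by (intro exI[of _ "-z"]) (simp add: X_def algebra_simps)
  qed
  have Xm: "int m dvd (X u' - X u) - (int v' - int v) * t"
    if "ap_term n b s u = ap_term m c t v" "ap_term n b s u' = ap_term m c t v'" for u u' v v'
  proof -
    have "int m dvd ((int (ap_term m c t v') - (c + int v' * t)) - (int (ap_term m c t v) - (c + int v * t)))"
      by (intro dvd_diff ap_term_cong m)
    then show ?thesis by (simp add: X_def that algebra_simps)
  qed
  obtain u v v' where u: "u \<in> {1..r}" "Suc u \<in> {1..r}" "v \<in> {1..r}" "v' \<in> {1..r}"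
    "ap_term n b s u = ap_term m c t v" "ap_term n b s (Suc u) = ap_term m c t v'"
    using overlap_consecutive[OF n s(4) m big] .
  define k where "k = int v' - int v"
  obtain e where e: "X (Suc u) - X u = (int (Suc u) - int u) * s - e * int n" using Xd by blast
  \<comment> \<open>The number e of passages past n in one step: the residues differ by less than n
    and 0 < s < n / 2, so e n lies strictly between -n and 2 n.\<close>
  have e01: "e = 0 \<or> e = 1"
  proof -
    have eq: "e * int n = s - (X (Suc u) - X u)" using e by simp
    have "e * int n < 2 * int n" using eq Xr[of u] Xr[of "Suc u"] s(2) s(1) by linarith
    moreover have "(-1) * int n < e * int n" using eq Xr[of u] Xr[of "Suc u"] s(1) by linarith
    ultimately have "e < 2" "-1 < e"
      using mult_right_less_imp_less[of e "int n" 2] mult_right_less_imp_less[of "-1" "int n" e] by simp_all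
    then show ?thesis by linarith
  qed
  have k1: "int m dvd s - e * int n - k * t"
    using Xm[OF u(5,6)] e by (simp add: k_def)
  define G where "G = {u\<in>{1..r}. ap_term n b s u \<in> ones r (m,c,t)}"
  have finG: "finite G" by (auto simp: G_def)
  have "ones r (n,b,s) \<inter> ones r (m,c,t) = ap_term n b s ` G" by (auto simp: G_def ones_def)
  moreover have "inj_on (ap_term n b s) G"
    by (rule inj_on_subset[OF good_step_inj[OF n s(4)]]) (auto simp: G_def)
  ultimately have cG: "r + 1 < 2 * card G" using big by (simp add: card_image)
  then have neG: "G \<noteq> {}" by auto
  define u1 where "u1 = Min G"
  define u2 where "u2 = Max G"
  have uG: "u1 \<in> G" "u2 \<in> G" using Min_in Max_in finG neG by (auto simp: u1_def u2_def)
  have "G \<subseteq> {u1..u2}" using finG by (auto simp: u1_def u2_def)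
  then have "card G \<le> card {u1..u2}" by (intro card_mono) auto
  then have cG2: "card G \<le> u2 + 1 - u1" by simp
  define d where "d = int u2 - int u1"
  \<comment> \<open>From r + 1 < 2 |G| and |G| <= d + 1.\<close>
  have d2: "int r \<le> 2 * d" using cG cG2 by (auto simp: d_def)
  then have d3: "2 \<le> d" using r by auto
  have dr: "d \<le> int r" using uG by (auto simp: d_def G_def)
  obtain v1 v2 where v: "v1 \<in> {1..r}" "v2 \<in> {1..r}" "ap_term n b s u1 = ap_term m c t v1"
    "ap_term n b s u2 = ap_term m c t v2" using uG by (auto simp: G_def ones_def)
  define k' where "k' = int v2 - int v1"
  obtain w where w: "X u2 - X u1 = d * s - w * int n" using Xd unfolding d_def by blast
  have k2: "int m dvd d * s - w * int n - k' * t"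
    using Xm[OF v(3,4)] w by (simp add: k'_def)
  \<comment> \<open>The extreme common terms are at least r / 2 steps apart and each step is at
    least 2 n / r, so at least n is travelled and the modulus is passed.\<close>
  have w1: "1 \<le> w"
  proof -
    have "int r * s \<le> 2 * d * s" using d2 s(1) by (intro mult_right_mono) auto
    then have "int n \<le> d * s" using s(3) by (simp add: mult.assoc)
    then have "0 < w * int n" using w Xr[of u1] Xr[of u2] by linarith
    then show ?thesis using n by (auto simp: zero_less_mult_iff)
  qed
  \<comment> \<open>Steps below n / 2 give 2 w < d + 2, and d + 2 <= 2 d.\<close>
  have w2: "w < d"
  proof -
    have "d * (2 * s) < d * int n" using s(2) d3 by simp
    then have "2 * (w * int n) < d * int n + 2 * int n" using w Xr[of u1] Xr[of u2] by (simp add: algebra_simps)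
    then have "(2 * w) * int n < (d + 2) * int n" by (simp add: algebra_simps)
    then have "2 * w < d + 2" using mult_right_less_imp_less[of "2 * w" "int n" "d + 2"] by simp
    then show ?thesis using d3 by linarith
  qed
  define W where "W = w - d * e"
  have W0: "W \<noteq> 0" "\<bar>W\<bar> \<le> int r" using e01 w1 w2 dr by (auto simp: W_def)
  have "int m dvd (d * s - w * int n - k' * t) - d * (s - e * int n - k * t)"
    by (rule dvd_diff[OF k2 dvd_mult[OF k1]])
  then have dv: "int m dvd (d * k - k') * t - W * int n" by (simp add: W_def algebra_simps)
  have "\<bar>d * k - k'\<bar> \<le> \<bar>d\<bar> * \<bar>k\<bar> + \<bar>k'\<bar>" using abs_triangle_ineq4[of "d * k" k'] by (simp add: abs_mult)
  also have "\<dots> \<le> int r * int r + int r"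
    using dr d3 u(3,4) v(1,2) by (intro add_mono mult_mono) (auto simp: k_def k'_def)
  finally have "\<bar>d * k - k'\<bar> \<le> int (r\<^sup>2 + r)" by (simp add: power2_eq_square)
  then have "rare r n m t" using W0 dv unfolding rare_def by blast
  then show False using nr by simp
qed

text \<open>The common points lie in {1..n} with 4 n <= m, so two consecutive common terms modulo m
  differ by less than m / 4, whereas the step t lies strictly between m / 4 and m / 2. The bound is
  therefore half the length r' of the progression with the larger modulus.\<close>

lemma small_modulus_overlap:
  assumes m: "m \<ge> 1" and nm: "4 * n \<le> m" and sub: "ones r (n,b,s) \<subseteq> {1..n}"
    and t: "int m < 4 * t" "2 * t < int m" "good_step m r' t"
  shows "2 * card (ones r (n,b,s) \<inter> ones r' (m,c,t)) \<le> r' + 1"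
proof (rule ccontr)
  assume "\<not> ?thesis"
  then have big: "r' + 1 < 2 * card (ones r' (m,c,t) \<inter> ones r (n,b,s))" by (simp add: Int_commute)
  define G where "G = {u\<in>{1..r'}. ap_term m c t u \<in> ones r (n,b,s)}"
  have "ones r' (m,c,t) \<inter> ones r (n,b,s) = ap_term m c t ` G" by (auto simp: G_def ones_def)
  moreover have "inj_on (ap_term m c t) G"
    by (rule inj_on_subset[OF good_step_inj[OF m t(3)]]) (auto simp: G_def)
  ultimately have "r' + 1 < 2 * card G" using big by (simp add: card_image)
  moreover have "G \<subseteq> {1..r'}" by (auto simp: G_def)
  ultimately obtain u where u: "u \<in> G" "Suc u \<in> G" using no_consecutive_card[of G r'] by fastforce
  let ?X = "\<lambda>u. int (ap_term m c t u)"
  have X: "1 \<le> ?X u" "?X u \<le> int n" "1 \<le> ?X (Suc u)" "?X (Suc u) \<le> int n"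
    using subsetD[OF sub, of "ap_term m c t u"] subsetD[OF sub, of "ap_term m c t (Suc u)"] u
    unfolding G_def by auto
  have "int m dvd (?X (Suc u) - (c + int (Suc u) * t)) - (?X u - (c + int u * t))"
    by (intro dvd_diff ap_term_cong m)
  then have dv: "int m dvd (?X (Suc u) - ?X u) - t" by (simp add: algebra_simps)
  define z where "z = (?X (Suc u) - ?X u) - t"
  have "z < 0" "- int m < z" using X nm t unfolding z_def by linarith+
  then have "z \<noteq> 0" "\<bar>z\<bar> < int m" by auto
  moreover have "int m dvd z" using dv unfolding z_def .
  ultimately show False by (metis abs_of_nat dvd_imp_le_int not_le)
qed

section \<open>Counting the progressions that meet a given set\<close>

definition pr_index :: "nat \<Rightarrow> (nat \<times> int \<times> int) set" where
  "pr_index m = {m} \<times> {1..int m} \<times> {1..int m}"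

lemma finite_pr_index: "finite (pr_index m)" by (simp add: pr_index_def)

text \<open>A common point, its index v in the progression and the step t determine the
  base.\<close>

lemma card_meet1:
  assumes m: "m \<ge> 1" and S: "finite S"
  shows "card {j\<in>pr_index m. supp r' j \<inter> S \<noteq> {}} \<le> card S * (r' + 1) * m"
proof -
  let ?f = "\<lambda>(x, v, t). (m, int (res m (int x - int v * t)), t)"
  have "{j\<in>pr_index m. supp r' j \<inter> S \<noteq> {}} \<subseteq> ?f ` (S \<times> {0..r'} \<times> {1..int m})"
  proof
    fix j assume "j \<in> {j\<in>pr_index m. supp r' j \<inter> S \<noteq> {}}"
    then obtain c t v where j: "j = (m, c, t)" "c \<in> {1..int m}" "t \<in> {1..int m}" "v \<in> {0..r'}"
      "ap_term m c t v \<in> S" by (fastforce simp: pr_index_def supp_def)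
    have "int m dvd (int (ap_term m c t v) - int v * t) - c"
      using ap_term_cong[OF m, of c t v] by (simp add: algebra_simps)
    then have "res m (int (ap_term m c t v) - int v * t) = res m c" using m by (simp add: res_eq_iff)
    also have "\<dots> = nat c" using j by (intro res_idem) auto
    finally have "j = ?f (ap_term m c t v, v, t)" using j by simp
    then show "j \<in> ?f ` (S \<times> {0..r'} \<times> {1..int m})" using j by blast
  qed
  then have "card {j\<in>pr_index m. supp r' j \<inter> S \<noteq> {}} \<le> card (S \<times> {0..r'} \<times> {1..int m})"
    using S by (intro surj_card_le) auto
  then show ?thesis by (simp add: card_cartesian_product algebra_simps)
qed

text \<open>Two distinct common points x, y at indices v, v' restrict the step to the solutions of
  (v' - v) t = y - x modulo m, of which there are at most r'. Thus the free choice of the step, a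
  factor m, disappears.\<close>

lemma card_meet2:
  assumes m: "m \<ge> 1" and S: "finite S"
  shows "card {j\<in>pr_index m. 2 \<le> card (supp r' j \<inter> S)} \<le> (card S)\<^sup>2 * (r' + 1)\<^sup>2 * r'"
proof -
  define D where "D = {(x, y, v, v'). x \<in> S \<and> y \<in> S \<and> v \<in> {0..r'} \<and> v' \<in> {0..r'} \<and> v \<noteq> v'}"
  let ?T = "\<lambda>(x, y, v, v'). (\<lambda>t. (m, int (res m (int x - int v * t)), t)) `
      {t\<in>{1..int m}. int m dvd (int v' - int v) * t - (int y - int x)}"
  have Dsub: "D \<subseteq> S \<times> S \<times> {0..r'} \<times> {0..r'}" by (auto simp: D_def)
  have finD: "finite D" by (rule finite_subset[OF Dsub]) (use S in auto)
  have "card D \<le> card (S \<times> S \<times> {0..r'} \<times> {0..r'})" by (intro card_mono Dsub) (use S in auto)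
  then have cD: "card D \<le> (card S)\<^sup>2 * (r' + 1)\<^sup>2"
    by (simp add: card_cartesian_product power2_eq_square algebra_simps)
  have "{j\<in>pr_index m. 2 \<le> card (supp r' j \<inter> S)} \<subseteq> (\<Union>z\<in>D. ?T z)"
  proof
    fix j assume j0: "j \<in> {j\<in>pr_index m. 2 \<le> card (supp r' j \<inter> S)}"
    then obtain c t where j: "j = (m, c, t)" "c \<in> {1..int m}" "t \<in> {1..int m}"
      by (fastforce simp: pr_index_def)
    have "\<exists>x y. x \<in> supp r' j \<inter> S \<and> y \<in> supp r' j \<inter> S \<and> x \<noteq> y"
    proof (rule ccontr)
      assume "\<not> ?thesis"
      then have "card (supp r' j \<inter> S) \<le> Suc 0" using S by (subst card_le_Suc0_iff_eq) auto
      then show False using j0 by simp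
    qed
    then obtain v v' where v: "v \<in> {0..r'}" "v' \<in> {0..r'}" "ap_term m c t v \<in> S" "ap_term m c t v' \<in> S"
      "ap_term m c t v \<noteq> ap_term m c t v'" using j by (fastforce simp: supp_def)
    let ?x = "ap_term m c t v" and ?y = "ap_term m c t v'"
    have "int m dvd (int ?x - int v * t) - c"
      using ap_term_cong[OF m, of c t v] by (simp add: algebra_simps)
    then have "res m (int ?x - int v * t) = res m c" using m by (simp add: res_eq_iff)
    also have "\<dots> = nat c" using j by (intro res_idem) auto
    finally have 1: "j = (m, int (res m (int ?x - int v * t)), t)" using j by simp
    have "int m dvd (int ?x - (c + int v * t)) - (int ?y - (c + int v' * t))"
      by (intro dvd_diff ap_term_cong m)
    then have "int m dvd (int v' - int v) * t - (int ?y - int ?x)" by (simp add: algebra_simps)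
    then have "j \<in> ?T (?x, ?y, v, v')" using 1 j by auto
    moreover have "(?x, ?y, v, v') \<in> D" using v by (auto simp: D_def)
    ultimately show "j \<in> (\<Union>z\<in>D. ?T z)" by blast
  qed
  then have "card {j\<in>pr_index m. 2 \<le> card (supp r' j \<inter> S)} \<le> card (\<Union>z\<in>D. ?T z)"
    by (intro card_mono finite_UN_I finD) (simp_all only: case_prod_beta finite_imageI finite_lin_cong)
  also have "\<dots> \<le> (\<Sum>z\<in>D. card (?T z))" by (rule card_UN_le[OF finD])
  also have "\<dots> \<le> (\<Sum>z\<in>D. r')"
  proof (rule sum_mono)
    fix z assume "z \<in> D"
    then obtain x y v v' where z: "z = (x, y, v, v')" "v \<in> {0..r'}" "v' \<in> {0..r'}" "v \<noteq> v'"
      by (auto simp: D_def)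
    have "card (?T z) \<le> card {t\<in>{1..int m}. int m dvd (int v' - int v) * t - (int y - int x)}"
      unfolding z by (simp del: atLeastAtMost_iff add: card_image_le finite_lin_cong)
    also have "\<dots> \<le> nat \<bar>int v' - int v\<bar>" using z by (intro card_lin_cong m) auto
    also have "\<dots> \<le> r'" using z by auto
    finally show "card (?T z) \<le> r'" .
  qed
  also have "\<dots> = card D * r'" by simp
  also have "\<dots> \<le> (card S)\<^sup>2 * (r' + 1)\<^sup>2 * r'" using cD by simp
  finally show ?thesis .
qed

section \<open>Sieve and second moment\<close>

text \<open>Induction over the events. Adding A x lowers the probability of no event by P(A x and no
  event in F); since A x is independent of its non-neighbours, this differs from P(A x) P(no event
  in F) by at most the contribution of the neighbours. The error inherited from F is multiplied by 1
  - P(A x) <= 1 and so does not grow.\<close>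

lemma (in prob_space) sieve:
  assumes fin: "finite I" and ev: "\<And>i. i \<in> I \<Longrightarrow> A i \<in> events"
    and ind: "\<And>i J. i \<in> I \<Longrightarrow> J \<subseteq> I \<Longrightarrow> (\<And>j. j \<in> J \<Longrightarrow> \<not> nb i j) \<Longrightarrow>
       prob (A i \<inter> (space M - (\<Union>j\<in>J. A j))) = prob (A i) * prob (space M - (\<Union>j\<in>J. A j))"
  shows "\<bar>prob (space M - (\<Union>i\<in>I. A i)) - (\<Prod>i\<in>I. 1 - prob (A i))\<bar>
     \<le> (\<Sum>i\<in>I. \<Sum>j\<in>{j\<in>I - {i}. nb i j}. prob (A i) * prob (A j) + prob (A i \<inter> A j))"
  using assms
proof (induction I)
  case empty
  then show ?case by (simp add: prob_space)
next
  case (insert x F)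
  let ?N = "\<lambda>J. space M - (\<Union>j\<in>J. A j)"
  let ?e = "\<lambda>i j. prob (A i) * prob (A j) + prob (A i \<inter> A j)"
  define J where "J = {j\<in>F. \<not> nb x j}"
  define B where "B = {j\<in>F. nb x j}"
  have finJ: "finite J" "finite B" using insert.hyps by (auto simp: J_def B_def)
  have F: "F = J \<union> B" by (auto simp: J_def B_def)
  have Aev: "A j \<in> events" if "j \<in> F" for j using that insert.prems(1) by blast
  have Ax: "A x \<in> events" using insert.prems(1) by blast
  have Nev: "?N K \<in> events" if "K \<subseteq> F" for K
    using that insert.hyps(1) finite_subset by (intro sets.Diff sets.top sets.finite_UN) (auto intro: Aev)
  have Bsub: "B \<subseteq> F" "J \<subseteq> F" by (auto simp: B_def J_def)
  have nn: "0 \<le> ?e i j" for i j by simp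
  have N: "?N J \<in> events" "?N F \<in> events" "?N B \<in> events" using Nev Bsub by blast+
  have UB: "(\<Union>j\<in>B. A j) \<in> events" "(\<Union>j\<in>B. A x \<inter> A j) \<in> events"
    using finJ Aev Bsub Ax by (auto intro!: sets.finite_UN)
  have sub: "?N F \<subseteq> ?N J" "?N J \<subseteq> ?N F \<union> (\<Union>j\<in>B. A j)"
    "A x \<inter> ?N J \<subseteq> (A x \<inter> ?N F) \<union> (\<Union>j\<in>B. A x \<inter> A j)" using F by auto
  have 1: "prob (?N (insert x F)) = prob (?N F) - prob (A x \<inter> ?N F)"
  proof -
    have "?N (insert x F) = ?N F - A x \<inter> ?N F" by auto
    then show ?thesis using finite_measure_Diff[of "?N F" "A x \<inter> ?N F"] Nev Ax by auto
  qed
  have indx: "prob (A x \<inter> ?N J) = prob (A x) * prob (?N J)"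
    by (rule insert.prems(2)) (auto simp: J_def)
  \<comment> \<open>Neighbours are dropped inside the joint event, and restored in the second factor
    after independence has been used.\<close>
  have up: "prob (A x \<inter> ?N F) \<le> prob (A x) * prob (?N F) + (\<Sum>j\<in>B. prob (A x) * prob (A j))"
  proof -
    have "prob (A x \<inter> ?N F) \<le> prob (A x \<inter> ?N J)"
      using Ax N sub by (intro finite_measure_mono) auto
    also note indx
    also have "prob (?N J) \<le> prob (?N F \<union> (\<Union>j\<in>B. A j))"
      using N UB sub by (intro finite_measure_mono sets.Un) auto
    also have "\<dots> \<le> prob (?N F) + prob (\<Union>j\<in>B. A j)"
      using N UB by (intro measure_Un_le) auto
    also have "prob (\<Union>j\<in>B. A j) \<le> (\<Sum>j\<in>B. prob (A j))"
      using finJ Aev Bsub by (intro finite_measure_subadditive_finite) auto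
    finally show ?thesis by (simp add: mult_left_mono sum_distrib_left distrib_left)
  qed
  \<comment> \<open>Here they are dropped in the product and restored in the joint event, which
    produces the terms P(A x and A j).\<close>
  have lo: "prob (A x) * prob (?N F) - (\<Sum>j\<in>B. prob (A x \<inter> A j)) \<le> prob (A x \<inter> ?N F)"
  proof -
    have "prob (A x) * prob (?N F) \<le> prob (A x) * prob (?N J)"
      using N sub by (intro mult_left_mono finite_measure_mono) auto
    also have "\<dots> = prob (A x \<inter> ?N J)" by (simp add: indx)
    also have "\<dots> \<le> prob ((A x \<inter> ?N F) \<union> (\<Union>j\<in>B. A x \<inter> A j))"
      using N Ax UB sub by (intro finite_measure_mono sets.Un sets.Int) auto
    also have "\<dots> \<le> prob (A x \<inter> ?N F) + prob (\<Union>j\<in>B. A x \<inter> A j)"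
      using N Ax UB by (intro measure_Un_le sets.Int) auto
    also have "prob (\<Union>j\<in>B. A x \<inter> A j) \<le> (\<Sum>j\<in>B. prob (A x \<inter> A j))"
      using finJ Aev Ax Bsub by (intro finite_measure_subadditive_finite) auto
    finally show ?thesis by simp
  qed
  have s1: "(\<Sum>j\<in>B. prob (A x) * prob (A j)) \<le> (\<Sum>j\<in>B. ?e x j)"
    "(\<Sum>j\<in>B. prob (A x \<inter> A j)) \<le> (\<Sum>j\<in>B. ?e x j)" by (auto intro!: sum_mono)
  have P: "\<bar>prob (?N (insert x F)) - (1 - prob (A x)) * prob (?N F)\<bar> \<le> (\<Sum>j\<in>B. ?e x j)"
    using 1 up lo s1 by (simp add: abs_le_iff algebra_simps)
  have IH: "\<bar>prob (?N F) - (\<Prod>i\<in>F. 1 - prob (A i))\<bar> \<le> (\<Sum>i\<in>F. \<Sum>j\<in>{j\<in>F - {i}. nb i j}. ?e i j)"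
    by (rule insert.IH; (rule insert.prems)?) blast+
  have "\<bar>(1 - prob (A x)) * (prob (?N F) - (\<Prod>i\<in>F. 1 - prob (A i)))\<bar>
      \<le> 1 * \<bar>prob (?N F) - (\<Prod>i\<in>F. 1 - prob (A i))\<bar>"
    unfolding abs_mult by (intro mult_right_mono) (auto simp: prob_le_1)
  with IH have IH': "\<bar>(1 - prob (A x)) * prob (?N F) - (1 - prob (A x)) * (\<Prod>i\<in>F. 1 - prob (A i))\<bar>
      \<le> (\<Sum>i\<in>F. \<Sum>j\<in>{j\<in>F - {i}. nb i j}. ?e i j)"
    by (simp add: right_diff_distrib)
  have "\<bar>prob (?N (insert x F)) - (\<Prod>i\<in>insert x F. 1 - prob (A i))\<bar>
      \<le> (\<Sum>j\<in>B. ?e x j) + (\<Sum>i\<in>F. \<Sum>j\<in>{j\<in>F - {i}. nb i j}. ?e i j)"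
    using P IH' insert.hyps by simp
  also have "\<dots> \<le> (\<Sum>j\<in>{j\<in>insert x F - {x}. nb x j}. ?e x j)
      + (\<Sum>i\<in>F. \<Sum>j\<in>{j\<in>insert x F - {i}. nb i j}. ?e i j)"
    using insert.hyps by (intro add_mono sum_mono sum_mono2 nn) (auto simp: B_def)
  also have "\<dots> = (\<Sum>i\<in>insert x F. \<Sum>j\<in>{j\<in>insert x F - {i}. nb i j}. ?e i j)"
    using insert.hyps by (intro sum.insert[symmetric])
  finally show ?case .
qed

text \<open>Factors are exchanged one at a time; exp(-y) and 1 - y differ by at most y^2 on [0, 1],
  and all remaining factors are at most 1.\<close>

lemma prod_one_minus_exp:
  fixes f :: "'b \<Rightarrow> real"
  assumes "finite I" "\<And>i. i \<in> I \<Longrightarrow> 0 \<le> f i" "\<And>i. i \<in> I \<Longrightarrow> f i \<le> 1"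
  shows "\<bar>(\<Prod>i\<in>I. 1 - f i) - exp (- (\<Sum>i\<in>I. f i))\<bar> \<le> (\<Sum>i\<in>I. (f i)\<^sup>2)"
  using assms
proof (induction I)
  case (insert x F)
  have e: "\<bar>exp (- y) - (1 - y)\<bar> \<le> y\<^sup>2" if "0 \<le> y" "y \<le> 1" for y :: real
  proof -
    have "1 - y \<le> exp (- y)" using exp_ge_add_one_self[of "-y"] by simp
    moreover have "exp (- y) \<le> 1 - y + y\<^sup>2"
    proof -
      have "1 + y \<le> exp y" by (rule exp_ge_add_one_self)
      then have "exp (- y) \<le> 1 / (1 + y)" using that by (simp add: exp_minus divide_inverse le_imp_inverse_le)
      also have "\<dots> \<le> 1 - y + y\<^sup>2"
        using that by (simp add: divide_le_eq) (simp add: algebra_simps power2_eq_square)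
      finally show ?thesis .
    qed
    ultimately show ?thesis by (simp add: abs_le_iff)
  qed
  let ?P = "\<Prod>i\<in>F. 1 - f i" and ?E = "exp (- (\<Sum>i\<in>F. f i))"
  have P: "0 \<le> ?P" "?P \<le> 1" using insert.prems by (auto intro!: prod_nonneg prod_le_1)
  have E: "0 < exp (- f x)" "exp (- f x) \<le> 1" using insert.prems by auto
  have "(\<Prod>i\<in>insert x F. 1 - f i) - exp (- (\<Sum>i\<in>insert x F. f i))
      = ((1 - f x) - exp (- f x)) * ?P + exp (- f x) * (?P - ?E)"
    using insert.hyps by (simp add: exp_add exp_minus exp_diff algebra_simps divide_inverse)
  also have "\<bar>\<dots>\<bar> \<le> \<bar>(1 - f x) - exp (- f x)\<bar> * \<bar>?P\<bar> + \<bar>exp (- f x)\<bar> * \<bar>?P - ?E\<bar>"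
    by (metis abs_mult abs_triangle_ineq)
  also have "\<dots> \<le> (f x)\<^sup>2 * 1 + 1 * (\<Sum>i\<in>F. (f i)\<^sup>2)"
    using P E e[of "f x"] insert by (intro add_mono mult_mono) (auto simp: abs_minus_commute)
  finally show ?case using insert.hyps by simp
qed simp

text \<open>Chebyshev's inequality for the number S of occurring events: where S = 0, its squared
  deviation from the mean m is m^2.\<close>

lemma (in prob_space) second_moment:
  assumes fin: "finite I" and ev: "\<And>i. i \<in> I \<Longrightarrow> A i \<in> events"
    and m: "0 < (\<Sum>i\<in>I. prob (A i))"
  shows "prob (space M - (\<Union>i\<in>I. A i)) \<le> (\<Sum>i\<in>I. \<Sum>j\<in>I. prob (A i \<inter> A j)) / (\<Sum>i\<in>I. prob (A i))\<^sup>2 - 1"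
proof -
  define m where "m = (\<Sum>i\<in>I. prob (A i))"
  define S where "S \<omega> = (\<Sum>i\<in>I. indicator (A i) \<omega> :: real)" for \<omega>
  let ?N = "space M - (\<Union>i\<in>I. A i)"
  have Nev: "?N \<in> events" using fin ev by (intro sets.Diff sets.top sets.finite_UN) auto
  have S2: "(S \<omega> - m)\<^sup>2 = (\<Sum>i\<in>I. \<Sum>j\<in>I. indicator (A i \<inter> A j) \<omega>) - 2 * m * S \<omega> + m\<^sup>2" for \<omega>
    by (simp add: S_def power2_diff power2_eq_square sum_product indicator_inter_arith algebra_simps)
  have i1: "integrable M (\<lambda>\<omega>. indicator (A i \<inter> A j) \<omega> :: real)" if "i \<in> I" "j \<in> I" for i j
    using ev that by (intro integrable_real_indicator) (auto simp: emeasure_eq_measure)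
  have i2: "integrable M (\<lambda>\<omega>. indicator (A i) \<omega> :: real)" if "i \<in> I" for i
    using ev that by (intro integrable_real_indicator) (auto simp: emeasure_eq_measure)
  have iS: "integrable M S" unfolding S_def by (intro Bochner_Integration.integrable_sum i2)
  have iSS: "integrable M (\<lambda>\<omega>. \<Sum>i\<in>I. \<Sum>j\<in>I. indicator (A i \<inter> A j) \<omega> :: real)"
    by (intro Bochner_Integration.integrable_sum i1)
  have eS: "expectation S = m"
    unfolding S_def m_def using ev i2 by (subst Bochner_Integration.integral_sum) (auto intro!: sum.cong)
  have eSS: "expectation (\<lambda>\<omega>. \<Sum>i\<in>I. \<Sum>j\<in>I. indicator (A i \<inter> A j) \<omega> :: real) = (\<Sum>i\<in>I. \<Sum>j\<in>I. prob (A i \<inter> A j))"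
    using ev i1 by (subst Bochner_Integration.integral_sum)
      (auto intro!: sum.cong Bochner_Integration.integrable_sum simp: Bochner_Integration.integral_sum)
  have "m\<^sup>2 * prob ?N = expectation (\<lambda>\<omega>. m\<^sup>2 * indicator ?N \<omega>)"
    using Nev by simp
  also have "\<dots> \<le> expectation (\<lambda>\<omega>. (S \<omega> - m)\<^sup>2)"
  proof (rule integral_mono)
    show "integrable M (\<lambda>\<omega>. m\<^sup>2 * indicator ?N \<omega>)" 
      using Nev by (intro integrable_mult_right integrable_real_indicator) (auto simp: emeasure_eq_measure)
    show "integrable M (\<lambda>\<omega>. (S \<omega> - m)\<^sup>2)" unfolding S2
      by (intro Bochner_Integration.integrable_add Bochner_Integration.integrable_diff iSS integrable_mult_right iS) simp
    show "m\<^sup>2 * indicator ?N \<omega> \<le> (S \<omega> - m)\<^sup>2" if "\<omega> \<in> space M" for \<omega>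
    proof (cases "\<omega> \<in> ?N")
      case True
      then have "S \<omega> = 0" by (auto simp: S_def)
      then show ?thesis by (auto simp: indicator_def)
    next
      case False
      then show ?thesis by simp
    qed
  qed
  also have "\<dots> = (\<Sum>i\<in>I. \<Sum>j\<in>I. prob (A i \<inter> A j)) - 2 * m * m + m\<^sup>2"
    unfolding S2 using iS iSS eS eSS
    by (simp add: prob_space)
  also have "\<dots> = (\<Sum>i\<in>I. \<Sum>j\<in>I. prob (A i \<inter> A j)) - m\<^sup>2" by (simp add: power2_eq_square)
  finally have "m\<^sup>2 * prob ?N \<le> (\<Sum>i\<in>I. \<Sum>j\<in>I. prob (A i \<inter> A j)) - m\<^sup>2" .
  moreover have "0 < m\<^sup>2" using m by (simp add: m_def)
  ultimately have "prob ?N \<le> ((\<Sum>i\<in>I. \<Sum>j\<in>I. prob (A i \<inter> A j)) - m\<^sup>2) / m\<^sup>2"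
    by (simp add: pos_le_divide_eq mult.commute)
  then show ?thesis using \<open>0 < m\<^sup>2\<close> by (simp add: diff_divide_distrib m_def)
qed

text \<open>The rank \<open>h\<close> lets each dependent pair be estimated in one order only, at
  the price of the factor 2. It will be the modulus: for unequal lengths the overlap is controlled
  by the progression with the larger modulus.\<close>

lemma (in prob_space) second_moment_indep:
  fixes h :: "'b \<Rightarrow> nat"
  assumes fin: "finite I" and ev: "\<And>i. i \<in> I \<Longrightarrow> A i \<in> events"
    and m: "0 < (\<Sum>i\<in>I. prob (A i))"
    and sym: "\<And>i j. nb i j \<longleftrightarrow> nb j i"
    and ind: "\<And>i j. i \<in> I \<Longrightarrow> j \<in> I \<Longrightarrow> \<not> nb i j \<Longrightarrow> prob (A i \<inter> A j) = prob (A i) * prob (A j)"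
  shows "prob (space M - (\<Union>i\<in>I. A i)) \<le> ((\<Sum>i\<in>I. prob (A i))
      + 2 * (\<Sum>i\<in>I. \<Sum>j\<in>{j\<in>I - {i}. h i \<le> h j \<and> nb i j}. prob (A i \<inter> A j))) / (\<Sum>i\<in>I. prob (A i))\<^sup>2"
proof -
  define m where "m = (\<Sum>i\<in>I. prob (A i))"
  define f where "f i j = (if nb i j then prob (A i \<inter> A j) else 0)" for i j
  define g where "g i j = (if i \<noteq> j \<and> h i \<le> h j then f i j else 0)" for i j
  have fs: "f i j = f j i" for i j using sym by (auto simp: f_def Int_commute)
  have g0: "0 \<le> g i j" for i j by (auto simp: g_def f_def)
  have 1: "prob (A i \<inter> A j) \<le> prob (A i) * prob (A j) + (if i = j then prob (A i) else 0) + g i j + g j i"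
    if "i \<in> I" "j \<in> I" for i j
  proof (cases "i = j")
    case True then show ?thesis using g0[of i j] by simp
  next
    case False
    show ?thesis
    proof (cases "nb i j")
      case True
      then have "prob (A i \<inter> A j) \<le> g i j + g j i"
        using False fs[of i j] by (auto simp: g_def f_def)
      also have "\<dots> \<le> prob (A i) * prob (A j) + \<dots>" by simp
      finally show ?thesis using False by simp
    next
      case nb: False
      then show ?thesis using False ind[OF that nb] g0[of i j] g0[of j i] by simp
    qed
  qed
  have "(\<Sum>i\<in>I. \<Sum>j\<in>I. prob (A i \<inter> A j))
      \<le> (\<Sum>i\<in>I. \<Sum>j\<in>I. prob (A i) * prob (A j) + (if i = j then prob (A i) else 0) + g i j + g j i)"
    by (intro sum_mono 1)
  also have "\<dots> = m\<^sup>2 + m + (\<Sum>i\<in>I. \<Sum>j\<in>I. g i j) + (\<Sum>i\<in>I. \<Sum>j\<in>I. g j i)"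
    using fin by (simp add: sum.distrib m_def power2_eq_square sum_product)
  also have "(\<Sum>i\<in>I. \<Sum>j\<in>I. g j i) = (\<Sum>i\<in>I. \<Sum>j\<in>I. g i j)" by (rule sum.swap)
  also have "(\<Sum>i\<in>I. \<Sum>j\<in>I. g i j)
      = (\<Sum>i\<in>I. \<Sum>j\<in>{j\<in>I - {i}. h i \<le> h j \<and> nb i j}. prob (A i \<inter> A j))"
  proof (rule sum.cong[OF refl])
    fix i
    show "(\<Sum>j\<in>I. g i j) = (\<Sum>j\<in>{j\<in>I - {i}. h i \<le> h j \<and> nb i j}. prob (A i \<inter> A j))"
      using fin by (intro sum.mono_neutral_cong_right) (auto simp: g_def f_def)
  qed
  finally have "(\<Sum>i\<in>I. \<Sum>j\<in>I. prob (A i \<inter> A j)) \<le> m\<^sup>2 + (m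
      + 2 * (\<Sum>i\<in>I. \<Sum>j\<in>{j\<in>I - {i}. h i \<le> h j \<and> nb i j}. prob (A i \<inter> A j)))" (is "?L \<le> m\<^sup>2 + ?R")
    by simp
  then have "?L / m\<^sup>2 \<le> (m\<^sup>2 + ?R) / m\<^sup>2" by (rule divide_right_mono) simp
  also have "\<dots> = 1 + ?R / m\<^sup>2" using m by (simp add: add_divide_distrib m_def)
  finally show ?thesis using second_moment[OF fin ev m] by (simp add: m_def)
qed

text \<open>Each tail union has probability at least the limit 1. This stands in for the second
  Borel-Cantelli lemma, as the events it is applied to are dependent.\<close>

lemma (in prob_space) AE_frequently_of_prob_tendsto_1:
  assumes ev: "\<And>n. B n \<in> events" and lim: "(\<lambda>n. prob (B n)) \<longlonglongrightarrow> 1"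
  shows "AE \<omega> in M. \<exists>\<^sub>F n in sequentially. \<omega> \<in> B n"
proof -
  have "AE \<omega> in M. \<omega> \<in> (\<Union>n\<in>{k..}. B n)" for k
  proof -
    have e: "(\<Union>n\<in>{k..}. B n) \<in> events" using ev by auto
    have "1 \<le> prob (\<Union>n\<in>{k..}. B n)"
      by (rule LIMSEQ_le_const2[OF lim])
        (use e in \<open>auto intro!: exI[of _ k] finite_measure_mono\<close>)
    then have "prob (\<Union>n\<in>{k..}. B n) = 1" using prob_le_1 by (simp add: antisym)
    then show ?thesis using e by (simp add: prob_eq_1)
  qed
  then have "AE \<omega> in M. \<forall>k. \<omega> \<in> (\<Union>n\<in>{k..}. B n)" unfolding AE_all_countable by blast
  then show ?thesis by eventually_elim (auto simp: frequently_sequentially)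
qed

lemma (in prob_space) AE_eventually_not:
  assumes ev: "\<And>n. B n \<in> events" and s: "summable b" and b: "\<forall>\<^sub>F n in sequentially. prob (B n) \<le> b n"
  shows "AE \<omega> in M. \<forall>\<^sub>F n in sequentially. \<omega> \<notin> B n"
proof -
  have "summable (\<lambda>n. prob (B n))"
    by (rule summable_comparison_test_ev[OF _ s]) (use b in \<open>auto elim: eventually_mono\<close>)
  then have "AE \<omega> in M. \<forall>\<^sub>F n in sequentially. \<omega> \<in> space M - B n"
    by (intro borel_cantelli_AE1 ev) (simp_all add: emeasure_eq_measure)
  then show ?thesis by eventually_elim (auto elim: eventually_mono)
qed

section \<open>Events depending on finitely many trials\<close>

locale bernoulli_sequence = prob_space M for M :: "'a measure" +
  fixes \<xi> :: "nat \<Rightarrow> 'a \<Rightarrow> real" and p q :: real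
  assumes p0: "0 < p" and p1: "p < 1" and q_def: "q = 1 - p"
    and indep: "indep_vars (\<lambda>_. borel) \<xi> {1..}"
    and prob_one: "\<And>i. i \<ge> 1 \<Longrightarrow> \<P>(\<omega> in M. \<xi> i \<omega> = 1) = p"
begin

definition X :: "'a \<Rightarrow> nat set" where "X \<omega> = {i. \<xi> i \<omega> = 1}"

definition event :: "(nat set \<Rightarrow> bool) \<Rightarrow> 'a set" where
  "event Q = {\<omega> \<in> space M. Q (X \<omega>)}"

abbreviation Pr :: "(nat set \<Rightarrow> bool) \<Rightarrow> real" where
  "Pr Q \<equiv> prob (event Q)"

text \<open>Events are predicates of the random set of ones, so that independence reduces to
  disjointness of finite index sets. Index 0 is excluded because independence is assumed from 1
  on.\<close>

definition depends_on :: "nat set \<Rightarrow> (nat set \<Rightarrow> bool) \<Rightarrow> bool" where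
  "depends_on S Q \<longleftrightarrow> finite S \<and> S \<subseteq> {1..} \<and> (\<forall>Y. Q Y \<longleftrightarrow> Q (Y \<inter> S))"

lemma q01: "0 < q" "q < 1" using p0 p1 q_def by auto

lemma pat_prob:
  assumes "finite S" "S \<subseteq> {1..}" "U \<subseteq> S"
  shows "event (\<lambda>Y. Y \<inter> S = U) \<in> events" "Pr (\<lambda>Y. Y \<inter> S = U) = p ^ card U * q ^ card (S - U)"
proof -
  \<comment> \<open>A trial outside U is described by the complement of {1}, since membership in
    \<open>X\<close> only asks for the value 1.\<close>
  let ?B = "\<lambda>i. if i \<in> U then {1} else - {1::real}"
  have rv: "\<xi> i \<in> borel_measurable M" if "i \<in> S" for i
    using indep assms(2) that unfolding indep_vars_def by auto
  have m: "\<xi> i -` ?B i \<inter> space M \<in> events" if "i \<in> S" for i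
    by (rule measurable_sets[OF rv[OF that]]) auto
  have pi: "prob (\<xi> i -` ?B i \<inter> space M) = (if i \<in> U then p else q)" if "i \<in> S" for i
  proof -
    have e: "\<xi> i -` {1} \<inter> space M \<in> events"
      by (rule measurable_sets[OF rv[OF that]]) auto
    have "{\<omega> \<in> space M. \<xi> i \<omega> = 1} = \<xi> i -` {1} \<inter> space M" by auto
    then have 1: "prob (\<xi> i -` {1} \<inter> space M) = p" using prob_one[of i] assms(2) that by auto
    have "\<xi> i -` (- {1}) \<inter> space M = space M - \<xi> i -` {1} \<inter> space M" by auto
    then have "prob (\<xi> i -` (- {1}) \<inter> space M) = q" using prob_compl[OF e] 1 by (simp add: q_def)
    with 1 show ?thesis by simp
  qed
  have "event (\<lambda>Y. Y \<inter> S = U) \<in> events \<and> Pr (\<lambda>Y. Y \<inter> S = U) = p ^ card U * q ^ card (S - U)"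
  proof (cases "S = {}")
    case True
    then show ?thesis using assms(3) by (simp add: event_def prob_space)
  next
    case False
    have eq: "event (\<lambda>Y. Y \<inter> S = U) = (\<Inter>i\<in>S. \<xi> i -` ?B i \<inter> space M)"
      using False assms(3) by (auto simp: event_def X_def split: if_splits)
    have "prob (\<Inter>i\<in>S. \<xi> i -` ?B i \<inter> space M) = (\<Prod>i\<in>S. prob (\<xi> i -` ?B i \<inter> space M))"
      by (rule indep_varsD[OF indep False assms(1,2)]) auto
    also have "\<dots> = (\<Prod>i\<in>S. if i \<in> U then p else q)" by (rule prod.cong[OF refl pi])
    also have "\<dots> = (\<Prod>i\<in>S \<inter> U. p) * (\<Prod>i\<in>S - U. q)"
      using assms(1) by (subst prod.If_cases) (auto simp: Diff_eq)
    also have "\<dots> = p ^ card U * q ^ card (S - U)" using assms(3) by (simp add: Int_absorb1)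
    finally have "prob (event (\<lambda>Y. Y \<inter> S = U)) = p ^ card U * q ^ card (S - U)"
      by (simp only: eq)
    moreover have "(\<Inter>i\<in>S. \<xi> i -` ?B i \<inter> space M) \<in> events"
      by (rule sets.finite_INT[OF assms(1) False m])
    ultimately show ?thesis by (simp only: eq)
  qed
  then show "event (\<lambda>Y. Y \<inter> S = U) \<in> events" "Pr (\<lambda>Y. Y \<inter> S = U) = p ^ card U * q ^ card (S - U)" by auto
qed

lemma event_eq_UN:
  assumes "depends_on S Q"
  shows "event Q = (\<Union>U\<in>{U\<in>Pow S. Q U}. event (\<lambda>Y. Y \<inter> S = U))"
  using assms unfolding depends_on_def event_def by fastforce

lemma event_measurable: "depends_on S Q \<Longrightarrow> event Q \<in> events"
  by (subst event_eq_UN) (auto intro!: sets.finite_UN pat_prob simp: depends_on_def)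

lemma depends_on_Un:
  assumes "depends_on S Q" "depends_on T R"
  shows "depends_on (S \<union> T) (\<lambda>Y. Q Y \<and> R Y)"
proof -
  have "Q Y = Q (Y \<inter> (S \<union> T))" "R Y = R (Y \<inter> (S \<union> T))" for Y
  proof -
    have "Q (Y \<inter> (S \<union> T)) = Q (Y \<inter> (S \<union> T) \<inter> S)" "R (Y \<inter> (S \<union> T)) = R (Y \<inter> (S \<union> T) \<inter> T)"
      "Q Y = Q (Y \<inter> S)" "R Y = R (Y \<inter> T)"
      using assms unfolding depends_on_def by blast+
    moreover have "Y \<inter> (S \<union> T) \<inter> S = Y \<inter> S" "Y \<inter> (S \<union> T) \<inter> T = Y \<inter> T" by auto
    ultimately show "Q Y = Q (Y \<inter> (S \<union> T))" "R Y = R (Y \<inter> (S \<union> T))" by simp_all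
  qed
  then show ?thesis using assms unfolding depends_on_def by blast
qed

text \<open>Both events split into finitely many exact patterns on S and on T, and for disjoint S
  and T the pattern probabilities multiply by \<open>pat_prob\<close>.\<close>

lemma event_indep:
  assumes Q: "depends_on S Q" and R: "depends_on T R" and d: "S \<inter> T = {}"
  shows "Pr (\<lambda>Y. Q Y \<and> R Y) = Pr Q * Pr R"
proof -
  let ?A = "\<lambda>U. event (\<lambda>Y. Y \<inter> S = U)" and ?B = "\<lambda>V. event (\<lambda>Y. Y \<inter> T = V)"
  define PS where "PS = {U\<in>Pow S. Q U}"
  define PT where "PT = {V\<in>Pow T. R V}"
  have fin: "finite S" "finite T" "S \<subseteq> {1..}" "T \<subseteq> {1..}" using Q R by (auto simp: depends_on_def)
  have finP: "finite PS" "finite PT" using fin by (auto simp: PS_def PT_def)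
  have AB: "prob (?A U \<inter> ?B V) = prob (?A U) * prob (?B V)" "?A U \<inter> ?B V \<in> events"
    if "U \<subseteq> S" "V \<subseteq> T" for U V
  proof -
    have "?A U \<inter> ?B V = event (\<lambda>Y. Y \<inter> (S \<union> T) = U \<union> V)"
      using that d by (auto simp: event_def)
    moreover have "Pr (\<lambda>Y. Y \<inter> (S \<union> T) = U \<union> V) = p ^ card (U \<union> V) * q ^ card (S \<union> T - (U \<union> V))"
      by (rule pat_prob(2)) (use fin that in auto)
    moreover have "card (U \<union> V) = card U + card V"
      using that d fin by (intro card_Un_disjoint) (auto intro: finite_subset)
    moreover have "card (S \<union> T - (U \<union> V)) = card (S - U) + card (T - V)"
    proof -
      have "S \<union> T - (U \<union> V) = (S - U) \<union> (T - V)" using that d by auto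
      then show ?thesis using that d fin by (simp add: card_Un_disjoint) (subst card_Un_disjoint, auto)
    qed
    ultimately show "prob (?A U \<inter> ?B V) = prob (?A U) * prob (?B V)"
      using pat_prob(2)[OF fin(1,3) that(1)] pat_prob(2)[OF fin(2,4) that(2)] by (simp add: power_add)
    show "?A U \<inter> ?B V \<in> events" using pat_prob(1) fin that by auto
  qed
  have "event (\<lambda>Y. Q Y \<and> R Y) = event Q \<inter> event R" by (auto simp: event_def)
  also have "\<dots> = (\<Union>z\<in>PS \<times> PT. ?A (fst z) \<inter> ?B (snd z))"
    unfolding event_eq_UN[OF Q] event_eq_UN[OF R] PS_def[symmetric] PT_def[symmetric] by auto
  finally have "Pr (\<lambda>Y. Q Y \<and> R Y) = prob (\<Union>z\<in>PS \<times> PT. ?A (fst z) \<inter> ?B (snd z))" by simp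
  also have "\<dots> = (\<Sum>z\<in>PS \<times> PT. prob (?A (fst z) \<inter> ?B (snd z)))"
  proof (rule finite_measure_finite_Union)
    show "disjoint_family_on (\<lambda>z. ?A (fst z) \<inter> ?B (snd z)) (PS \<times> PT)"
      unfolding disjoint_family_on_def event_def by force
  qed (use finP AB(2) in \<open>auto simp: PS_def PT_def\<close>)
  also have "\<dots> = (\<Sum>z\<in>PS \<times> PT. prob (?A (fst z)) * prob (?B (snd z)))"
    by (intro sum.cong refl AB(1)) (auto simp: PS_def PT_def)
  also have "\<dots> = (\<Sum>U\<in>PS. prob (?A U)) * (\<Sum>V\<in>PT. prob (?B V))"
    by (simp add: sum_product sum.cartesian_product case_prod_beta)
  also have "(\<Sum>U\<in>PS. prob (?A U)) = Pr Q"
  proof -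
    have "Pr Q = prob (\<Union>U\<in>PS. ?A U)" using event_eq_UN[OF Q] by (simp add: PS_def)
    also have "\<dots> = (\<Sum>U\<in>PS. prob (?A U))"
      by (rule finite_measure_finite_Union)
        (use finP pat_prob(1)[OF fin(1,3)] in \<open>auto simp: PS_def disjoint_family_on_def event_def\<close>)
    finally show ?thesis by simp
  qed
  also have "(\<Sum>V\<in>PT. prob (?B V)) = Pr R"
  proof -
    have "Pr R = prob (\<Union>U\<in>PT. ?B U)" using event_eq_UN[OF R] by (simp add: PT_def)
    also have "\<dots> = (\<Sum>U\<in>PT. prob (?B U))"
      by (rule finite_measure_finite_Union)
        (use finP pat_prob(1)[OF fin(2,4)] in \<open>auto simp: PT_def disjoint_family_on_def event_def\<close>)
    finally show ?thesis by simp
  qed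
  finally show ?thesis .
qed

lemma depends_on_subset: "finite S \<Longrightarrow> S \<subseteq> {1..} \<Longrightarrow> depends_on S (\<lambda>Y. S \<subseteq> Y)"
  by (auto simp: depends_on_def)

lemma depends_on_notin: "z \<ge> 1 \<Longrightarrow> depends_on {z} (\<lambda>Y. z \<notin> Y)"
  by (auto simp: depends_on_def)

lemma Pr_subset: "finite S \<Longrightarrow> S \<subseteq> {1..} \<Longrightarrow> Pr (\<lambda>Y. S \<subseteq> Y) = p ^ card S"
  using pat_prob(2)[of S S] by (simp add: inf.absorb_iff2 [symmetric] Int_commute)

lemma Pr_notin: "z \<ge> 1 \<Longrightarrow> Pr (\<lambda>Y. z \<notin> Y) = q"
  using pat_prob(2)[of "{z}" "{}"] by simp

lemma Pr_mono:
  assumes "depends_on T R" "\<And>Y. Q Y \<Longrightarrow> R Y"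
  shows "Pr Q \<le> Pr R"
  by (rule finite_measure_mono) (use assms event_measurable in \<open>auto simp: event_def\<close>)

lemma depends_on_all:
  assumes "finite I" "\<And>i. i \<in> I \<Longrightarrow> depends_on (S i) (Q i)"
  shows "depends_on (\<Union>i\<in>I. S i) (\<lambda>Y. \<forall>i\<in>I. Q i Y)"
  using assms
proof (induction I)
  case (insert x F)
  then have "depends_on (S x \<union> (\<Union>i\<in>F. S i)) (\<lambda>Y. Q x Y \<and> (\<forall>i\<in>F. Q i Y))"
    by (intro depends_on_Un) auto
  then show ?case by simp
qed (simp add: depends_on_def)

lemma depends_on_not: "depends_on S Q \<Longrightarrow> depends_on S (\<lambda>Y. \<not> Q Y)"
  by (auto simp: depends_on_def)

lemma Pr_ex_le:
  assumes "finite I" "\<And>i. i \<in> I \<Longrightarrow> depends_on (S i) (Q i)"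
  shows "Pr (\<lambda>Y. \<exists>i\<in>I. Q i Y) \<le> (\<Sum>i\<in>I. Pr (Q i))"
proof -
  have "event (\<lambda>Y. \<exists>i\<in>I. Q i Y) = (\<Union>i\<in>I. event (Q i))" by (auto simp: event_def)
  moreover have "(\<lambda>i. event (Q i)) ` I \<subseteq> events" using assms(2) event_measurable by blast
  ultimately show ?thesis
    using finite_measure_subadditive_finite[OF assms(1), of "\<lambda>i. event (Q i)"] by simp
qed

lemma Pr_not: "depends_on S Q \<Longrightarrow> Pr (\<lambda>Y. \<not> Q Y) = 1 - Pr Q"
proof -
  assume "depends_on S Q"
  moreover have "event (\<lambda>Y. \<not> Q Y) = space M - event Q" by (auto simp: event_def)
  ultimately show ?thesis using prob_compl event_measurable by simp
qed

section \<open>Declumped progressions: probabilities of single events and of pairs\<close>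

lemma supp_props:
  assumes "fst i \<ge> 1"
  shows "finite (supp r i)" "supp r i \<subseteq> {1..}" "finite (ones r i)" "ones r i \<subseteq> {1..}"
    "supp r i \<subseteq> {1..fst i}"
proof -
  obtain n b s where i: "i = (n, b, s)" by (cases i)
  have "supp r i \<subseteq> {1..n}" using ap_term_range[of n b s] assms by (auto simp: i supp_def)
  moreover have "finite (supp r i)" "finite (ones r i)" by (auto simp: i ones_def supp_def)
  moreover have "{1..n} \<subseteq> {1..}" by auto
  ultimately show "finite (supp r i)" "supp r i \<subseteq> {1..}" "finite (ones r i)" "ones r i \<subseteq> {1..}"
    "supp r i \<subseteq> {1..fst i}"
    using ones_sub_supp[of r i] by (simp_all add: i) fastforce+
qed

lemma card_supp_le: "card (supp r i) \<le> r + 1"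
  using card_image_le[of "{0..r}"] by (auto simp: supp_def split: prod.splits)

lemma card_ones: "n \<ge> 1 \<Longrightarrow> good_step n r s \<Longrightarrow> card (ones r (n, b, s)) = r"
  using inj_on_subset[OF good_step_inj[of n r s b], of "{1..r}"] by (simp add: ones_def card_image)

lemma depends_on_ap_ev: "fst i \<ge> 1 \<Longrightarrow> depends_on (supp r i) (ap_ev r i)"
  using supp_props(1,2)[of i r] ones_sub_supp[of r i]
  by (auto simp: depends_on_def ap_ev_def supp_def split: prod.splits)

lemma Pr_ap_ev:
  assumes n: "n \<ge> 1" and g: "good_step n r s"
  shows "Pr (ap_ev r (n, b, s)) = q * p ^ r"
proof -
  let ?z = "ap_term n b s 0"
  have z: "?z \<ge> 1" using ap_term_range[OF n] by auto
  have "?z \<notin> ones r (n, b, s)"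
    using good_step_inj[OF n g, of b] unfolding ones_def inj_on_def by force
  then have "Pr (\<lambda>Y. ?z \<notin> Y \<and> ones r (n, b, s) \<subseteq> Y) = Pr (\<lambda>Y. ?z \<notin> Y) * Pr (\<lambda>Y. ones r (n, b, s) \<subseteq> Y)"
    using n by (intro event_indep[OF depends_on_notin[OF z] depends_on_subset] supp_props) auto
  also have "\<dots> = q * p ^ r"
    using n g supp_props(3,4)[of "(n,b,s)" r] by (simp add: Pr_notin[OF z] Pr_subset card_ones)
  finally show ?thesis by (simp add: ap_ev_def[abs_def])
qed

text \<open>Only the union of the required ones is kept; with at most k shared points it has at
  least r + r' - k elements.\<close>

lemma Pr_pair:
  assumes n: "n \<ge> 1" "good_step n r s" and m: "m \<ge> 1" "good_step m r' t"
    and k: "card (ones r (n,b,s) \<inter> ones r' (m,c,t)) \<le> k" "k \<le> r + r'"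
  shows "Pr (\<lambda>Y. ap_ev r (n,b,s) Y \<and> ap_ev r' (m,c,t) Y) \<le> p ^ (r + r' - k)"
proof -
  let ?A = "ones r (n,b,s)" and ?B = "ones r' (m,c,t)"
  have f: "finite ?A" "finite ?B" "?A \<subseteq> {1..}" "?B \<subseteq> {1..}" using supp_props n m by auto
  have "Pr (\<lambda>Y. ap_ev r (n,b,s) Y \<and> ap_ev r' (m,c,t) Y) \<le> Pr (\<lambda>Y. ?A \<union> ?B \<subseteq> Y)"
    by (rule Pr_mono[OF depends_on_subset]) (use f in \<open>auto simp: ap_ev_def\<close>)
  also have "\<dots> = p ^ card (?A \<union> ?B)" using f by (intro Pr_subset) auto
  also have "\<dots> \<le> p ^ (r + r' - k)"
  proof (rule power_decreasing)
    have "card (?A \<union> ?B) + card (?A \<inter> ?B) = r + r'"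
      using card_Un_Int[OF f(1,2)] card_ones n m by simp
    then show "r + r' - k \<le> card (?A \<union> ?B)" using k by linarith
  qed (use p0 p1 in auto)
  finally show ?thesis .
qed

text \<open>Total contribution of all progressions modulo m of length r' that meet a fixed one of
  length r. The first term counts all of them as sharing one point; the second pays for those, far
  fewer, that meet it twice and may share up to (R + 1) / 2 of the required ones.\<close>

definition pair_bound :: "nat \<Rightarrow> nat \<Rightarrow> nat \<Rightarrow> nat \<Rightarrow> real" where
  "pair_bound r r' m R = real ((r + 1) * (r' + 1) * m) * p ^ (r + r' - 1)
     + real ((r + 1)\<^sup>2 * (r' + 1)\<^sup>2 * r') * p ^ (r + r' - (R + 1) div 2)"

lemma pair_bound_nonneg: "0 \<le> pair_bound r r' m R"
  using p0 by (simp add: pair_bound_def)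

definition compatible_bound :: "nat \<Rightarrow> nat \<times> int \<times> int \<Rightarrow> nat \<Rightarrow> nat \<times> int \<times> int \<Rightarrow> nat \<Rightarrow> bool" where
  "compatible_bound r i r' j R \<longleftrightarrow>
     (\<forall>Y. \<not> (ap_ev r i Y \<and> ap_ev r' j Y)) \<or> 2 * card (ones r i \<inter> ones r' j) \<le> R + 1"

text \<open>The split is by whether the supports meet at least twice. If they do not, at most one
  required one is shared; if they do, the number of such progressions is free of the factor m, and
  compatibility still leaves about half of the points new.\<close>

lemma pair_sum:
  assumes n: "n \<ge> 1" "good_step n r s" and m: "m \<ge> 1" and J: "J \<subseteq> pr_index m"
    and g: "\<And>m' c t. (m', c, t) \<in> J \<Longrightarrow> good_step m r' t"
    and c: "\<And>j. j \<in> J \<Longrightarrow> compatible_bound r (n,b,s) r' j R"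
    and r: "r \<ge> 1" "(R + 1) div 2 \<le> r + r'"
  shows "(\<Sum>j\<in>{j\<in>J. supp r (n,b,s) \<inter> supp r' j \<noteq> {}}. Pr (\<lambda>Y. ap_ev r (n,b,s) Y \<and> ap_ev r' j Y))
       \<le> pair_bound r r' m R"
    and "(\<Sum>j\<in>{j\<in>J. supp r (n,b,s) \<inter> supp r' j \<noteq> {}}. Pr (ap_ev r (n,b,s)) * Pr (ap_ev r' j))
       \<le> pair_bound r r' m R"
proof -
  let ?i = "(n,b,s)"
  let ?S = "supp r ?i"
  define K where "K = {j\<in>J. ?S \<inter> supp r' j \<noteq> {}}"
  define K1 where "K1 = {j\<in>pr_index m. supp r' j \<inter> ?S \<noteq> {}}"
  define K2 where "K2 = {j\<in>pr_index m. 2 \<le> card (supp r' j \<inter> ?S)}"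
  have finS: "finite ?S" using supp_props n by auto
  have fin: "finite K" "finite K1" "finite K2"
    using finite_pr_index[of m] finite_subset[OF J] by (auto simp: K_def K1_def K2_def)
  have KK: "K \<subseteq> K1" using J by (auto simp: K_def K1_def)
  have cS: "card ?S \<le> r + 1" by (rule card_supp_le)
  have c1: "real (card K1) \<le> real ((r + 1) * (r' + 1) * m)"
  proof -
    have "card K1 \<le> card ?S * (r' + 1) * m" unfolding K1_def by (rule card_meet1[OF m finS])
    also have "\<dots> \<le> (r + 1) * (r' + 1) * m" using cS by (intro mult_right_mono) auto
    finally show ?thesis by linarith
  qed
  have c2: "real (card K2) \<le> real ((r + 1)\<^sup>2 * (r' + 1)\<^sup>2 * r')"
  proof -
    have "card K2 \<le> (card ?S)\<^sup>2 * (r' + 1)\<^sup>2 * r'" unfolding K2_def by (rule card_meet2[OF m finS])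
    also have "\<dots> \<le> (r + 1)\<^sup>2 * (r' + 1)\<^sup>2 * r'" using cS by (intro mult_right_mono power_mono) auto
    finally show ?thesis by linarith
  qed
  let ?a = "p ^ (r + r' - 1)" and ?b = "p ^ (r + r' - (R + 1) div 2)"
  have ab: "0 \<le> ?a" "0 \<le> ?b" using p0 by auto
  have pair: "Pr (\<lambda>Y. ap_ev r ?i Y \<and> ap_ev r' j Y) \<le> ?a + (if j \<in> K2 then ?b else 0)" if "j \<in> K" for j
  proof -
    have jJ: "j \<in> J" using that by (simp add: K_def)
    then have "j \<in> pr_index m" using J by blast
    then obtain c t where j: "j = (m, c, t)" by (auto simp: pr_index_def)
    have gt: "good_step m r' t" using g jJ j by auto
    show ?thesis
    proof (cases "\<forall>Y. \<not> (ap_ev r ?i Y \<and> ap_ev r' j Y)")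
      case True
      then have "event (\<lambda>Y. ap_ev r ?i Y \<and> ap_ev r' j Y) = {}" by (auto simp: event_def)
      then show ?thesis using ab by simp
    next
      case False
      then have "2 * card (ones r ?i \<inter> ones r' j) \<le> R + 1"
        using c[OF jJ] unfolding compatible_bound_def by blast
      then have k: "card (ones r ?i \<inter> ones r' j) \<le> (R + 1) div 2" by linarith
      show ?thesis
      proof (cases "j \<in> K2")
        case True
        have "Pr (\<lambda>Y. ap_ev r ?i Y \<and> ap_ev r' j Y) \<le> ?b"
          using Pr_pair[OF n m gt, of b c] k r unfolding j by blast
        then show ?thesis using True ab by simp
      next
        case F2: False
        have "j \<in> pr_index m" using jJ J by blast
        then have "card (supp r' j \<inter> ?S) \<le> 1" using F2 unfolding K2_def by simp
        moreover have "card (ones r ?i \<inter> ones r' j) \<le> card (supp r' j \<inter> ?S)"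
          using finS ones_sub_supp[of r ?i] ones_sub_supp[of r' j] by (intro card_mono) auto
        ultimately have "card (ones r ?i \<inter> ones r' j) \<le> 1" by simp
        then have "Pr (\<lambda>Y. ap_ev r ?i Y \<and> ap_ev r' j Y) \<le> ?a"
          using Pr_pair[OF n m gt, of b c 1] r unfolding j by simp
        then show ?thesis using F2 by simp
      qed
    qed
  qed
  have "(\<Sum>j\<in>K. Pr (\<lambda>Y. ap_ev r ?i Y \<and> ap_ev r' j Y)) \<le> (\<Sum>j\<in>K. ?a + (if j \<in> K2 then ?b else 0))"
    by (intro sum_mono pair)
  also have "\<dots> \<le> (\<Sum>j\<in>K1. ?a + (if j \<in> K2 then ?b else 0))"
    using ab by (intro sum_mono2 fin KK) auto
  also have "\<dots> = real (card K1) * ?a + (\<Sum>j\<in>K1. if j \<in> K2 then ?b else 0)"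
    by (simp add: sum.distrib)
  also have "(\<Sum>j\<in>K1. if j \<in> K2 then ?b else 0) = real (card (K1 \<inter> K2)) * ?b"
    using fin by (simp add: sum.If_cases)
  also have "real (card (K1 \<inter> K2)) \<le> real (card K2)" using fin by (simp add: card_mono)
  finally have "(\<Sum>j\<in>K. Pr (\<lambda>Y. ap_ev r ?i Y \<and> ap_ev r' j Y)) \<le> real (card K1) * ?a + real (card K2) * ?b"
    using ab by (simp add: mult_right_mono)
  also have "\<dots> \<le> pair_bound r r' m R"
    unfolding pair_bound_def by (intro add_mono mult_right_mono c1 c2 ab)
  finally show "(\<Sum>j\<in>{j\<in>J. supp r (n,b,s) \<inter> supp r' j \<noteq> {}}. Pr (\<lambda>Y. ap_ev r (n,b,s) Y \<and> ap_ev r' j Y))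
       \<le> pair_bound r r' m R" unfolding K_def .
  have "(\<Sum>j\<in>K. Pr (ap_ev r ?i) * Pr (ap_ev r' j)) \<le> (\<Sum>j\<in>K. ?a)"
  proof (rule sum_mono)
    fix j assume "j \<in> K"
    then have jJ: "j \<in> J" by (simp add: K_def)
    then have "j \<in> pr_index m" using J by blast
    then obtain c t where j: "j = (m, c, t)" by (auto simp: pr_index_def)
    then have gt: "good_step m r' t" using g jJ by auto
    have "Pr (ap_ev r ?i) * Pr (ap_ev r' j) = (q * q) * p ^ (r + r')"
      unfolding j Pr_ap_ev[OF n] Pr_ap_ev[OF m gt] by (simp add: power_add)
    also have "\<dots> \<le> 1 * p ^ (r + r' - 1)"
      using q01 p0 p1 by (intro mult_mono power_decreasing) (auto simp: mult_le_one)
    finally show "Pr (ap_ev r ?i) * Pr (ap_ev r' j) \<le> ?a" by simp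
  qed
  also have "\<dots> = real (card K) * ?a" by simp
  also have "\<dots> \<le> real ((r + 1) * (r' + 1) * m) * ?a"
    using c1 card_mono[OF fin(2) KK] ab by (intro mult_right_mono) auto
  also have "\<dots> \<le> pair_bound r r' m R" using ab by (simp add: pair_bound_def)
  finally show "(\<Sum>j\<in>{j\<in>J. supp r (n,b,s) \<inter> supp r' j \<noteq> {}}. Pr (ap_ev r (n,b,s)) * Pr (ap_ev r' j))
       \<le> pair_bound r r' m R" unfolding K_def .
qed

text \<open>The common interface of the sieve and the second moment method. The length may vary with
  the modulus, and overlaps are limited by half the length attached to the larger modulus, the only
  form available for moduli of different size.\<close>

definition family :: "nat set \<Rightarrow> (nat \<Rightarrow> nat) \<Rightarrow> (nat \<times> int \<times> int) set \<Rightarrow> bool" where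
  "family Ms \<rho> I \<longleftrightarrow> finite Ms \<and> (\<forall>m\<in>Ms. 1 \<le> m \<and> 1 \<le> \<rho> m) \<and> I \<subseteq> (\<Union>m\<in>Ms. pr_index m)
     \<and> (\<forall>(n,b,s)\<in>I. good_step n (\<rho> n) s)
     \<and> (\<forall>i\<in>I. \<forall>j\<in>I. i \<noteq> j \<and> fst i \<le> fst j \<longrightarrow> compatible_bound (\<rho> (fst i)) i (\<rho> (fst j)) j (\<rho> (fst j)))"

lemma familyD:
  assumes "family Ms \<rho> I" "(n,b,s) \<in> I"
  shows "n \<in> Ms" "n \<ge> 1" "\<rho> n \<ge> 1" "good_step n (\<rho> n) s" "b \<in> {1..int n}" "s \<in> {1..int n}"
    "Pr (ap_ev (\<rho> n) (n,b,s)) = q * p ^ \<rho> n"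
proof -
  have "I \<subseteq> (\<Union>m\<in>Ms. pr_index m)" using assms(1) unfolding family_def by (elim conjE)
  then have "(n,b,s) \<in> (\<Union>m\<in>Ms. pr_index m)" using assms(2) by blast
  then show "n \<in> Ms" "b \<in> {1..int n}" "s \<in> {1..int n}" by (auto simp: pr_index_def)
  moreover have "\<forall>m\<in>Ms. 1 \<le> m \<and> 1 \<le> \<rho> m" using assms(1) unfolding family_def by (elim conjE)
  ultimately show n: "n \<ge> 1" and "\<rho> n \<ge> 1" by blast+
  have "\<forall>(n,b,s)\<in>I. good_step n (\<rho> n) s" using assms(1) unfolding family_def by (elim conjE)
  then show "good_step n (\<rho> n) s" using assms(2) by blast
  then show "Pr (ap_ev (\<rho> n) (n,b,s)) = q * p ^ \<rho> n" using n by (rule Pr_ap_ev[rotated])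
qed

lemma finite_family: "family Ms \<rho> I \<Longrightarrow> finite I"
  unfolding family_def by (elim conjE, erule finite_subset, rule finite_UN_I) (assumption, rule finite_pr_index)

lemma family_compatible:
  "family Ms \<rho> I \<Longrightarrow> i \<in> I \<Longrightarrow> j \<in> I \<Longrightarrow> i \<noteq> j \<Longrightarrow> fst i \<le> fst j \<Longrightarrow>
     compatible_bound (\<rho> (fst i)) i (\<rho> (fst j)) j (\<rho> (fst j))"
  unfolding family_def by (elim conjE) blast

text \<open>\<open>pair_sum\<close> modulus by modulus. The predicate \<open>P\<close> selects the
  moduli: all of them for the sieve, those not below n for the second moment.\<close>

lemma family_pair_sum:
  assumes fam: "family Ms \<rho> I" and i: "(n,b,s) \<in> I"
    and c: "\<And>j. j \<in> I \<Longrightarrow> j \<noteq> (n,b,s) \<Longrightarrow> P (fst j) \<Longrightarrow>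
      compatible_bound (\<rho> n) (n,b,s) (\<rho> (fst j)) j (\<rho> (fst j))"
  shows "(\<Sum>j\<in>{j\<in>I - {(n,b,s)}. P (fst j) \<and> supp (\<rho> n) (n,b,s) \<inter> supp (\<rho> (fst j)) j \<noteq> {}}.
            Pr (\<lambda>Y. ap_ev (\<rho> n) (n,b,s) Y \<and> ap_ev (\<rho> (fst j)) j Y))
       \<le> (\<Sum>m\<in>{m\<in>Ms. P m}. pair_bound (\<rho> n) (\<rho> m) m (\<rho> m))" (is ?A)
    and "(\<Sum>j\<in>{j\<in>I - {(n,b,s)}. P (fst j) \<and> supp (\<rho> n) (n,b,s) \<inter> supp (\<rho> (fst j)) j \<noteq> {}}.
            Pr (ap_ev (\<rho> n) (n,b,s)) * Pr (ap_ev (\<rho> (fst j)) j))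
       \<le> (\<Sum>m\<in>{m\<in>Ms. P m}. pair_bound (\<rho> n) (\<rho> m) m (\<rho> m))" (is ?B)
proof -
  let ?i = "(n,b,s)"
  define J where "J m = {j\<in>I - {?i}. fst j = m}" for m
  define L where "L m = {j\<in>J m. supp (\<rho> n) ?i \<inter> supp (\<rho> m) j \<noteq> {}}" for m
  have finM: "finite Ms" using fam by (simp add: family_def)
  have finI: "finite I" by (rule finite_family[OF fam])
  have finL: "finite (L m)" for m using finI by (simp add: L_def J_def)
  have U: "{j\<in>I - {?i}. P (fst j) \<and> supp (\<rho> n) ?i \<inter> supp (\<rho> (fst j)) j \<noteq> {}} = (\<Union>m\<in>{m\<in>Ms. P m}. L m)"
  proof -
    have "fst j \<in> Ms" if "j \<in> I" for j using familyD(1)[OF fam] that by (cases j) auto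
    then show ?thesis by (auto simp: L_def J_def)
  qed
  have split: "sum f (\<Union>m\<in>{m\<in>Ms. P m}. L m) = (\<Sum>m\<in>{m\<in>Ms. P m}. sum f (L m))" for f :: "_ \<Rightarrow> real"
    using finM finL by (intro sum.UNION_disjoint) (auto simp: L_def J_def)
  have cong: "(\<Sum>j\<in>L m. F (\<rho> (fst j)) j) = (\<Sum>j\<in>L m. F (\<rho> m) j)" for F :: "nat \<Rightarrow> _ \<Rightarrow> real" and m
    by (intro sum.cong) (auto simp: L_def J_def)
  have *: "(\<Sum>j\<in>L m. Pr (\<lambda>Y. ap_ev (\<rho> n) ?i Y \<and> ap_ev (\<rho> m) j Y)) \<le> pair_bound (\<rho> n) (\<rho> m) m (\<rho> m)"
    "(\<Sum>j\<in>L m. Pr (ap_ev (\<rho> n) ?i) * Pr (ap_ev (\<rho> m) j)) \<le> pair_bound (\<rho> n) (\<rho> m) m (\<rho> m)"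
    if "m \<in> Ms" "P m" for m
  proof -
    have 1: "J m \<subseteq> pr_index m"
    proof
      fix j assume "j \<in> J m"
      then obtain c t where "j = (m, c, t)" "j \<in> I" by (cases j) (auto simp: J_def)
      then show "j \<in> pr_index m" using familyD(5,6)[OF fam, of m c t] by (simp add: pr_index_def)
    qed
    have 2: "good_step m (\<rho> m) t" if "(m', c, t) \<in> J m" for m' c t
      using familyD(4)[OF fam, of m' c t] that by (auto simp: J_def)
    have 3: "compatible_bound (\<rho> n) ?i (\<rho> m) j (\<rho> m)" if "j \<in> J m" for j
      using c[of j] that \<open>P m\<close> by (auto simp: J_def)
    have 4: "m \<ge> 1" using fam that by (auto simp: family_def)
    have 5: "(\<rho> m + 1) div 2 \<le> \<rho> n + \<rho> m" using familyD(3)[OF fam i] by linarith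
    show "(\<Sum>j\<in>L m. Pr (\<lambda>Y. ap_ev (\<rho> n) ?i Y \<and> ap_ev (\<rho> m) j Y)) \<le> pair_bound (\<rho> n) (\<rho> m) m (\<rho> m)"
      unfolding L_def by (rule pair_sum[OF familyD(2,4)[OF fam i] 4 1 2 3 familyD(3)[OF fam i] 5])
    show "(\<Sum>j\<in>L m. Pr (ap_ev (\<rho> n) ?i) * Pr (ap_ev (\<rho> m) j)) \<le> pair_bound (\<rho> n) (\<rho> m) m (\<rho> m)"
      unfolding L_def by (rule pair_sum[OF familyD(2,4)[OF fam i] 4 1 2 3 familyD(3)[OF fam i] 5])
  qed
  show ?A unfolding U split cong[of "\<lambda>r j. Pr (\<lambda>Y. ap_ev (\<rho> n) ?i Y \<and> ap_ev r j Y)"]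
    by (intro sum_mono *) auto
  show ?B unfolding U split cong[of "\<lambda>r j. Pr (ap_ev (\<rho> n) ?i) * Pr (ap_ev r j)"]
    by (intro sum_mono *) auto
qed

lemma event_Int: "event Q \<inter> event R = event (\<lambda>Y. Q Y \<and> R Y)" by (auto simp: event_def)

lemma event_none: "space M - (\<Union>j\<in>J. event (Q j)) = event (\<lambda>Y. \<forall>j\<in>J. \<not> Q j Y)"
  by (auto simp: event_def)

lemma family_sieve:
  assumes fam: "family Ms (\<lambda>_. r) I" and N: "\<And>m. m \<in> Ms \<Longrightarrow> m \<le> N"
  shows "\<bar>Pr (\<lambda>Y. \<forall>i\<in>I. \<not> ap_ev r i Y) - exp (- (real (card I) * (q * p ^ r)))\<bar>
     \<le> real (card I) * ((p ^ r)\<^sup>2 + 2 * real (card Ms) * pair_bound r r N r)"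
proof -
  let ?A = "\<lambda>i. event (ap_ev r i)"
  let ?nb = "\<lambda>i j. supp r i \<inter> supp r j \<noteq> {}"
  have fin: "finite I" by (rule finite_family[OF fam])
  have f1: "fst i \<ge> 1" if "i \<in> I" for i
    using familyD(2)[OF fam] that by (cases i) auto
  have dep: "depends_on (supp r i) (ap_ev r i)" if "i \<in> I" for i
    using depends_on_ap_ev f1 that by blast
  have pi: "prob (?A i) = q * p ^ r" if "i \<in> I" for i
    using familyD(7)[OF fam] that by (cases i) auto
  have S: "\<bar>prob (space M - (\<Union>i\<in>I. ?A i)) - (\<Prod>i\<in>I. 1 - prob (?A i))\<bar>
     \<le> (\<Sum>i\<in>I. \<Sum>j\<in>{j\<in>I - {i}. ?nb i j}. prob (?A i) * prob (?A j) + prob (?A i \<inter> ?A j))"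
  proof (rule sieve[OF fin])
    show "?A i \<in> events" if "i \<in> I" for i using dep that event_measurable by blast
  next
    fix i J assume i: "i \<in> I" and J: "J \<subseteq> I" "\<And>j. j \<in> J \<Longrightarrow> \<not> ?nb i j"
    have "depends_on (\<Union>j\<in>J. supp r j) (\<lambda>Y. \<forall>j\<in>J. \<not> ap_ev r j Y)"
      using J(1) fin dep by (intro depends_on_all depends_on_not) (auto intro: finite_subset)
    then show "prob (?A i \<inter> (space M - (\<Union>j\<in>J. ?A j))) = prob (?A i) * prob (space M - (\<Union>j\<in>J. ?A j))"
      unfolding event_none event_Int using J(2) by (intro event_indep[OF dep[OF i]]) auto
  qed
  have pb: "pair_bound r r m r \<le> pair_bound r r N r" if "m \<in> Ms" for m
  proof -
    have "(r + 1) * (r + 1) * m \<le> (r + 1) * (r + 1) * N" using N[OF that] by (intro mult_le_mono2)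
    then show ?thesis unfolding pair_bound_def
      using p0 by (intro add_mono mult_right_mono of_nat_mono) auto
  qed
  have finM: "finite Ms" using fam by (simp add: family_def)
  have "(\<Sum>i\<in>I. \<Sum>j\<in>{j\<in>I - {i}. ?nb i j}. prob (?A i) * prob (?A j) + prob (?A i \<inter> ?A j))
      \<le> (\<Sum>i\<in>I. 2 * real (card Ms) * pair_bound r r N r)"
  proof (rule sum_mono)
    fix i assume iI: "i \<in> I"
    obtain n b s where i: "i = (n,b,s)" by (cases i)
    have iI': "(n,b,s) \<in> I" using iI i by simp
    \<comment> \<open>With one common length the overlap bound is symmetric, so smaller moduli are
      covered too.\<close>
    have c: "compatible_bound r (n,b,s) r j r" if "j \<in> I" "j \<noteq> (n,b,s)" for j
    proof (cases "n \<le> fst j")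
      case True
      then show ?thesis using family_compatible[OF fam iI', of j] that by auto
    next
      case False
      then have "compatible_bound r j r (n,b,s) r" using family_compatible[OF fam, of j "(n,b,s)"] iI' that by auto
      then show ?thesis by (auto simp: compatible_bound_def Int_commute)
    qed
    have "(\<Sum>m\<in>{m\<in>Ms. True}. pair_bound r r m r) \<le> (\<Sum>m\<in>{m\<in>Ms. True}. pair_bound r r N r)"
      by (intro sum_mono pb) auto
    then have le: "(\<Sum>m\<in>{m\<in>Ms. True}. pair_bound r r m r) \<le> real (card Ms) * pair_bound r r N r"
      by simp
    have "(\<Sum>j\<in>{j\<in>I - {i}. ?nb i j}. prob (?A i \<inter> ?A j)) \<le> real (card Ms) * pair_bound r r N r"
      using family_pair_sum(1)[OF fam iI', of "\<lambda>_. True"] c le unfolding i event_Int by fastforce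
    moreover have "(\<Sum>j\<in>{j\<in>I - {i}. ?nb i j}. prob (?A i) * prob (?A j)) \<le> real (card Ms) * pair_bound r r N r"
      using family_pair_sum(2)[OF fam iI', of "\<lambda>_. True"] c le unfolding i by fastforce
    ultimately show "(\<Sum>j\<in>{j\<in>I - {i}. ?nb i j}. prob (?A i) * prob (?A j) + prob (?A i \<inter> ?A j))
        \<le> 2 * real (card Ms) * pair_bound r r N r" by (simp add: sum.distrib)
  qed
  also have "\<dots> = real (card I) * (2 * real (card Ms) * pair_bound r r N r)" by simp
  finally have 1: "\<bar>prob (space M - (\<Union>i\<in>I. ?A i)) - (\<Prod>i\<in>I. 1 - prob (?A i))\<bar>
     \<le> real (card I) * (2 * real (card Ms) * pair_bound r r N r)" using S by linarith
  have "\<bar>(\<Prod>i\<in>I. 1 - prob (?A i)) - exp (- (\<Sum>i\<in>I. prob (?A i)))\<bar> \<le> (\<Sum>i\<in>I. (prob (?A i))\<^sup>2)"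
    using fin by (intro prod_one_minus_exp) (auto simp: prob_le_1)
  also have "(\<Sum>i\<in>I. (prob (?A i))\<^sup>2) = real (card I) * (q * p ^ r)\<^sup>2" using pi by simp
  also have "\<dots> \<le> real (card I) * (p ^ r)\<^sup>2"
    using q01 p0 by (intro mult_left_mono power_mono) (auto simp: mult_left_le_one_le)
  also have "(\<Sum>i\<in>I. prob (?A i)) = real (card I) * (q * p ^ r)" using pi by simp
  finally have 2: "\<bar>(\<Prod>i\<in>I. 1 - prob (?A i)) - exp (- (real (card I) * (q * p ^ r)))\<bar> \<le> real (card I) * (p ^ r)\<^sup>2" .
  show ?thesis using 1 2 unfolding event_none by (simp add: distrib_left abs_le_iff)
qed

lemma family_second_moment:
  assumes fam: "family Ms \<rho> I" and ne: "I \<noteq> {}"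
  shows "Pr (\<lambda>Y. \<forall>i\<in>I. \<not> ap_ev (\<rho> (fst i)) i Y) \<le>
     ((\<Sum>i\<in>I. q * p ^ \<rho> (fst i))
        + 2 * (\<Sum>i\<in>I. \<Sum>m\<in>{m\<in>Ms. fst i \<le> m}. pair_bound (\<rho> (fst i)) (\<rho> m) m (\<rho> m)))
      / (\<Sum>i\<in>I. q * p ^ \<rho> (fst i))\<^sup>2"
proof -
  let ?A = "\<lambda>i. event (ap_ev (\<rho> (fst i)) i)"
  let ?nb = "\<lambda>i j. supp (\<rho> (fst i)) i \<inter> supp (\<rho> (fst j)) j \<noteq> {}"
  have fin: "finite I" by (rule finite_family[OF fam])
  have f1: "fst i \<ge> 1" if "i \<in> I" for i
    using familyD(2)[OF fam] that by (cases i) auto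
  have dep: "depends_on (supp (\<rho> (fst i)) i) (ap_ev (\<rho> (fst i)) i)" if "i \<in> I" for i
    using depends_on_ap_ev f1 that by blast
  have pi: "prob (?A i) = q * p ^ \<rho> (fst i)" if "i \<in> I" for i
    using familyD(7)[OF fam] that by (cases i) auto
  have m: "(\<Sum>i\<in>I. prob (?A i)) = (\<Sum>i\<in>I. q * p ^ \<rho> (fst i))" using pi by simp
  have m0: "0 < (\<Sum>i\<in>I. prob (?A i))"
    unfolding m using fin ne p0 q01 by (intro sum_pos) auto
  have "prob (space M - (\<Union>i\<in>I. ?A i)) \<le> ((\<Sum>i\<in>I. prob (?A i))
      + 2 * (\<Sum>i\<in>I. \<Sum>j\<in>{j\<in>I - {i}. fst i \<le> fst j \<and> ?nb i j}. prob (?A i \<inter> ?A j))) / (\<Sum>i\<in>I. prob (?A i))\<^sup>2"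
  proof (rule second_moment_indep[OF fin _ m0])
    show "?A i \<in> events" if "i \<in> I" for i using dep that event_measurable by blast
    show "?nb i j \<longleftrightarrow> ?nb j i" for i j by auto
    show "prob (?A i \<inter> ?A j) = prob (?A i) * prob (?A j)" if "i \<in> I" "j \<in> I" "\<not> ?nb i j" for i j
      unfolding event_Int using that by (intro event_indep[OF dep dep]) auto
  qed
  also have "\<dots> \<le> ((\<Sum>i\<in>I. prob (?A i))
        + 2 * (\<Sum>i\<in>I. \<Sum>m\<in>{m\<in>Ms. fst i \<le> m}. pair_bound (\<rho> (fst i)) (\<rho> m) m (\<rho> m)))
      / (\<Sum>i\<in>I. prob (?A i))\<^sup>2"
  proof (intro divide_right_mono add_left_mono mult_left_mono sum_mono)
    fix i assume iI: "i \<in> I"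
    obtain n b s where i: "i = (n,b,s)" by (cases i)
    have iI': "(n,b,s) \<in> I" using iI i by simp
    have "compatible_bound (\<rho> n) (n,b,s) (\<rho> (fst j)) j (\<rho> (fst j))"
      if "j \<in> I" "j \<noteq> (n,b,s)" "n \<le> fst j" for j
      using family_compatible[OF fam iI', of j] that by auto
    then show "(\<Sum>j\<in>{j\<in>I - {i}. fst i \<le> fst j \<and> ?nb i j}. prob (?A i \<inter> ?A j))
       \<le> (\<Sum>m\<in>{m\<in>Ms. fst i \<le> m}. pair_bound (\<rho> (fst i)) (\<rho> m) m (\<rho> m))"
      using family_pair_sum(1)[OF fam iI', of "\<lambda>m. n \<le> m"] unfolding i event_Int fst_conv by blast
  qed auto
  finally show ?thesis unfolding m event_none .
qed

end

section \<open>Poisson approximation\<close>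

text \<open>Goodness at level r - 1 expresses the limit n / gcd(s, n) on the length: r terms are
  distinct iff the first r - 1 multiples of the step do not vanish.\<close>

definition has_ap :: "nat \<Rightarrow> nat \<Rightarrow> nat set \<Rightarrow> bool" where
  "has_ap n r Y \<longleftrightarrow> (\<exists>a\<in>{1..int n}. \<exists>s\<in>{1..int n}. good_step n (r - 1) s \<and> (\<forall>j<r. ap_term n a s j \<in> Y))"

text \<open>With d = n / gcd(s, n), the number s / gcd(s, n) is coprime to d, so n divides k s
  exactly when d divides k.\<close>

lemma le_div_gcd_iff_good_step:
  assumes n: "n \<ge> 1" and r: "r \<ge> 1"
  shows "r \<le> n div gcd s n \<longleftrightarrow> good_step n (r - 1) (int s)"
proof -
  define g where "g = gcd s n"
  define d where "d = n div g"
  have g0: "g > 0" using n by (simp add: g_def)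
  have gn: "g dvd n" by (simp add: g_def)
  then have nd: "n = d * g" unfolding d_def by simp
  have d0: "d \<ge> 1" using dvd_imp_le[OF gn] n g0 by (simp add: d_def div_greater_zero_iff Suc_le_eq)
  have "g dvd s" by (simp add: g_def)
  then obtain s' where s': "s = g * s'" by (rule dvdE)
  have cop: "coprime d s'"
  proof -
    have "coprime (s div g) (n div g)" unfolding g_def by (rule div_gcd_coprime) (use n in auto)
    moreover have "s div g = s'" using s' g0 by simp
    ultimately show ?thesis by (simp add: d_def coprime_commute)
  qed
  have iff: "int n dvd int k * int s \<longleftrightarrow> d dvd k" for k
  proof -
    have "int n dvd int k * int s \<longleftrightarrow> n dvd k * s" 
      using of_nat_dvd_iff[where 'a = int, of n "k * s"] by simp
    also have "\<dots> \<longleftrightarrow> d * g dvd (k * s') * g" by (subst nd, subst s') (simp only: mult_ac)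
    also have "\<dots> \<longleftrightarrow> d dvd k * s'" using g0 by simp
    also have "\<dots> \<longleftrightarrow> d dvd k" using cop by (simp add: coprime_dvd_mult_left_iff)
    finally show ?thesis .
  qed
  show ?thesis
  proof
    assume "r \<le> n div gcd s n"
    then have rd: "r \<le> d" by (simp add: d_def g_def)
    show "good_step n (r - 1) (int s)" unfolding good_step_def iff
    proof (intro allI impI notI)
      fix k assume "1 \<le> k \<and> k \<le> r - 1" "d dvd k"
      then have "d \<le> k" by (auto intro: dvd_imp_le)
      then show False using \<open>1 \<le> k \<and> k \<le> r - 1\<close> rd by linarith
    qed
  next
    assume "good_step n (r - 1) (int s)"
    then have "1 \<le> d \<and> d \<le> r - 1 \<longrightarrow> \<not> d dvd d" unfolding good_step_def iff by (rule spec)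
    then have "r \<le> d" using d0 r by auto
    then show "r \<le> n div gcd s n" by (simp add: d_def g_def)
  qed
qed

lemma longest_ap_ge_iff:
  assumes n: "n \<ge> 1" and r: "r \<ge> 1"
  shows "r \<le> longest_ap x n \<longleftrightarrow> has_ap n r {i. x i = 1}"
proof -
  have L: "r \<le> ap_length x n a s \<longleftrightarrow> good_step n (r - 1) (int s) \<and> (\<forall>j<r. x (ap_term n (int a) (int s) j) = 1)"
    if a: "a \<in> {1..n}" and s: "s \<in> {1..n}" for a s
  proof -
    have cyc: "cyc_res n (a + j * s) = ap_term n (int a) (int s) j" for j
      using n by (simp add: cyc_res_eq ap_term_def)
    have a0: "ap_term n (int a) (int s) 0 = a" using a by (simp add: ap_term_def res_idem)
    show ?thesis
    proof (cases "x a = 1")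
      case True
      define T where "T = {m \<in> {1..n div gcd s n}. \<forall>j<m. x (cyc_res n (a + j * s)) = 1}"
      have fin: "finite T" by (simp add: T_def)
      have "gcd s n \<le> n" using n by (intro dvd_imp_le) auto
      then have "1 \<le> n div gcd s n" using n by (simp add: div_greater_zero_iff Suc_le_eq)
      then have "1 \<in> T" using True a0 by (simp add: T_def cyc)
      then have ne: "T \<noteq> {}" by auto
      have "r \<le> ap_length x n a s \<longleftrightarrow> r \<le> Max T" using True by (simp add: ap_length_def T_def)
      also have "\<dots> \<longleftrightarrow> (\<exists>m\<in>T. r \<le> m)" by (rule Max_ge_iff[OF fin ne])
      \<comment> \<open>The set of admissible lengths is closed downwards, so the maximum reaches r
        iff r itself is admissible.\<close>
      also have "\<dots> \<longleftrightarrow> r \<in> T" using r by (auto simp: T_def intro: bexI[of _ r])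
      also have "\<dots> \<longleftrightarrow> good_step n (r - 1) (int s) \<and> (\<forall>j<r. x (ap_term n (int a) (int s) j) = 1)"
        using r le_div_gcd_iff_good_step[OF n r, of s] by (auto simp: T_def cyc)
      finally show ?thesis .
    next
      case False
      then have "ap_length x n a s = 0" by (simp add: ap_length_def)
      moreover have "\<not> (\<forall>j<r. x (ap_term n (int a) (int s) j) = 1)" using False a0 r by (auto intro!: exI[of _ 0])
      ultimately show ?thesis using r by simp
    qed
  qed
  have ne: "{1..n} \<times> {1..n} \<noteq> {}" using n by auto
  have "r \<le> longest_ap x n \<longleftrightarrow> (\<exists>a\<in>{1..n}. \<exists>s\<in>{1..n}. r \<le> ap_length x n a s)"
    unfolding longest_ap_def using ne by (subst Max_ge_iff) auto
  also have "\<dots> \<longleftrightarrow> (\<exists>a\<in>{1..n}. \<exists>s\<in>{1..n}. good_step n (r - 1) (int s) \<and> (\<forall>j<r. x (ap_term n (int a) (int s) j) = 1))"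
    by (intro bex_cong refl L)
  also have "\<dots> \<longleftrightarrow> has_ap n r {i. x i = 1}"
  proof
    assume "\<exists>a\<in>{1..n}. \<exists>s\<in>{1..n}. good_step n (r - 1) (int s) \<and> (\<forall>j<r. x (ap_term n (int a) (int s) j) = 1)"
    then obtain a s where "a \<in> {1..n}" "s \<in> {1..n}" "good_step n (r - 1) (int s)"
      "\<forall>j<r. x (ap_term n (int a) (int s) j) = 1" by blast
    then show "has_ap n r {i. x i = 1}"
      unfolding has_ap_def by (intro bexI[of _ "int a"] bexI[of _ "int s"]) auto
  next
    assume "has_ap n r {i. x i = 1}"
    then obtain a s where "a \<in> {1..int n}" "s \<in> {1..int n}" "good_step n (r - 1) s"
      "\<forall>j<r. x (ap_term n a s j) = 1" unfolding has_ap_def by blast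
    then show "\<exists>a\<in>{1..n}. \<exists>s\<in>{1..n}. good_step n (r - 1) (int s) \<and> (\<forall>j<r. x (ap_term n (int a) (int s) j) = 1)"
      by (intro bexI[of _ "nat a"] bexI[of _ "nat s"]) auto
  qed
  finally show ?thesis .
qed

lemma ap_term_shift:
  "n \<ge> 1 \<Longrightarrow> ap_term n (int (res n (b + k * s))) s u = res n (b + (k + int u) * s)"
  using res_cong[of n "b + k * s"] by (simp add: ap_term_def res_eq_iff algebra_simps)

lemma finite_int_box [simp]: "finite {t::int. a \<le> t \<and> t \<le> b \<and> P t}"
  by (rule finite_subset[of _ "{a..b}"]) auto

lemma has_ap_antimono: "has_ap n r Y \<Longrightarrow> r' \<le> r \<Longrightarrow> has_ap n r' Y"
  unfolding has_ap_def by (meson good_step_mono diff_le_mono less_le_trans)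

definition half_index :: "nat \<Rightarrow> nat \<Rightarrow> (nat \<times> int \<times> int) set" where
  "half_index n r = {n} \<times> {1..int n} \<times> {s\<in>{1..int n}. 2 * s < int n \<and> good_step n (r\<^sup>2) s}"

lemma ap_ev_imp_has_ap:
  assumes n: "n \<ge> 1" and g: "good_step n (r - 1) s" and s: "s \<in> {1..int n}" and e: "ap_ev r (n, b, s) Y"
  shows "has_ap n r Y"
proof -
  let ?a = "res n (b + 1 * s)"
  have "ap_term n (int ?a) s j \<in> Y" if "j < r" for j
  proof -
    have "ap_term n (int ?a) s j = ap_term n b s (Suc j)"
      unfolding ap_term_shift[OF n] by (simp add: ap_term_def)
    moreover have "ap_term n b s (Suc j) \<in> ones r (n, b, s)" using that by (auto simp: ones_def)
    ultimately show ?thesis using e by (auto simp: ap_ev_def)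
  qed
  moreover have "int ?a \<in> {1..int n}" using res_range[OF n, of "b + 1 * s"] by auto
  ultimately show ?thesis using g s unfolding has_ap_def by blast
qed

text \<open>Up to reversal the step is less than \<^term>\<open>n / 2\<close>; walking back from the first term one
  either meets a point outside \<^term>\<open>Y\<close> or doubles the length.\<close>

lemma has_ap_cases:
  assumes n: "n \<ge> 1" and r: "r \<ge> 2" and h: "has_ap n r Y"
  obtains (declumped) i where "i \<in> half_index n r" "ap_ev r i Y"
    | (double) "has_ap n (2 * r) Y"
    | (bad) a s where "a \<in> {1..int n}" "s \<in> {1..int n}" "good_step n (r - 1) s" "\<not> good_step n (r\<^sup>2) s"
        "\<forall>j<r. ap_term n a s j \<in> Y"
proof -
  obtain a0 s0 where as0: "a0 \<in> {1..int n}" "s0 \<in> {1..int n}" "good_step n (r - 1) s0"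
    "\<forall>j<r. ap_term n a0 s0 j \<in> Y" using h unfolding has_ap_def by blast
  show thesis
  proof (cases "good_step n (r\<^sup>2) s0")
    case False
    then show ?thesis using bad as0 by blast
  next
    case g0: True
    have rr: "2 * r \<le> r\<^sup>2" using r by (simp add: power2_eq_square)
    have k1: "\<not> int n dvd int k * s0" if "1 \<le> k" "k \<le> 2" for k
      using g0 rr r that unfolding good_step_def by auto
    have "\<exists>a s. 1 \<le> s \<and> 2 * s < int n \<and> good_step n (r\<^sup>2) s \<and> (\<forall>j<r. res n (a + int j * s) \<in> Y)"
    proof (cases "2 * s0 < int n")
      case True
      then show ?thesis using as0 g0 by (intro exI[of _ a0] exI[of _ s0]) (auto simp: ap_term_def)
    next
      case False
      have "s0 \<noteq> int n" using k1[of 1] by auto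
      moreover have "2 * s0 \<noteq> int n" using k1[of 2] by auto
      ultimately have s: "1 \<le> int n - s0" "2 * (int n - s0) < int n" using as0 False by auto
      \<comment> \<open>Reversal: the last term becomes the base and index j becomes r - 1 -
        j.\<close>
      have "res n (a0 + (int r - 1) * s0 + int j * (int n - s0)) \<in> Y" if j: "j < r" for j
      proof -
        have e: "int (r - 1 - j) = int r - 1 - int j" using j by linarith
        have "res n (a0 + (int r - 1) * s0 + int j * (int n - s0)) = ap_term n a0 s0 (r - 1 - j)"
          unfolding ap_term_def res_eq_iff[OF n] e by (simp add: algebra_simps)
        then show ?thesis using as0(4) j by simp
      qed
      then show ?thesis using s good_step_neg[OF g0] by blast
    qed
    then obtain a s where s: "1 \<le> s" "2 * s < int n" "good_step n (r\<^sup>2) s"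
      and Y: "\<And>j. j < r \<Longrightarrow> res n (a + int j * s) \<in> Y" by blast
    show ?thesis
    proof (cases "\<exists>i. 1 \<le> i \<and> i \<le> r \<and> res n (a + (- int i) * s) \<notin> Y")
      case True
      \<comment> \<open>The distance back to the nearest point outside the set. As i <= r, the r
        points after it all lie in the set: those before the first term by minimality, the others
        because they belong to the given progression.\<close>
      define i where "i = (LEAST i. 1 \<le> i \<and> i \<le> r \<and> res n (a + (- int i) * s) \<notin> Y)"
      have i: "1 \<le> i" "i \<le> r" "res n (a + (- int i) * s) \<notin> Y"
        using LeastI_ex[OF True] unfolding i_def by auto
      have below: "res n (a + (- int k) * s) \<in> Y" if "1 \<le> k" "k < i" for k
        using not_less_Least[of k "\<lambda>i. 1 \<le> i \<and> i \<le> r \<and> res n (a + (- int i) * s) \<notin> Y"] that i(2)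
        unfolding i_def[symmetric] by auto
      let ?b = "res n (a + (- int i) * s)"
      have t: "ap_term n (int ?b) s u = res n (a + (int u - int i) * s)" for u
        unfolding ap_term_shift[OF n] by (simp add: algebra_simps)
      have "ap_term n (int ?b) s u \<in> Y" if u: "1 \<le> u" "u \<le> r" for u
      proof (cases "u < i")
        case True
        then show ?thesis using below[of "i - u"] u unfolding t by (simp add: of_nat_diff)
      next
        case False
        then show ?thesis using Y[of "u - i"] u i unfolding t by (simp add: of_nat_diff)
      qed
      moreover have "ap_term n (int ?b) s 0 \<notin> Y" using i(3) unfolding t by simp
      ultimately have "ap_ev r (n, int ?b, s) Y" by (auto simp: ap_ev_def ones_def)
      moreover have "(n, int ?b, s) \<in> half_index n r"
        using s res_range[OF n, of "a + (- int i) * s"] by (auto simp: half_index_def)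
      ultimately show ?thesis using declumped by blast
    next
      case False
      let ?b = "res n (a + (- int r) * s)"
      have t: "ap_term n (int ?b) s u = res n (a + (int u - int r) * s)" for u
        unfolding ap_term_shift[OF n] by (simp add: algebra_simps)
      have "ap_term n (int ?b) s u \<in> Y" if u: "u < 2 * r" for u
      proof (cases "u < r")
        case True
        then have "1 \<le> r - u" "r - u \<le> r" "- int (r - u) = int u - int r" by (simp_all add: of_nat_diff)
        then show ?thesis using False unfolding t by metis
      next
        case F2: False
        then show ?thesis using Y[of "u - r"] u unfolding t by (simp add: of_nat_diff)
      qed
      moreover have "int ?b \<in> {1..int n}" using res_range[OF n, of "a + (- int r) * s"] by auto
      moreover have "good_step n (2 * r - 1) s" using s(3) rr by (auto intro: good_step_mono)
      ultimately have "has_ap n (2 * r) Y" using s unfolding has_ap_def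
        by (intro bexI[of _ "int ?b"] bexI[of _ s]) auto
      then show ?thesis using double by blast
    qed
  qed
qed

section \<open>Comparison of the absence of progressions with the Poisson law\<close>

context bernoulli_sequence
begin

lemma depends_on_ap:
  assumes n: "n \<ge> 1"
  shows "depends_on {1..n} (\<lambda>Y. \<exists>a\<in>A. \<exists>s\<in>S. \<forall>j<r. ap_term n a s j \<in> Y)"
proof -
  have "ap_term n a s j \<in> Y \<inter> {1..n} \<longleftrightarrow> ap_term n a s j \<in> Y" for a s j Y
    using ap_term_range[OF n] by blast
  then show ?thesis unfolding depends_on_def by simp
qed

lemma has_ap_alt: "has_ap n r = (\<lambda>Y. \<exists>a\<in>{1..int n}. \<exists>s\<in>{s\<in>{1..int n}. good_step n (r - 1) s}. \<forall>j<r. ap_term n a s j \<in> Y)"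
  unfolding has_ap_def by blast

lemma depends_on_has_ap: "n \<ge> 1 \<Longrightarrow> depends_on {1..n} (has_ap n r)"
  unfolding has_ap_alt by (rule depends_on_ap)

lemma Pr_ap_le:
  assumes n: "n \<ge> 1" and r: "r \<ge> 1" and S: "finite S" "\<And>s. s \<in> S \<Longrightarrow> good_step n (r - 1) s"
  shows "Pr (\<lambda>Y. \<exists>a\<in>{1..int n}. \<exists>s\<in>S. \<forall>j<r. ap_term n a s j \<in> Y) \<le> real n * real (card S) * p ^ r"
proof -
  let ?T = "\<lambda>z. ap_term n (fst z) (snd z) ` {..<r}"
  have T: "finite (?T z)" "?T z \<subseteq> {1..}" for z
  proof -
    have "?T z \<subseteq> {1..n}" using ap_term_range[OF n] by blast
    then show "?T z \<subseteq> {1..}" by auto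
  qed auto
  have "(\<lambda>Y. \<exists>a\<in>{1..int n}. \<exists>s\<in>S. \<forall>j<r. ap_term n a s j \<in> Y)
      = (\<lambda>Y. \<exists>z\<in>{1..int n} \<times> S. ?T z \<subseteq> Y)" by fastforce
  then have "Pr (\<lambda>Y. \<exists>a\<in>{1..int n}. \<exists>s\<in>S. \<forall>j<r. ap_term n a s j \<in> Y)
      \<le> (\<Sum>z\<in>{1..int n} \<times> S. Pr (\<lambda>Y. ?T z \<subseteq> Y))"
    using S(1) Pr_ex_le[of "{1..int n} \<times> S" ?T "\<lambda>z Y. ?T z \<subseteq> Y"] depends_on_subset[OF T] by simp
  also have "\<dots> = (\<Sum>z\<in>{1..int n} \<times> S. p ^ r)"
  proof (rule sum.cong[OF refl])
    fix z assume "z \<in> {1..int n} \<times> S"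
    then have "good_step n (r - 1) (snd z)" using S by auto
    then have "inj_on (ap_term n (fst z) (snd z)) {..<r}"
      using r by (intro inj_on_subset[OF good_step_inj[OF n]]) auto
    then have "card (?T z) = r" by (simp add: card_image)
    then show "Pr (\<lambda>Y. ?T z \<subseteq> Y) = p ^ r" using Pr_subset[OF T] by simp
  qed
  also have "\<dots> = real n * real (card S) * p ^ r" by (simp add: card_cartesian_product)
  finally show ?thesis .
qed

lemma Pr_has_ap_le:
  assumes n: "n \<ge> 1" and r: "r \<ge> 1"
  shows "Pr (has_ap n r) \<le> (real n)\<^sup>2 * p ^ r"
proof -
  let ?S = "{s\<in>{1..int n}. good_step n (r - 1) s}"
  have "card ?S \<le> card {1..int n}" by (intro card_mono) auto
  then have "card ?S \<le> n" by simp
  have "Pr (has_ap n r) \<le> real n * real (card ?S) * p ^ r"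
    unfolding has_ap_alt by (intro Pr_ap_le n r) auto
  also have "\<dots> \<le> real n * real n * p ^ r"
    using \<open>card ?S \<le> n\<close> p0 by (intro mult_right_mono mult_left_mono) auto
  finally show ?thesis by (simp add: power2_eq_square)
qed

lemma family_half_index:
  assumes n: "n \<ge> 1" and r: "r \<ge> 2"
  shows "family {n} (\<lambda>_. r) (half_index n r)"
proof -
  have rr: "r \<le> r\<^sup>2" by (simp add: power2_eq_square)
  have "compatible_bound r i r j r" if ij: "i \<in> half_index n r" "j \<in> half_index n r" "i \<noteq> j" for i j
  proof -
    obtain b s c t where "i = (n,b,s)" "j = (n,c,t)" using ij by (auto simp: half_index_def)
    then show ?thesis
      using same_modulus_overlap[OF n r, of b s c t] ij unfolding compatible_bound_def half_index_def by auto
  qed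
  then show ?thesis
    using n r good_step_mono[OF _ rr] unfolding family_def by (auto simp: half_index_def pr_index_def)
qed

text \<open>There are n bases and about n / 2 steps, minus at most r^4 steps that are not good at
  level r^2.\<close>

lemma card_half_index:
  assumes n: "n \<ge> 1"
  shows "real (card (half_index n r)) \<le> (real n)\<^sup>2 / 2"
    and "(real n)\<^sup>2 / 2 - real n * (1 + real r ^ 4) \<le> real (card (half_index n r))"
proof -
  define T where "T = {s\<in>{1..int n}. 2 * s < int n}"
  define B where "B = {s\<in>{1..int n}. \<not> good_step n (r\<^sup>2) s}"
  define G where "G = {s\<in>{1..int n}. 2 * s < int n \<and> good_step n (r\<^sup>2) s}"
  have c: "card (half_index n r) = n * card G" by (simp add: half_index_def G_def card_cartesian_product)
  have "T = {1..(int n - 1) div 2}" by (auto simp: T_def)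
  then have cT: "card T = nat ((int n - 1) div 2)" by simp
  have fin: "finite T" "finite B" "finite G" by (simp_all add: T_def B_def G_def)
  have cB: "card B \<le> r ^ 4" using card_not_good[OF n, of "r\<^sup>2"] by (simp add: B_def power_mult [symmetric])
  have "card G \<le> card T" by (intro card_mono fin) (auto simp: T_def G_def)
  then have "2 * card G \<le> n" using cT n by linarith
  then have 1: "real (card G) \<le> real n / 2" by linarith
  have "card T \<le> card (G \<union> B)" by (intro card_mono) (auto simp: T_def G_def B_def)
  also have "\<dots> \<le> card G + r ^ 4" using card_Un_le[of G B] cB by linarith
  finally have "int (card T) \<le> int (card G + r ^ 4)" by (rule of_nat_mono)
  then have "(int n - 1) div 2 \<le> int (card G + r ^ 4)" using cT n by simp
  then have "int n \<le> 2 * int (card G + r ^ 4) + 2" by presburger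
  then have "n \<le> 2 * (card G + r ^ 4) + 2" by linarith
  then have "real n \<le> real (2 * (card G + r ^ 4) + 2)" by (rule of_nat_mono)
  then have 2: "real n / 2 - (1 + real r ^ 4) \<le> real (card G)" by simp
  show "real (card (half_index n r)) \<le> (real n)\<^sup>2 / 2"
    using mult_left_mono[OF 1, of "real n"] by (simp add: c power2_eq_square)
  show "(real n)\<^sup>2 / 2 - real n * (1 + real r ^ 4) \<le> real (card (half_index n r))"
    using mult_left_mono[OF 2, of "real n"] by (simp add: c power2_eq_square algebra_simps)
qed

text \<open>A declumped progression is a progression. Conversely, by \<open>has_ap_cases\<close>, a
  progression without a declumped one has one of at most r^4 bad steps or comes with one of length 2
  r; the two error terms are union bounds for these.\<close>

lemma has_ap_sandwich:
  assumes n: "n \<ge> 1" and r: "r \<ge> 2"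
  shows "\<bar>Pr (\<lambda>Y. \<not> has_ap n r Y) - Pr (\<lambda>Y. \<forall>i\<in>half_index n r. \<not> ap_ev r i Y)\<bar>
    \<le> real n * real r ^ 4 * p ^ r + (real n)\<^sup>2 * p ^ (2 * r)"
proof -
  define N where "N Y \<longleftrightarrow> (\<forall>i\<in>half_index n r. \<not> ap_ev r i Y)" for Y
  define S where "S = {s\<in>{1..int n}. good_step n (r - 1) s \<and> \<not> good_step n (r\<^sup>2) s}"
  define Z where "Z Y \<longleftrightarrow> (\<exists>a\<in>{1..int n}. \<exists>s\<in>S. \<forall>j<r. ap_term n a s j \<in> Y)" for Y
  have "finite (half_index n r)" by (simp add: half_index_def)
  then have dN: "depends_on (\<Union>i\<in>half_index n r. supp r i) N"
    unfolding N_def using n by (intro depends_on_all depends_on_not depends_on_ap_ev) (auto simp: half_index_def)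
  have dZ: "depends_on {1..n} Z" unfolding Z_def by (rule depends_on_ap[OF n])
  note dH = depends_on_has_ap[OF n]
  have rr: "r - 1 \<le> r\<^sup>2" using self_le_power[of r 2] r by simp
  have 1: "Pr (\<lambda>Y. \<not> has_ap n r Y) \<le> Pr N"
  proof (rule Pr_mono[OF dN])
    fix Y assume h: "\<not> has_ap n r Y"
    show "N Y" unfolding N_def
    proof (intro ballI notI)
      fix i assume i: "i \<in> half_index n r" "ap_ev r i Y"
      then obtain b s where "i = (n,b,s)" "s \<in> {1..int n}" "good_step n (r\<^sup>2) s"
        by (auto simp: half_index_def)
      then have "has_ap n r Y" using ap_ev_imp_has_ap[OF n good_step_mono[OF _ rr], of s b Y] i by blast
      then show False using h by simp
    qed
  qed
  have ev: "event N \<in> events" "event (\<lambda>Y. \<not> has_ap n r Y) \<in> events" "event Z \<in> events" "event (has_ap n (2 * r)) \<in> events"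
    using dN dZ dH depends_on_not event_measurable by blast+
  have "event N \<subseteq> event (\<lambda>Y. \<not> has_ap n r Y) \<union> (event Z \<union> event (has_ap n (2 * r)))"
  proof
    fix \<omega> assume w: "\<omega> \<in> event N"
    show "\<omega> \<in> event (\<lambda>Y. \<not> has_ap n r Y) \<union> (event Z \<union> event (has_ap n (2 * r)))"
    proof (cases "has_ap n r (X \<omega>)")
      case True
      have "Z (X \<omega>) \<or> has_ap n (2 * r) (X \<omega>)"
        using n r True
      proof (cases rule: has_ap_cases)
        case (declumped i)
        then show ?thesis using w by (auto simp: event_def N_def)
      next
        case double then show ?thesis by simp
      next
        case (bad a s)
        then show ?thesis unfolding Z_def S_def by blast
      qed
      then show ?thesis using w by (auto simp: event_def)
    next
      case False
      then show ?thesis using w by (auto simp: event_def)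
    qed
  qed
  then have "Pr N \<le> prob (event (\<lambda>Y. \<not> has_ap n r Y) \<union> (event Z \<union> event (has_ap n (2 * r))))"
    using ev by (intro finite_measure_mono sets.Un)
  also have "\<dots> \<le> Pr (\<lambda>Y. \<not> has_ap n r Y) + (Pr Z + Pr (has_ap n (2 * r)))"
    using ev by (intro order_trans[OF measure_Un_le] add_left_mono measure_Un_le sets.Un)
  also have "Pr Z \<le> real n * real r ^ 4 * p ^ r"
  proof -
    have "card S \<le> card {s\<in>{1..int n}. \<not> good_step n (r\<^sup>2) s}" by (intro card_mono) (auto simp: S_def)
    also have "\<dots> \<le> r ^ 4" using card_not_good[OF n, of "r\<^sup>2"] by (simp add: power_mult [symmetric])
    finally have "real (card S) \<le> real r ^ 4" by (metis of_nat_mono of_nat_power)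
    have "Pr Z \<le> real n * real (card S) * p ^ r"
      unfolding Z_def using r by (intro Pr_ap_le n) (auto simp: S_def)
    also have "\<dots> \<le> real n * real r ^ 4 * p ^ r"
      using \<open>real (card S) \<le> real r ^ 4\<close> p0 by (intro mult_right_mono mult_left_mono) auto
    finally show ?thesis .
  qed
  also have "Pr (has_ap n (2 * r)) \<le> (real n)\<^sup>2 * p ^ (2 * r)"
    using r by (intro Pr_has_ap_le n) simp
  finally show ?thesis using 1 unfolding N_def by linarith
qed

text \<open>Measured in units of n^2 p^r and m^2 p^r', both bounded by Q, the two parts of
  \<open>pair_bound\<close> have the same order: a single shared point leaves 1/m from the count,
  and a half overlap leaves p^(r'/2), again about 1/m.\<close>

lemma pair_bound_le:
  assumes m: "m \<ge> 1" and r: "r \<ge> 1" "r' \<ge> 1" and Q: "(real n)\<^sup>2 * p ^ r \<le> Q" "(real m)\<^sup>2 * p ^ r' \<le> Q" "1 \<le> Q"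
    and R: "real r + 1 \<le> R" "real r' + 1 \<le> R"
  shows "(real n)\<^sup>2 * pair_bound r r' m r' \<le> 2 * (R ^ 5 * Q\<^sup>2 / (p * real m))"
proof -
  have R1: "1 \<le> R" using R by simp
  have m0: "0 < real m" using m by simp
  let ?P = "p ^ r" and ?P' = "p ^ r'"
  have P0: "0 < ?P" "0 < ?P'" using p0 by auto
  have e1: "p ^ (r + r' - 1) = ?P * ?P' / p"
  proof -
    have "p ^ (r + r' - 1) * p = ?P * ?P'" using r by (simp add: power_add [symmetric] flip: power_Suc2)
    then show ?thesis using p0 by (simp add: field_simps)
  qed
  define k where "k = (r' + 1) div 2"
  have k: "k \<le> r'" "2 * k \<le> r' + 1" using r by (auto simp: k_def)
  have e2: "p ^ (r + r' - k) = ?P * p ^ (r' - k)" using k by (simp add: power_add [symmetric])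
  \<comment> \<open>The square is at most p^(r' - 1), because 2 k <= r' + 1, and hence at most Q /
    (p m^2); the rest uses p <= 1 <= Q.\<close>
  have e3: "p ^ (r' - k) \<le> Q / (p * real m)"
  proof (rule power2_le_imp_le)
    have "(p ^ (r' - k))\<^sup>2 = p ^ (2 * (r' - k))" by (simp add: power_mult [symmetric] mult.commute)
    also have "\<dots> \<le> p ^ (r' - 1)" using k p0 p1 by (intro power_decreasing) auto
    also have "\<dots> = ?P' / p" using r p0 by (cases r') auto
    also have "\<dots> \<le> (Q / (real m)\<^sup>2) / p"
      using Q(2) m0 p0 by (intro divide_right_mono) (auto simp: pos_le_divide_eq mult.commute)
    also have "\<dots> = Q * p / (p * real m)\<^sup>2" using p0 by (simp add: power2_eq_square)
    also have "\<dots> \<le> Q\<^sup>2 / (p * real m)\<^sup>2"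
      using Q(3) p0 p1 by (intro divide_right_mono) (auto simp: power2_eq_square)
    finally show "(p ^ (r' - k))\<^sup>2 \<le> (Q / (p * real m))\<^sup>2" by (simp add: power_divide)
    show "0 \<le> Q / (p * real m)" using Q p0 by simp
  qed
  have t1: "(real n)\<^sup>2 * (real ((r + 1) * (r' + 1) * m) * p ^ (r + r' - 1)) \<le> R ^ 5 * Q\<^sup>2 / (p * real m)"
  proof -
    have "(real n)\<^sup>2 * (real ((r + 1) * (r' + 1) * m) * p ^ (r + r' - 1))
        = ((real r + 1) * (real r' + 1)) * (((real n)\<^sup>2 * ?P) * ((real m)\<^sup>2 * ?P')) / (p * real m)"
      unfolding e1 using m0 p0 by (simp add: power2_eq_square field_simps)
    also have "\<dots> \<le> (R * R) * (Q * Q) / (p * real m)"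
      using Q R P0 m0 p0 by (intro divide_right_mono mult_mono) auto
    also have "\<dots> = R\<^sup>2 * (Q * Q) / (p * real m)" by (simp add: power2_eq_square)
    also have "\<dots> \<le> R ^ 5 * (Q * Q) / (p * real m)"
      using R1 Q m0 p0 by (intro divide_right_mono mult_right_mono power_increasing) auto
    finally show ?thesis by (simp add: power2_eq_square)
  qed
  have t2: "(real n)\<^sup>2 * (real ((r + 1)\<^sup>2 * (r' + 1)\<^sup>2 * r') * p ^ (r + r' - k)) \<le> R ^ 5 * Q\<^sup>2 / (p * real m)"
  proof -
    have "real ((r + 1)\<^sup>2 * (r' + 1)\<^sup>2 * r') = (real r + 1)\<^sup>2 * (real r' + 1)\<^sup>2 * real r'"
      by (simp add: add.commute)
    also have "\<dots> \<le> R\<^sup>2 * R\<^sup>2 * R" using R by (intro mult_mono power_mono) auto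
    also have "\<dots> = R ^ 5" by (simp add: power_numeral_reduce)
    finally have c: "real ((r + 1)\<^sup>2 * (r' + 1)\<^sup>2 * r') \<le> R ^ 5" .
    have "(real n)\<^sup>2 * (real ((r + 1)\<^sup>2 * (r' + 1)\<^sup>2 * r') * p ^ (r + r' - k))
       = real ((r + 1)\<^sup>2 * (r' + 1)\<^sup>2 * r') * (((real n)\<^sup>2 * ?P) * p ^ (r' - k))"
      unfolding e2 by (simp only: mult_ac)
    also have "\<dots> \<le> R ^ 5 * (Q * (Q / (p * real m)))"
      using c Q e3 P0 p0 m0 R1 by (intro mult_mono) auto
    finally show ?thesis by (simp add: power2_eq_square)
  qed
  have "(real n)\<^sup>2 * pair_bound r r' m r' \<le> R ^ 5 * Q\<^sup>2 / (p * real m) + R ^ 5 * Q\<^sup>2 / (p * real m)"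
    unfolding pair_bound_def k_def [symmetric] distrib_left[of "(real n)\<^sup>2"] by (rule add_mono[OF t1 t2])
  then show ?thesis by linarith
qed

text \<open>Per modulus the sieve error is at most five units R^5 Q^2 / (p N): one for the squares
  (p^r)^2, and twice two for the neighbour sums.\<close>

lemma family_sieve_le:
  assumes fam: "family Ms (\<lambda>_. r) I" and N: "\<And>m. m \<in> Ms \<Longrightarrow> m \<le> N" "N \<ge> 1" and Ms: "Ms \<noteq> {}"
    and r: "r \<ge> 1" and Q: "(real N)\<^sup>2 * p ^ r \<le> Q" "1 \<le> Q" and R: "real r + 1 \<le> R"
  shows "\<bar>Pr (\<lambda>Y. \<forall>i\<in>I. \<not> ap_ev r i Y) - exp (- (real (card I) * (q * p ^ r)))\<bar>
     \<le> real (card I) / (real N)\<^sup>2 * (5 * real (card Ms) * (R ^ 5 * Q\<^sup>2 / (p * real N)))"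
proof -
  have N0: "1 \<le> real N" using N by simp
  have finM: "finite Ms" using fam by (simp add: family_def)
  have cM: "1 \<le> real (card Ms)" using finM Ms by (simp add: Suc_le_eq card_gt_0_iff)
  define E where "E = R ^ 5 * Q\<^sup>2 / (p * real N)"
  have R1: "1 \<le> R" using R by simp
  have E0: "0 \<le> E" using R1 Q p0 N0 by (simp add: E_def)
  have a: "(real N)\<^sup>2 * (p ^ r)\<^sup>2 \<le> E"
  proof -
    have "(real N)\<^sup>2 * (p ^ r)\<^sup>2 = ((real N)\<^sup>2 * p ^ r)\<^sup>2 / (real N)\<^sup>2" using N0 by (simp add: power_mult_distrib power2_eq_square)
    also have "\<dots> \<le> Q\<^sup>2 / (real N)\<^sup>2" using Q p0 by (intro divide_right_mono power_mono) auto
    also have "\<dots> \<le> Q\<^sup>2 / (p * real N)"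
    proof (rule divide_left_mono)
      have "p * real N \<le> 1 * real N" using p1 by (intro mult_right_mono) auto
      also have "\<dots> \<le> real N * real N" using N0 by simp
      finally show "p * real N \<le> (real N)\<^sup>2" by (simp add: power2_eq_square)
    qed (use p0 N0 in auto)
    also have "\<dots> \<le> E" unfolding E_def
      using R1 p0 N0 by (intro divide_right_mono) (auto simp: mult_le_cancel_right1)
    finally show ?thesis .
  qed
  have b: "(real N)\<^sup>2 * pair_bound r r N r \<le> 2 * E" unfolding E_def by (rule pair_bound_le[OF N(2) r r Q(1,1,2) R R])
  have "(real N)\<^sup>2 * ((p ^ r)\<^sup>2 + 2 * real (card Ms) * pair_bound r r N r)
      = (real N)\<^sup>2 * (p ^ r)\<^sup>2 + 2 * real (card Ms) * ((real N)\<^sup>2 * pair_bound r r N r)"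
    by (simp add: algebra_simps)
  also have "\<dots> \<le> E + 2 * real (card Ms) * (2 * E)"
    by (intro add_mono a mult_left_mono b) simp
  also have "\<dots> \<le> real (card Ms) * E + 2 * real (card Ms) * (2 * E)" using mult_right_mono[OF cM E0] by (simp add: mult.commute)
  also have "\<dots> = 5 * real (card Ms) * E" by simp
  finally have c: "(p ^ r)\<^sup>2 + 2 * real (card Ms) * pair_bound r r N r \<le> 5 * real (card Ms) * E / (real N)\<^sup>2"
    using N0 by (simp add: pos_le_divide_eq mult.commute)
  have "\<bar>Pr (\<lambda>Y. \<forall>i\<in>I. \<not> ap_ev r i Y) - exp (- (real (card I) * (q * p ^ r)))\<bar>
     \<le> real (card I) * ((p ^ r)\<^sup>2 + 2 * real (card Ms) * pair_bound r r N r)"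
    by (rule family_sieve[OF fam N(1)])
  also have "\<dots> \<le> real (card I) * (5 * real (card Ms) * E / (real N)\<^sup>2)"
    by (intro mult_left_mono c) simp
  finally show ?thesis by (simp add: E_def mult_ac)
qed

lemma exp_neg_diff_le:
  fixes x y :: real
  assumes "0 \<le> x" "x \<le> y"
  shows "\<bar>exp (- x) - exp (- y)\<bar> \<le> y - x"
proof -
  have "1 - exp (- (y - x)) \<le> y - x" using exp_ge_add_one_self[of "- (y - x)"] by linarith
  moreover have "0 \<le> 1 - exp (- (y - x))" using assms by simp
  moreover have "exp (- x) - exp (- y) = exp (- x) * (1 - exp (- (y - x)))"
    by (simp add: right_diff_distrib flip: exp_add)
  moreover have "exp (- x) * (1 - exp (- (y - x))) \<le> 1 * (1 - exp (- (y - x)))"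
    using assms by (intro mult_right_mono) auto
  ultimately show ?thesis by (simp add: abs_le_iff)
qed

text \<open>The factor 8 collects five units from the sieve, two from the comparison with declumped
  progressions, and one from replacing the number of indices by n^2 / 2.\<close>

theorem Pr_no_ap_poisson:
  assumes n: "n \<ge> 1" and r: "r \<ge> 2" and Q: "(real n)\<^sup>2 * p ^ r \<le> Q" "1 \<le> Q" and R: "real r + 1 \<le> R"
  shows "\<bar>Pr (\<lambda>Y. \<not> has_ap n r Y) - exp (- (q * (real n)\<^sup>2 * p ^ r / 2))\<bar> \<le> 8 * (R ^ 5 * Q\<^sup>2 / (p * real n))"
proof -
  define E where "E = R ^ 5 * Q\<^sup>2 / (p * real n)"
  define c where "c = real (card (half_index n r))"
  let ?P = "p ^ r"
  have P0: "0 < ?P" using p0 by simp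
  have n0: "1 \<le> real n" using n by simp
  have R1: "1 \<le> R" using R by simp
  have E0: "0 \<le> E" using R1 Q p0 n0 by (simp add: E_def)
  have s1: "\<bar>Pr (\<lambda>Y. \<forall>i\<in>half_index n r. \<not> ap_ev r i Y) - exp (- (c * (q * ?P)))\<bar> \<le> c / (real n)\<^sup>2 * (5 * E)"
    using family_sieve_le[OF family_half_index[OF n r], of n Q R] n r Q R by (simp add: c_def E_def)
  have "c \<le> (real n)\<^sup>2 / 2" using card_half_index(1)[OF n, of r] by (simp add: c_def)
  also have "\<dots> \<le> (real n)\<^sup>2" by simp
  finally have "c \<le> (real n)\<^sup>2" .
  then have "c / (real n)\<^sup>2 \<le> 1" using n0 by (simp add: divide_le_eq)
  then have s1': "c / (real n)\<^sup>2 * (5 * E) \<le> 5 * E" using E0 mult_right_mono[of "c / (real n)\<^sup>2" 1 "5 * E"] by simp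
  have small: "real n * (real r + 1) ^ 4 * ?P \<le> E"
  proof -
    have "real n * (real r + 1) ^ 4 * ?P = (real r + 1) ^ 4 * ((real n)\<^sup>2 * ?P) / real n"
      using n0 by (simp add: power2_eq_square)
    also have "\<dots> \<le> R ^ 5 * Q\<^sup>2 / real n"
    proof (intro divide_right_mono mult_mono)
      have "(real r + 1) ^ 4 \<le> R ^ 4" using R by (intro power_mono) auto
      also have "\<dots> \<le> R ^ 5" using R1 by (intro power_increasing) auto
      finally show "(real r + 1) ^ 4 \<le> R ^ 5" .
      have "Q \<le> Q\<^sup>2" using Q by (simp add: power2_eq_square mult_le_cancel_left1)
      then show "(real n)\<^sup>2 * ?P \<le> Q\<^sup>2" using Q by linarith
    qed (use R1 P0 in auto)
    also have "\<dots> \<le> E" unfolding E_def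
      using p0 p1 n0 R1 Q by (intro divide_left_mono) (auto simp: mult_le_cancel_right1)
    finally show ?thesis .
  qed
  have r4: "real r ^ 4 \<le> (real r + 1) ^ 4" by (intro power_mono) auto
  have r4': "1 + real r ^ 4 \<le> (real r + 1) ^ 4"
    by (simp add: power4_eq_xxxx algebra_simps)
  have s2: "real n * real r ^ 4 * ?P \<le> E"
    using mult_right_mono[OF mult_left_mono[OF r4, of "real n"], of ?P] P0 small by simp
  have s3: "(real n)\<^sup>2 * p ^ (2 * r) \<le> E"
  proof -
    have "(real n)\<^sup>2 * p ^ (2 * r) = ((real n)\<^sup>2 * ?P)\<^sup>2 / (real n)\<^sup>2"
      using n0 by (simp add: power_mult_distrib power2_eq_square mult_2 power_add)
    also have "\<dots> \<le> Q\<^sup>2 / (real n)\<^sup>2" using Q P0 by (intro divide_right_mono power_mono) auto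
    also have "\<dots> \<le> Q\<^sup>2 / (p * real n)"
    proof (rule divide_left_mono)
      have "p * real n \<le> 1 * real n" using p1 by (intro mult_right_mono) auto
      also have "\<dots> \<le> real n * real n" using n0 by simp
      finally show "p * real n \<le> (real n)\<^sup>2" by (simp add: power2_eq_square)
    qed (use p0 n0 in auto)
    also have "\<dots> \<le> E" unfolding E_def
      using R1 p0 n0 by (intro divide_right_mono) (auto simp: mult_le_cancel_right1)
    finally show ?thesis .
  qed
  have s4: "\<bar>exp (- (c * (q * ?P))) - exp (- (q * (real n)\<^sup>2 * ?P / 2))\<bar> \<le> E"
  proof -
    have "\<bar>exp (- (c * (q * ?P))) - exp (- (q * (real n)\<^sup>2 * ?P / 2))\<bar> \<le> q * (real n)\<^sup>2 * ?P / 2 - c * (q * ?P)"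
    proof (rule exp_neg_diff_le)
      show "0 \<le> c * (q * ?P)" using q01 P0 by (simp add: c_def)
      have "c * (q * ?P) \<le> (real n)\<^sup>2 / 2 * (q * ?P)"
        using card_half_index(1)[OF n, of r] q01 P0 by (intro mult_right_mono) (auto simp: c_def)
      then show "c * (q * ?P) \<le> q * (real n)\<^sup>2 * ?P / 2" by (simp add: mult_ac)
    qed
    also have "\<dots> = ((real n)\<^sup>2 / 2 - c) * (q * ?P)" by (simp add: algebra_simps)
    also have "\<dots> \<le> (real n * (1 + real r ^ 4)) * (1 * ?P)"
      using card_half_index[OF n, of r] q01 P0 by (intro mult_mono) (auto simp: c_def)
    also have "\<dots> \<le> (real n * (real r + 1) ^ 4) * (1 * ?P)"
      using r4' P0 by (intro mult_right_mono mult_left_mono) auto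
    also have "\<dots> \<le> E" using small by simp
    finally show ?thesis .
  qed
  show ?thesis using s1 s1' s2 s3 s4 has_ap_sandwich[OF n r] unfolding E_def[symmetric]
    by linarith
qed

end

lemma tendsto_exp_ln_powr:
  assumes "0 < k" "0 < c"
  shows "(\<lambda>n::nat. exp (- (k * ln (real n) powr c))) \<longlonglongrightarrow> 0"
proof -
  have "filterlim (\<lambda>n::nat. ln (real n) powr c) at_top sequentially" using assms(2) by real_asymp
  moreover have "((\<lambda>x::real. exp (- (k * x))) \<longlongrightarrow> 0) at_top" using assms(1) by real_asymp
  ultimately show ?thesis by (rule filterlim_compose[rotated])
qed

section \<open>Tail probabilities and the distributional statements\<close>

context bernoulli_sequence
begin

definition Wn :: "nat \<Rightarrow> 'a \<Rightarrow> nat" where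
  "Wn n \<omega> = longest_ap (\<lambda>i. \<xi> i \<omega>) n"

text \<open>The positive form of ln p: C = 2 / \<open>lp\<close> and D = -1 /
  \<open>lp\<close>.\<close>

definition lp :: real where "lp = - ln p"

lemma lp_pos: "0 < lp" using p0 p1 by (simp add: lp_def)

lemma powr_lp: "p powr x = exp (- lp * x)"
  using p0 by (simp add: powr_def lp_def mult.commute)

lemma power_lp: "p ^ r = exp (- lp * real r)"
  using p0 by (simp add: powr_realpow [symmetric] powr_lp)

lemma Wn_ge_iff: "n \<ge> 1 \<Longrightarrow> r \<ge> 1 \<Longrightarrow> r \<le> Wn n \<omega> \<longleftrightarrow> has_ap n r (X \<omega>)"
  by (simp add: Wn_def X_def longest_ap_ge_iff)

lemma Wn_ge_event: "n \<ge> 1 \<Longrightarrow> r \<ge> 1 \<Longrightarrow> {\<omega> \<in> space M. r \<le> Wn n \<omega>} = event (has_ap n r)"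
  by (auto simp: event_def Wn_ge_iff)

lemma Wn_less_event: "n \<ge> 1 \<Longrightarrow> r \<ge> 1 \<Longrightarrow> {\<omega> \<in> space M. Wn n \<omega> < r} = event (\<lambda>Y. \<not> has_ap n r Y)"
  using Wn_ge_iff by (auto simp: event_def linorder_not_le [symmetric])

lemma Wn_less_real_event:
  assumes "n \<ge> 1" "y > 0"
  shows "{\<omega> \<in> space M. real (Wn n \<omega>) < y} = event (\<lambda>Y. \<not> has_ap n (nat \<lceil>y\<rceil>) Y)"
proof -
  have "real w < y \<longleftrightarrow> w < nat \<lceil>y\<rceil>" for w :: nat using assms(2) by linarith
  then show ?thesis using assms Wn_less_event[of n "nat \<lceil>y\<rceil>"] by (auto simp: Suc_le_eq)
qed

lemma Wn_less_real_events: "n \<ge> 1 \<Longrightarrow> y > 0 \<Longrightarrow> {\<omega> \<in> space M. real (Wn n \<omega>) < y} \<in> events"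
  unfolding Wn_less_real_event using event_measurable depends_on_not depends_on_has_ap by blast

lemma Wn_ge_real_event:
  assumes "n \<ge> 1" "y > 0"
  shows "{\<omega> \<in> space M. y \<le> real (Wn n \<omega>)} = event (has_ap n (nat \<lceil>y\<rceil>))"
proof -
  have "y \<le> real w \<longleftrightarrow> nat \<lceil>y\<rceil> \<le> w" for w :: nat using assms(2) by linarith
  then show ?thesis using assms Wn_ge_event[of n "nat \<lceil>y\<rceil>"] by (auto simp: Suc_le_eq)
qed

lemma Wn_ge_real_events: "n \<ge> 1 \<Longrightarrow> y > 0 \<Longrightarrow> {\<omega> \<in> space M. y \<le> real (Wn n \<omega>)} \<in> events"
  unfolding Wn_ge_real_event using event_measurable depends_on_has_ap by blast

text \<open>A plain first moment bound. It carries no additive error, so it remains useful where the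
  tail is smaller than the Poisson error.\<close>

lemma upper_tail:
  assumes "n \<ge> 1" "y > 0"
  shows "prob {\<omega> \<in> space M. y \<le> real (Wn n \<omega>)} \<le> (real n)\<^sup>2 * p powr y"
proof -
  have "prob {\<omega> \<in> space M. y \<le> real (Wn n \<omega>)} \<le> (real n)\<^sup>2 * p ^ nat \<lceil>y\<rceil>"
    unfolding Wn_ge_real_event[OF assms] using assms by (intro Pr_has_ap_le) (auto simp: Suc_le_eq)
  also have "p ^ nat \<lceil>y\<rceil> \<le> p powr y"
    unfolding power_lp powr_lp using lp_pos assms by (simp add: mult_left_mono)
  finally show ?thesis by (simp add: mult_left_mono)
qed

text \<open>\<open>Pr_no_ap_poisson\<close> is sharp enough only while n^2 p^r lies between 1/n and
  a multiple of ln n; there both r and Q are of order ln n, giving ln^7 n / n. Below this range both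
  probabilities are within 1/n of 1. Above it both are small: the Poisson one directly, the other by
  monotonicity in r.\<close>

theorem poisson_approximation:
  "\<exists>K\<ge>0. \<forall>n\<ge>3. \<forall>r\<ge>2. \<bar>Pr (\<lambda>Y. \<not> has_ap n r Y) - exp (- (q * (real n)\<^sup>2 * p ^ r / 2))\<bar> \<le> K * (ln (real n) ^ 7 / real n)"
proof -
  \<comment> \<open>\<open>A\<close> bounds (r + 1) / ln n, since n^2 p^r >= 1/n means r <= 3 ln n /
    \<open>lp\<close>. \<open>B\<close> bounds n^2 p^r / ln n; its factor 1/p leaves room for
    rounding a length down.\<close>
  define A where "A = 3 / lp + 1"
  define B where "B = 2 / (p * q)"
  define K where "K = 8 * (A ^ 5 * B\<^sup>2 / p)"
  have B2: "2 \<le> B" unfolding B_def using p0 p1 q01 by (simp add: pos_le_divide_eq mult_le_one)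
  have A1: "1 \<le> A" using lp_pos by (simp add: A_def)
  have K0: "0 \<le> K" using A1 B2 p0 by (simp add: K_def)
  have ln3: "1 \<le> ln (real n)" if "n \<ge> 3" for n
  proof -
    have "exp 1 \<le> (3::real)" using exp_le by simp
    then have "exp 1 \<le> real n" using that by linarith
    then show ?thesis using that by (simp add: ln_ge_iff)
  qed
  have mid: "\<bar>Pr (\<lambda>Y. \<not> has_ap n r Y) - exp (- (q * (real n)\<^sup>2 * p ^ r / 2))\<bar> \<le> K * (ln (real n) ^ 7 / real n)"
    if n: "n \<ge> 3" and r: "r \<ge> 2" and lo: "1 / real n \<le> (real n)\<^sup>2 * p ^ r" and up: "(real n)\<^sup>2 * p ^ r \<le> B * ln (real n)" for n r
  proof -
    have n0: "0 < real n" using n by simp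
    have "1 \<le> (real n) ^ 3 * p ^ r" using lo n0 by (simp add: field_simps power3_eq_cube power2_eq_square)
    then have "0 \<le> ln ((real n) ^ 3 * p ^ r)" by simp
    also have "\<dots> = 3 * ln (real n) - lp * real r"
      using n0 p0 by (simp add: ln_mult ln_realpow lp_def mult.commute)
    finally have "real r \<le> 3 * ln (real n) / lp" using lp_pos by (simp add: pos_le_divide_eq mult.commute)
    then have R: "real r + 1 \<le> A * ln (real n)" using ln3[OF n] by (simp add: A_def distrib_right)
    have "1 * 1 \<le> B * ln (real n)" using ln3[OF n] B2 by (intro mult_mono) auto
    then have "\<bar>Pr (\<lambda>Y. \<not> has_ap n r Y) - exp (- (q * (real n)\<^sup>2 * p ^ r / 2))\<bar>
        \<le> 8 * ((A * ln (real n)) ^ 5 * (B * ln (real n))\<^sup>2 / (p * real n))"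
      using n r up R by (intro Pr_no_ap_poisson) auto
    also have "\<dots> = K * (ln (real n) ^ 7 / real n)"
      by (simp add: K_def power_mult_distrib power_numeral_reduce)
    finally show ?thesis .
  qed
  have "\<bar>Pr (\<lambda>Y. \<not> has_ap n r Y) - exp (- (q * (real n)\<^sup>2 * p ^ r / 2))\<bar> \<le> (K + 2) * (ln (real n) ^ 7 / real n)"
    if n: "n \<ge> 3" and r: "r \<ge> 2" for n r
  proof -
    have n0: "0 < real n" "1 \<le> n" using n by auto
    have "1 \<le> ln (real n) ^ 7" using ln3[OF n] by simp
    then have inv: "1 / real n \<le> ln (real n) ^ 7 / real n" using n0 by (simp add: divide_right_mono)
    have L0: "0 \<le> ln (real n) ^ 7 / real n" using ln3[OF n] n0 by simp
    have KL: "K * (ln (real n) ^ 7 / real n) + 2 * (1 / real n) \<le> (K + 2) * (ln (real n) ^ 7 / real n)"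
      unfolding distrib_right using inv by linarith
    have dep: "depends_on {1..n} (has_ap n s)" for s by (rule depends_on_has_ap[OF n0(2)])
    consider "(real n)\<^sup>2 * p ^ r < 1 / real n" | "1 / real n \<le> (real n)\<^sup>2 * p ^ r" "(real n)\<^sup>2 * p ^ r \<le> B * ln (real n)"
      | "B * ln (real n) < (real n)\<^sup>2 * p ^ r" by linarith
    then show ?thesis
    proof cases
      case 1
      have "Pr (has_ap n r) \<le> 1 / real n" using Pr_has_ap_le[of n r] n r 1 by simp
      moreover have "Pr (\<lambda>Y. \<not> has_ap n r Y) = 1 - Pr (has_ap n r)" by (rule Pr_not[OF dep])
      moreover have "1 - q * (real n)\<^sup>2 * p ^ r / 2 \<le> exp (- (q * (real n)\<^sup>2 * p ^ r / 2))"
        using exp_ge_add_one_self[of "- (q * (real n)\<^sup>2 * p ^ r / 2)"] by simp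
      moreover have "q * (real n)\<^sup>2 * p ^ r / 2 \<le> 1 / real n"
      proof -
        have "(q / 2) * ((real n)\<^sup>2 * p ^ r) \<le> 1 * (1 / real n)" using 1 q01 p0 by (intro mult_mono) auto
        then show ?thesis by (simp add: mult.assoc)
      qed
      moreover have "exp (- (q * (real n)\<^sup>2 * p ^ r / 2)) \<le> 1" using q01 p0 by simp
      moreover have "0 \<le> Pr (has_ap n r)" by simp
      ultimately have "\<bar>Pr (\<lambda>Y. \<not> has_ap n r Y) - exp (- (q * (real n)\<^sup>2 * p ^ r / 2))\<bar> \<le> 1 / real n"
        by linarith
      then show ?thesis using KL inv K0 L0 mult_nonneg_nonneg[OF K0 L0] by linarith
    next
      case 2
      have "K * (ln (real n) ^ 7 / real n) \<le> (K + 2) * (ln (real n) ^ 7 / real n)"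
        by (rule mult_right_mono[OF _ L0]) simp
      then show ?thesis using mid[OF n r 2] by linarith
    next
      case 3
      \<comment> \<open>At length z the Poisson mean q n^2 p^z / 2 equals ln n, so its exponential
        is 1/n. Rounding down to r' raises the mean at most to ln n / p, still inside the middle
        range.\<close>
      define z where "z = ln (q * (real n)\<^sup>2 / (2 * ln (real n))) / lp"
      define r' where "r' = nat \<lfloor>z\<rfloor>"
      have arg: "0 < q * (real n)\<^sup>2 / (2 * ln (real n))" 
      proof -
        have "0 < ln (real n)" using ln3[OF n] by linarith
        then show ?thesis using q01 n0(1) by (intro divide_pos_pos mult_pos_pos zero_less_power) simp_all
      qed
      have key: "p powr z = 2 * ln (real n) / (q * (real n)\<^sup>2)"
        unfolding powr_lp z_def using lp_pos arg by (simp add: exp_minus)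
      have "2 * ln (real n) / (q * (real n)\<^sup>2) < p ^ r"
      proof -
        have "2 / q * ln (real n) \<le> B * ln (real n)"
          using ln3[OF n] p0 p1 q01 unfolding B_def by (intro mult_right_mono divide_left_mono) auto
        then have "2 / q * ln (real n) < (real n)\<^sup>2 * p ^ r" using 3 by linarith
        then have "2 / q * ln (real n) / (real n)\<^sup>2 < p ^ r" 
          using n0 by (subst pos_divide_less_eq) (simp_all only: zero_less_power mult.commute[of "p ^ r"])
        then show ?thesis by (simp only: times_divide_eq_left divide_divide_eq_left)
      qed
      then have "p powr z < p powr real r" using key p0 by (simp add: powr_realpow)
      then have "real r < z" unfolding powr_lp using lp_pos by simp
      then have rr': "r \<le> r'" "real r' \<le> z" "z < real r' + 1" by (auto simp: r'_def le_nat_floor)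
      have lo': "2 * ln (real n) / q \<le> (real n)\<^sup>2 * p ^ r'"
      proof -
        have "p powr z \<le> p powr real r'" unfolding powr_lp using rr' lp_pos by simp
        then have "2 * ln (real n) / (q * (real n)\<^sup>2) \<le> p ^ r'" using key p0 by (simp add: powr_realpow)
        then have "(real n)\<^sup>2 * (2 * ln (real n) / (q * (real n)\<^sup>2)) \<le> (real n)\<^sup>2 * p ^ r'"
          by (rule mult_left_mono) simp
        then show ?thesis using n0 by simp
      qed
      have up': "(real n)\<^sup>2 * p ^ r' \<le> B * ln (real n)"
      proof -
        have "p powr (real r' + 1) \<le> p powr z" unfolding powr_lp using rr' lp_pos by simp
        then have "p ^ r' * p \<le> 2 * ln (real n) / (q * (real n)\<^sup>2)" using key p0 by (simp add: powr_realpow powr_add)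
        then have "(real n)\<^sup>2 * (p ^ r' * p) \<le> (real n)\<^sup>2 * (2 * ln (real n) / (q * (real n)\<^sup>2))"
          by (rule mult_left_mono) simp
        then have "(real n)\<^sup>2 * p ^ r' * p \<le> 2 * ln (real n) / q" using n0 by simp
        then have "(real n)\<^sup>2 * p ^ r' \<le> 2 * ln (real n) / q / p" unfolding pos_le_divide_eq[OF p0] .
        then show ?thesis by (simp add: B_def mult.commute)
      qed
      have lo1: "2 \<le> 2 * ln (real n) / q" using ln3[OF n] q01 by (simp add: pos_le_divide_eq)
      have "1 / real n \<le> 1" using n by simp
      then have lo'': "1 / real n \<le> (real n)\<^sup>2 * p ^ r'" using lo' lo1 by linarith
      have m: "\<bar>Pr (\<lambda>Y. \<not> has_ap n r' Y) - exp (- (q * (real n)\<^sup>2 * p ^ r' / 2))\<bar> \<le> K * (ln (real n) ^ 7 / real n)"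
        using r rr' by (intro mid n lo'' up') simp
      have e: "exp (- (q * (real n)\<^sup>2 * p ^ s / 2)) \<le> 1 / real n" if "2 * ln (real n) / q \<le> (real n)\<^sup>2 * p ^ s" for s
      proof -
        have "ln (real n) \<le> q * (real n)\<^sup>2 * p ^ s / 2" using that q01 by (simp add: pos_divide_le_eq mult_ac)
        then have "exp (- (q * (real n)\<^sup>2 * p ^ s / 2)) \<le> exp (- ln (real n))" by simp
        also have "\<dots> = 1 / real n" using n0 by (simp add: exp_minus inverse_eq_divide)
        finally show ?thesis .
      qed
      have "(real n)\<^sup>2 * p ^ r' \<le> (real n)\<^sup>2 * p ^ r"
        using rr'(1) p0 p1 by (intro mult_left_mono power_decreasing) auto
      then have e1: "exp (- (q * (real n)\<^sup>2 * p ^ r / 2)) \<le> 1 / real n" using lo' by (intro e) linarith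
      have "Pr (\<lambda>Y. \<not> has_ap n r Y) \<le> Pr (\<lambda>Y. \<not> has_ap n r' Y)"
        by (rule Pr_mono[OF depends_on_not[OF dep]]) (use rr' has_ap_antimono in blast)
      then have "Pr (\<lambda>Y. \<not> has_ap n r Y) \<le> 1 / real n + K * (ln (real n) ^ 7 / real n)"
        using m e[OF lo'] by linarith
      moreover have "0 \<le> Pr (\<lambda>Y. \<not> has_ap n r Y)" "0 < exp (- (q * (real n)\<^sup>2 * p ^ r / 2))" by simp_all
      ultimately show ?thesis using e1 KL inv mult_nonneg_nonneg[OF K0 L0] n0
        by (intro abs_leI) (smt (verit) divide_nonneg_nonneg)+
    qed
  qed
  then show ?thesis using K0 by (intro exI[of _ "K + 2"]) auto
qed

definition poisson_const :: real where
  "poisson_const = (SOME K. K \<ge> 0 \<and> (\<forall>n\<ge>3. \<forall>r\<ge>2. \<bar>Pr (\<lambda>Y. \<not> has_ap n r Y) - exp (- (q * (real n)\<^sup>2 * p ^ r / 2))\<bar> \<le> K * (ln (real n) ^ 7 / real n)))"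

lemma poisson_const: "0 \<le> poisson_const"
  "n \<ge> 3 \<Longrightarrow> r \<ge> 2 \<Longrightarrow> \<bar>Pr (\<lambda>Y. \<not> has_ap n r Y) - exp (- (q * (real n)\<^sup>2 * p ^ r / 2))\<bar> \<le> poisson_const * (ln (real n) ^ 7 / real n)"
  using someI_ex[OF poisson_approximation] unfolding poisson_const_def by auto

text \<open>Rounding y up to an integer length costs at most one factor p, visible in the
  exponent.\<close>

lemma lower_tail:
  assumes n: "n \<ge> 3" and y: "y \<ge> 2"
  shows "prob {\<omega> \<in> space M. real (Wn n \<omega>) < y}
    \<le> exp (- (p * q / 2 * ((real n)\<^sup>2 * p powr y))) + poisson_const * (ln (real n) ^ 7 / real n)"
proof -
  let ?r = "nat \<lceil>y\<rceil>"
  have "real ?r \<le> y + 1" using y by linarith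
  then have "p powr (y + 1) \<le> p powr (real ?r)" unfolding powr_lp using lp_pos by simp
  then have pr: "p * p powr y \<le> p ^ ?r" using p0 by (simp add: powr_realpow powr_add mult.commute)
  have "prob {\<omega> \<in> space M. real (Wn n \<omega>) < y} = Pr (\<lambda>Y. \<not> has_ap n ?r Y)"
    using n y by (subst Wn_less_real_event) auto
  also have "\<dots> \<le> exp (- (q * (real n)\<^sup>2 * p ^ ?r / 2)) + poisson_const * (ln (real n) ^ 7 / real n)"
    using poisson_const(2)[OF n, of ?r] y by (simp add: abs_le_iff) linarith
  also have "exp (- (q * (real n)\<^sup>2 * p ^ ?r / 2)) \<le> exp (- (p * q / 2 * ((real n)\<^sup>2 * p powr y)))"
  proof -
    have "(q * (real n)\<^sup>2 / 2) * (p * p powr y) \<le> (q * (real n)\<^sup>2 / 2) * p ^ ?r"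
      using pr q01 by (intro mult_left_mono) auto
    then show ?thesis by (simp add: mult_ac)
  qed
  finally show ?thesis by simp
qed

text \<open>At C ln n the factor n^2 cancels, and a shift by x leaves p^x as the size of n^2
  p^r.\<close>

lemma sq_mult_powr:
  assumes "n > 0" shows "n\<^sup>2 * p powr (2 / lp * ln n + x) = p powr x"
proof -
  have "n\<^sup>2 = exp (2 * ln n)" using assms by (simp add: exp_double)
  then show ?thesis unfolding powr_lp using lp_pos by (simp add: algebra_simps flip: exp_add)
qed

theorem poisson_error_Max:
  "\<exists>K. \<forall>\<^sub>F n in sequentially.
     (MAX r\<in>{1<..n}. \<bar>prob {\<omega> \<in> space M. Wn n \<omega> < r} - exp (- (q * real n ^ 2 * p ^ r / 2))\<bar>)
       \<le> K * (ln (real n) ^ 7 / real n)"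
proof (intro exI eventually_sequentiallyI)
  fix n :: nat assume n: "3 \<le> n"
  show "(MAX r\<in>{1<..n}. \<bar>prob {\<omega> \<in> space M. Wn n \<omega> < r} - exp (- (q * real n ^ 2 * p ^ r / 2))\<bar>)
       \<le> poisson_const * (ln (real n) ^ 7 / real n)"
    using n poisson_const(2) by (subst Max_le_iff) (auto simp: Wn_less_event)
qed

text \<open>The absolute error is multiplied by exp(q p^x / 2). The lower limit on x gives p^x <=
  p^a ln n, so this factor is at most n^(q p^a / 2), which is the loss in the exponent of n.\<close>

theorem poisson_ratio_error:
  "\<exists>K. \<forall>\<^sub>F n in sequentially.
     \<forall>x::real. x \<ge> - 1 / lp * ln (ln (real n)) + a \<and> 2 / lp * ln (real n) + x \<in> \<int> \<longrightarrow>
       \<bar>exp (q / 2 * p powr x) * prob {\<omega> \<in> space M. real (Wn n \<omega>) < 2 / lp * ln (real n) + x} - 1\<bar>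
         \<le> K * (ln (real n) ^ 7 / real n powr (1 - q * p powr a / 2))"
proof (intro exI)
  have c: "0 < 2 / lp" "0 < 1 / lp" using lp_pos by auto
  have "filterlim (\<lambda>n. 2 / lp * ln (real n) - 1 / lp * ln (ln (real n)) + a) at_top sequentially"
    using c by real_asymp
  then have "\<forall>\<^sub>F n in sequentially. 2 \<le> 2 / lp * ln (real n) - 1 / lp * ln (ln (real n)) + a"
    by (simp add: filterlim_at_top)
  then show "\<forall>\<^sub>F n in sequentially.
     \<forall>x::real. x \<ge> - 1 / lp * ln (ln (real n)) + a \<and> 2 / lp * ln (real n) + x \<in> \<int> \<longrightarrow>
       \<bar>exp (q / 2 * p powr x) * prob {\<omega> \<in> space M. real (Wn n \<omega>) < 2 / lp * ln (real n) + x} - 1\<bar>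
         \<le> poisson_const * (ln (real n) ^ 7 / real n powr (1 - q * p powr a / 2))"
    using eventually_ge_at_top[of 3]
  proof eventually_elim
    case (elim n)
    show ?case
    proof (intro allI impI)
      fix x :: real
      assume x: "x \<ge> - 1 / lp * ln (ln (real n)) + a \<and> 2 / lp * ln (real n) + x \<in> \<int>"
      define y where "y = 2 / lp * ln (real n) + x"
      have y2: "2 \<le> y" using x elim by (simp add: y_def)
      obtain z where z: "y = of_int z" using x by (auto simp: y_def elim: Ints_cases)
      define r where "r = nat z"
      have r: "y = real r" "r \<ge> 2" "nat \<lceil>y\<rceil> = r" using z y2 by (auto simp: r_def)
      have n0: "0 < real n" "1 < ln (real n)"
      proof -
        have "exp 1 < (3::real)" using e_less_272 by simp
        then have "exp 1 < real n" using elim by linarith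
        then show "1 < ln (real n)" using elim ln_less_cancel_iff[of "exp 1" "real n"] by simp
      qed (use elim in simp)
      have ev: "prob {\<omega> \<in> space M. real (Wn n \<omega>) < y} = Pr (\<lambda>Y. \<not> has_ap n r Y)"
        using elim y2 r by (subst Wn_less_real_event) auto
      have mu: "(real n)\<^sup>2 * p ^ r = p powr x"
        using sq_mult_powr[OF n0(1), of x] r(1) p0 by (simp add: y_def powr_realpow [symmetric])
      have K: "\<bar>Pr (\<lambda>Y. \<not> has_ap n r Y) - exp (- (q / 2 * p powr x))\<bar> \<le> poisson_const * (ln (real n) ^ 7 / real n)"
        using poisson_const(2)[OF _ r(2), of n] elim mu by (simp add: mult.assoc)
      have px: "p powr x \<le> ln (real n) * p powr a"
      proof -
        have "p powr x \<le> p powr (- 1 / lp * ln (ln (real n)) + a)" unfolding powr_lp using x lp_pos by simp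
        also have "\<dots> = ln (real n) * p powr a"
        proof -
          have eq: "- lp * (- 1 / lp * ln (ln (real n)) + a) = ln (ln (real n)) + - lp * a"
            using lp_pos by (simp add: field_simps)
          show ?thesis unfolding powr_lp eq exp_add using n0(2) by (subst exp_ln) linarith+
        qed
        finally show ?thesis .
      qed
      have "exp (q / 2 * p powr x) \<le> exp (ln (real n) * (q * p powr a / 2))"
        using mult_left_mono[OF px, of "q / 2"] q01 by (simp add: mult_ac)
      also have "\<dots> = real n powr (q * p powr a / 2)" using n0 by (simp add: powr_def mult.commute)
      finally have E: "exp (q / 2 * p powr x) \<le> real n powr (q * p powr a / 2)" .
      have "exp (q / 2 * p powr x) * Pr (\<lambda>Y. \<not> has_ap n r Y) - 1
          = exp (q / 2 * p powr x) * (Pr (\<lambda>Y. \<not> has_ap n r Y) - exp (- (q / 2 * p powr x)))"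
        by (simp add: right_diff_distrib flip: exp_add)
      then have "\<bar>exp (q / 2 * p powr x) * Pr (\<lambda>Y. \<not> has_ap n r Y) - 1\<bar>
          = exp (q / 2 * p powr x) * \<bar>Pr (\<lambda>Y. \<not> has_ap n r Y) - exp (- (q / 2 * p powr x))\<bar>"
        by (simp add: abs_mult)
      also have "\<dots> \<le> real n powr (q * p powr a / 2) * (poisson_const * (ln (real n) ^ 7 / real n))"
        by (intro mult_mono E K) auto
      also have "\<dots> = poisson_const * (ln (real n) ^ 7 / real n powr (1 - q * p powr a / 2))"
        using n0 by (simp add: powr_diff)
      finally show "\<bar>exp (q / 2 * p powr x) * prob {\<omega> \<in> space M. real (Wn n \<omega>) < 2 / lp * ln (real n) + x} - 1\<bar>
         \<le> poisson_const * (ln (real n) ^ 7 / real n powr (1 - q * p powr a / 2))"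
        using ev by (simp add: y_def)
    qed
  qed
qed

text \<open>A deviation of \<epsilon> ln ln n changes n^2 p^r by the power (ln n)^(\<open>lp\<close>
  \<epsilon>): the upper tail is at most its inverse, the lower tail is exponentially small in it up
  to the Poisson error.\<close>

theorem tendsto_in_prob_normalised:
  assumes e: "0 < \<epsilon>"
  shows "(\<lambda>n. prob {\<omega> \<in> space M. \<bar>(real (Wn n \<omega>) - 2 / lp * ln (real n)) / ln (ln (real n)) - 0\<bar> > \<epsilon>}) \<longlonglongrightarrow> 0"
proof (rule tendsto_sandwich[of "\<lambda>_. 0"])
  define c where "c = lp * \<epsilon>"
  have c0: "0 < c" using e lp_pos by (simp add: c_def)
  let ?u = "\<lambda>n. ln (real n) powr (- c) + (exp (- (p * q / 2 * ln (real n) powr c)) + poisson_const * (ln (real n) ^ 7 / real n))"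
  have C: "0 < 2 / lp" using lp_pos by simp
  have "filterlim (\<lambda>n. 2 / lp * ln (real n) - \<epsilon> * ln (ln (real n))) at_top sequentially"
    using C e by real_asymp
  then have "\<forall>\<^sub>F n in sequentially. 2 \<le> 2 / lp * ln (real n) - \<epsilon> * ln (ln (real n))"
    by (simp add: filterlim_at_top)
  moreover have "\<forall>\<^sub>F n in sequentially. 1 < ln (real n)" by real_asymp
  ultimately show "\<forall>\<^sub>F n in sequentially.
     prob {\<omega> \<in> space M. \<bar>(real (Wn n \<omega>) - 2 / lp * ln (real n)) / ln (ln (real n)) - 0\<bar> > \<epsilon>} \<le> ?u n"
    using eventually_ge_at_top[of 3]
  proof eventually_elim
    case (elim n)
    let ?l = "ln (ln (real n))"
    have l0: "0 < ?l" using elim by simp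
    have n0: "0 < real n" "n \<ge> 1" using elim by auto
    let ?y = "2 / lp * ln (real n) + \<epsilon> * ?l" and ?z = "2 / lp * ln (real n) - \<epsilon> * ?l"
    have el: "0 < \<epsilon> * ?l" using l0 e by simp
    have z0: "0 < ?z" using elim by linarith
    then have y0: "0 < ?y" using el by linarith
    let ?A = "{\<omega> \<in> space M. ?y \<le> real (Wn n \<omega>)}" and ?B = "{\<omega> \<in> space M. real (Wn n \<omega>) < ?z}"
    have ev: "?A \<in> events" "?B \<in> events"
      by (rule Wn_ge_real_events[OF n0(2) y0], rule Wn_less_real_events[OF n0(2) z0])
    have "{\<omega> \<in> space M. \<bar>(real (Wn n \<omega>) - 2 / lp * ln (real n)) / ?l - 0\<bar> > \<epsilon>} \<subseteq> ?A \<union> ?B"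
    proof
      fix \<omega> assume w: "\<omega> \<in> {\<omega> \<in> space M. \<bar>(real (Wn n \<omega>) - 2 / lp * ln (real n)) / ?l - 0\<bar> > \<epsilon>}"
      define d where "d = real (Wn n \<omega>) - 2 / lp * ln (real n)"
      have "\<epsilon> < \<bar>d\<bar> / ?l" using w l0 by (simp add: d_def)
      then have "\<epsilon> * ?l < \<bar>d\<bar>" unfolding pos_less_divide_eq[OF l0] .
      then show "\<omega> \<in> ?A \<union> ?B" using w unfolding d_def by (cases "d \<ge> 0") auto
    qed
    then have "prob {\<omega> \<in> space M. \<bar>(real (Wn n \<omega>) - 2 / lp * ln (real n)) / ?l - 0\<bar> > \<epsilon>} \<le> prob (?A \<union> ?B)"
      using ev by (intro finite_measure_mono sets.Un)
    also have "\<dots> \<le> prob ?A + prob ?B" using ev by (rule measure_Un_le)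
    also have "prob ?A \<le> ln (real n) powr (- c)"
    proof -
      have "prob ?A \<le> (real n)\<^sup>2 * p powr ?y" by (rule upper_tail[OF n0(2) y0])
      also have "\<dots> = p powr (\<epsilon> * ?l)" by (rule sq_mult_powr[OF n0(1)])
      also have "\<dots> = ln (real n) powr (- c)" unfolding powr_lp using elim by (simp add: powr_def c_def)
      finally show ?thesis .
    qed
    also have "prob ?B \<le> exp (- (p * q / 2 * ln (real n) powr c)) + poisson_const * (ln (real n) ^ 7 / real n)"
    proof -
      have "prob ?B \<le> exp (- (p * q / 2 * ((real n)\<^sup>2 * p powr ?z))) + poisson_const * (ln (real n) ^ 7 / real n)"
        by (rule lower_tail) (use elim in auto)
      also have "(real n)\<^sup>2 * p powr ?z = p powr (- (\<epsilon> * ?l))"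
        using sq_mult_powr[OF n0(1), of "- (\<epsilon> * ?l)"] by simp
      also have "\<dots> = ln (real n) powr c" unfolding powr_lp using elim by (simp add: powr_def c_def)
      finally show ?thesis .
    qed
    finally show ?case by simp
  qed
  have pq: "0 < p * q / 2" using p0 q01 by simp
  have 1: "(\<lambda>n. ln (real n) powr (- c)) \<longlonglongrightarrow> 0" using c0 by real_asymp
  have 2: "(\<lambda>n. exp (- (p * q / 2 * ln (real n) powr c))) \<longlonglongrightarrow> 0"
    using pq c0 by (rule tendsto_exp_ln_powr)
  have 3: "(\<lambda>n. poisson_const * (ln (real n) ^ 7 / real n)) \<longlonglongrightarrow> 0"
    by (rule tendsto_mult_right_zero) real_asymp
  show "?u \<longlonglongrightarrow> 0" using tendsto_add[OF 1 tendsto_add[OF 2 3]] by simp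
qed auto

end

section \<open>Almost sure bounds by the Borel-Cantelli lemma\<close>

lemma summable_le_inverse_square:
  fixes f :: "nat \<Rightarrow> real"
  assumes "\<forall>\<^sub>F k in sequentially. \<bar>f k\<bar> \<le> 1 / (real k)\<^sup>2"
  shows "summable f"
proof (rule summable_comparison_test_ev)
  show "summable (\<lambda>k. inverse ((real k)\<^sup>2))" by (rule inverse_power_summable) simp
  show "\<forall>\<^sub>F k in sequentially. norm (f k) \<le> inverse ((real k)\<^sup>2)"
    using assms by eventually_elim (simp add: inverse_eq_divide)
qed

lemma summable_exp_powr:
  assumes "0 < c" "0 < e" "0 < b"
  shows "summable (\<lambda>k. exp (- (c * (b * real k) powr e)))"
proof (rule summable_le_inverse_square)
  show "\<forall>\<^sub>F k in sequentially. \<bar>exp (- (c * (b * real k) powr e))\<bar> \<le> 1 / (real k)\<^sup>2"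
    using assms by real_asymp
qed

lemma summable_power_over_exp:
  assumes "0 < c"
  shows "summable (\<lambda>k. c * (ln 2 * real k) ^ j / 2 ^ k)"
proof (rule summable_le_inverse_square)
  have "(\<lambda>k. (real k)\<^sup>2 * (c * (ln 2 * real k) ^ j / 2 ^ k)) \<longlonglongrightarrow> 0" using assms by real_asymp
  then have "\<forall>\<^sub>F k in sequentially. (real k)\<^sup>2 * (c * (ln 2 * real k) ^ j / 2 ^ k) < 1"
    by (rule order_tendstoD) simp
  then show "\<forall>\<^sub>F k in sequentially. \<bar>c * (ln 2 * real k) ^ j / 2 ^ k\<bar> \<le> 1 / (real k)\<^sup>2"
    using eventually_gt_at_top[of 0]
  proof eventually_elim
    case (elim k)
    have "c * (ln 2 * real k) ^ j / 2 ^ k \<le> 1 / (real k)\<^sup>2"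
      using elim by (subst pos_le_divide_eq) (simp_all add: mult_ac)
    moreover have "0 \<le> c * (ln 2 * real k) ^ j / 2 ^ k" using assms by simp
    ultimately show ?case by simp
  qed
qed

lemma summable_powr_less: "e < -1 \<Longrightarrow> summable (\<lambda>k. (b * real k) powr e)" if "0 \<le> b" for b :: real
  using summable_mult[of "\<lambda>k. real k powr e" "b powr e"] that
  by (simp add: powr_mult summable_real_powr_iff)

text \<open>The expectation of the weighted count is finite. This gives the density of the set of k
  with \<open>F k\<close>, also where P(\<open>F k\<close>) itself is not summable.\<close>

lemma (in prob_space) AE_summable_indicators:
  assumes ev: "\<And>k. F k \<in> events" and w: "\<And>k. 0 \<le> w k" and s: "summable (\<lambda>k. w k * prob (F k))"
  shows "AE \<omega> in M. summable (\<lambda>k. w k * indicator (F k) \<omega> :: real)"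
proof -
  have [measurable]: "F k \<in> sets M" for k by (rule ev)
  have "(\<integral>\<^sup>+\<omega>. (\<Sum>k. ennreal (w k * indicator (F k) \<omega>)) \<partial>M) = (\<Sum>k. \<integral>\<^sup>+\<omega>. ennreal (w k * indicator (F k) \<omega>) \<partial>M)"
    by (intro nn_integral_suminf) measurable
  also have "\<dots> = (\<Sum>k. ennreal (w k * prob (F k)))"
  proof (intro suminf_cong)
    fix k
    have "(\<integral>\<^sup>+\<omega>. ennreal (w k * indicator (F k) \<omega>) \<partial>M) = (\<integral>\<^sup>+\<omega>. ennreal (w k) * indicator (F k) \<omega> \<partial>M)"
      using w by (intro nn_integral_cong) (auto simp: indicator_def)
    also have "\<dots> = ennreal (w k) * emeasure M (F k)" by (rule nn_integral_cmult_indicator[OF ev])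
    also have "\<dots> = ennreal (w k * prob (F k))" using w by (simp add: emeasure_eq_measure ennreal_mult)
    finally show "(\<integral>\<^sup>+\<omega>. ennreal (w k * indicator (F k) \<omega>) \<partial>M) = ennreal (w k * prob (F k))" .
  qed
  also have "\<dots> < \<infinity>" using s w by (subst suminf_ennreal2) auto
  finally have fin: "(\<integral>\<^sup>+\<omega>. (\<Sum>k. ennreal (w k * indicator (F k) \<omega>)) \<partial>M) \<noteq> \<infinity>" by simp
  have "AE \<omega> in M. (\<Sum>k. ennreal (w k * indicator (F k) \<omega>)) \<noteq> \<infinity>"
    by (rule nn_integral_PInf_AE[OF _ fin]) measurable
  then show ?thesis
  proof eventually_elim
    case (elim \<omega>)
    then show ?case using w by (intro summable_suminf_not_top) auto
  qed
qed

section \<open>Almost sure estimates for all moduli and along powers of two\<close>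

context bernoulli_sequence
begin

lemma family_subset:
  assumes "family Ms \<rho> I" "I' \<subseteq> I"
  shows "family Ms \<rho> I'"
proof -
  have "finite Ms" "\<forall>m\<in>Ms. 1 \<le> m \<and> 1 \<le> \<rho> m" "I \<subseteq> (\<Union>m\<in>Ms. pr_index m)" "\<forall>(n,b,s)\<in>I. good_step n (\<rho> n) s"
    using assms(1) by (simp_all add: family_def)
  then show ?thesis unfolding family_def
    using assms(2) family_compatible[OF assms(1)] by (intro conjI ballI impI) (assumption | blast)+
qed

lemma upper_tail_shift:
  assumes "n \<ge> 1" "0 < 2 / lp * ln (real n) + x"
  shows "prob {\<omega> \<in> space M. 2 / lp * ln (real n) + x \<le> real (Wn n \<omega>)} \<le> p powr x"
  using upper_tail[OF assms] sq_mult_powr[of "real n" x] assms(1) by simp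

lemma lower_tail_shift:
  assumes "n \<ge> 3" "2 \<le> 2 / lp * ln (real n) + x"
  shows "prob {\<omega> \<in> space M. real (Wn n \<omega>) < 2 / lp * ln (real n) + x}
    \<le> exp (- (p * q / 2 * p powr x)) + poisson_const * (ln (real n) ^ 7 / real n)"
  using lower_tail[OF assms] sq_mult_powr[of "real n" x] assms(1) by simp

lemma AE_eventually_upper:
  fixes m :: "nat \<Rightarrow> nat"
  assumes m: "\<And>k. m k \<ge> 1" and pos: "\<forall>\<^sub>F k in sequentially. 0 < 2 / lp * ln (real (m k)) + x k"
    and s: "summable b" and b: "\<forall>\<^sub>F k in sequentially. p powr x k \<le> b k"
  shows "AE \<omega> in M. \<forall>\<^sub>F k in sequentially. real (Wn (m k) \<omega>) < 2 / lp * ln (real (m k)) + x k"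
proof -
  let ?y = "\<lambda>k. 2 / lp * ln (real (m k)) + x k"
  \<comment> \<open>The empty set at nonpositive thresholds makes every \<open>B k\<close> an event,
    while only large k matter.\<close>
  define B where "B k = (if 0 < ?y k then {\<omega> \<in> space M. ?y k \<le> real (Wn (m k) \<omega>)} else {})" for k
  have ev: "B k \<in> events" for k unfolding B_def using Wn_ge_real_events[OF m] by auto
  have "\<forall>\<^sub>F k in sequentially. prob (B k) \<le> b k" using pos b
  proof eventually_elim
    case (elim k)
    then show ?case unfolding B_def using upper_tail_shift[OF m, of k "x k"] by simp
  qed
  from AE_eventually_not[OF ev s this] AE_space show ?thesis
  proof eventually_elim
    case (elim \<omega>)
    from elim(1) pos show ?case
      by eventually_elim (use elim(2) in \<open>auto simp: B_def\<close>)
  qed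
qed

lemma AE_eventually_lower:
  fixes m :: "nat \<Rightarrow> nat"
  assumes m: "\<And>k. m k \<ge> 1" and pos: "\<forall>\<^sub>F k in sequentially. 2 \<le> 2 / lp * ln (real (m k)) + x k"
    and m3: "\<forall>\<^sub>F k in sequentially. m k \<ge> 3"
    and s: "summable b" and b: "\<forall>\<^sub>F k in sequentially. exp (- (p * q / 2 * p powr x k)) + poisson_const * (ln (real (m k)) ^ 7 / real (m k)) \<le> b k"
  shows "AE \<omega> in M. \<forall>\<^sub>F k in sequentially. 2 / lp * ln (real (m k)) + x k \<le> real (Wn (m k) \<omega>)"
proof -
  let ?y = "\<lambda>k. 2 / lp * ln (real (m k)) + x k"
  define B where "B k = (if 0 < ?y k then {\<omega> \<in> space M. real (Wn (m k) \<omega>) < ?y k} else {})" for k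
  have ev: "B k \<in> events" for k unfolding B_def using Wn_less_real_events[OF m] by auto
  have "\<forall>\<^sub>F k in sequentially. prob (B k) \<le> b k" using pos m3 b
  proof eventually_elim
    case (elim k)
    then show ?case unfolding B_def using lower_tail_shift[of "m k" "x k"] by simp
  qed
  from AE_eventually_not[OF ev s this] AE_space show ?thesis
  proof eventually_elim
    case (elim \<omega>)
    from elim(1) pos show ?case
      by eventually_elim (use elim(2) in \<open>auto simp: B_def not_less\<close>)
  qed
qed

text \<open>At length (3/2 + \<epsilon>) C ln n the expected number n^2 p^r is n^(-1 - 2
  \<epsilon>), which is summable over n.\<close>

theorem limsup_upper:
  assumes e: "0 < \<epsilon>"
  shows "AE \<omega> in M. \<forall>\<^sub>F n in sequentially. real (Wn n \<omega>) < (3 / 2 + \<epsilon>) * (2 / lp * ln (real n))"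
proof -
  define x where "x n = (1 / 2 + \<epsilon>) * (2 / lp * ln (real n))" for n
  have C: "0 < 2 / lp" using lp_pos by simp
  \<comment> \<open>The value n = 0 is replaced by 1, as \<open>longest_ap\<close> is unspecified
    there.\<close>
  have "AE \<omega> in M. \<forall>\<^sub>F n in sequentially. real (Wn (max n 1) \<omega>) < 2 / lp * ln (real (max n 1)) + x n"
  proof (rule AE_eventually_upper[where b = "\<lambda>n. (1 * real n) powr (- 1 - 2 * \<epsilon>)"])
    show "\<forall>\<^sub>F n in sequentially. 0 < 2 / lp * ln (real (max n 1)) + x n"
      using eventually_ge_at_top[of 2]
    proof eventually_elim
      case (elim n)
      then have "0 < 2 / lp * ln (real n)" using C by simp
      moreover have "0 \<le> x n" unfolding x_def using elim e C by simp
      ultimately show ?case using elim by (simp add: max_def)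
    qed
    show "summable (\<lambda>n. (1 * real n) powr (- 1 - 2 * \<epsilon>))" by (rule summable_powr_less) (use e in auto)
    show "\<forall>\<^sub>F n in sequentially. p powr x n \<le> (1 * real n) powr (- 1 - 2 * \<epsilon>)"
      using eventually_ge_at_top[of 2]
    proof eventually_elim
      case (elim n)
      have "- lp * x n = (- 1 - 2 * \<epsilon>) * ln (real n)" using lp_pos by (simp add: x_def field_simps)
      then show ?case unfolding powr_lp using elim by (simp add: powr_def)
    qed
  qed simp
  then show ?thesis
  proof eventually_elim
    case (elim \<omega>)
    from elim eventually_ge_at_top[of 1] show ?case
    proof eventually_elim
      case (elim n)
      have "2 / lp * ln (real n) + x n = (3 / 2 + \<epsilon>) * (2 / lp * ln (real n))" unfolding x_def by algebra
      then show ?case using elim by (simp add: max_def)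
    qed
  qed
qed

lemma ln_pow2: "ln (real (2 ^ k)) = ln 2 * real k" "ln (2 ^ k :: real) = ln 2 * real k"
  by (simp_all add: ln_realpow mult.commute)

text \<open>The excess (1 / \<open>lp\<close> + \<epsilon>) ln ln 2^k makes the tail of order k^(-1
  - \<open>lp\<close> \<epsilon>), summable over the exponents k.\<close>

theorem pow2_upper:
  assumes e: "0 < \<epsilon>"
  shows "AE \<omega> in M. \<forall>\<^sub>F k in sequentially.
    real (Wn (2 ^ k) \<omega>) < 2 / lp * (ln 2 * real k) + (1 / lp + \<epsilon>) * ln (ln 2 * real k)"
proof -
  have C: "0 < 2 / lp" "0 < 1 / lp + \<epsilon>" using lp_pos e by (auto intro: add_pos_pos)
  have "AE \<omega> in M. \<forall>\<^sub>F k in sequentially. real (Wn (2 ^ k) \<omega>) < 2 / lp * ln (real (2 ^ k)) + (1 / lp + \<epsilon>) * ln (ln 2 * real k)"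
  proof (rule AE_eventually_upper[where b = "\<lambda>k. (ln 2 * real k) powr (- 1 - lp * \<epsilon>)"])
    show "\<forall>\<^sub>F k in sequentially. 0 < 2 / lp * ln (real (2 ^ k)) + (1 / lp + \<epsilon>) * ln (ln 2 * real k)"
      unfolding ln_pow2 using C by real_asymp
    show "summable (\<lambda>k. (ln 2 * real k) powr (- 1 - lp * \<epsilon>))"
      by (rule summable_powr_less) (use e lp_pos in auto)
    show "\<forall>\<^sub>F k in sequentially. p powr ((1 / lp + \<epsilon>) * ln (ln 2 * real k)) \<le> (ln 2 * real k) powr (- 1 - lp * \<epsilon>)"
      using eventually_ge_at_top[of 1]
    proof eventually_elim
      case (elim k)
      have "- lp * ((1 / lp + \<epsilon>) * ln (ln 2 * real k)) = (- 1 - lp * \<epsilon>) * ln (ln 2 * real k)"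
        using lp_pos by (simp add: field_simps)
      then show ?case unfolding powr_lp using elim by (simp add: powr_def)
    qed
  qed simp
  then show ?thesis unfolding ln_pow2 .
qed

lemma summable_lower:
  assumes "0 < \<epsilon>" "0 < b"
  shows "summable (\<lambda>k. exp (- (p * q / 2 * (b * real k) powr \<epsilon>)) + (poisson_const + 1) * (ln 2 * real k) ^ 7 / 2 ^ k)"
  using assms p0 q01 poisson_const(1) by (intro summable_add summable_exp_powr summable_power_over_exp) auto

text \<open>The lower tail is exp of minus a positive power of k plus k^7 / 2^k, both summable. The
  scale \<open>b\<close> inside the logarithm is ln 2 for the liminf and 1 for the averages.\<close>

lemma AE_pow2_lower:
  assumes e: "0 < \<epsilon>" and b: "0 < b"
  shows "AE \<omega> in M. \<forall>\<^sub>F k in sequentially. 2 / lp * (ln 2 * real k) - \<epsilon> * ln (b * real k) \<le> real (Wn (2 ^ k) \<omega>)"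
proof -
  have C: "0 < 2 / lp" using lp_pos by simp
  have "AE \<omega> in M. \<forall>\<^sub>F k in sequentially. 2 / lp * ln (real (2 ^ k)) + (- \<epsilon> * ln (b * real k)) \<le> real (Wn (2 ^ k) \<omega>)"
  proof (rule AE_eventually_lower[OF _ _ _ summable_lower[of "lp * \<epsilon>" b]])
    show "\<forall>\<^sub>F k in sequentially. 2 \<le> 2 / lp * ln (real (2 ^ k)) + - \<epsilon> * ln (b * real k)"
      unfolding ln_pow2 using C e b by real_asymp
    show "\<forall>\<^sub>F k in sequentially. 3 \<le> (2::nat) ^ k"
      using eventually_ge_at_top[of 2]
    proof eventually_elim
      case (elim k)
      then have "(2::nat) ^ 2 \<le> 2 ^ k" by (intro power_increasing) auto
      then show ?case by simp
    qed
    show "\<forall>\<^sub>F k in sequentially. exp (- (p * q / 2 * p powr (- \<epsilon> * ln (b * real k)))) + poisson_const * (ln (real (2 ^ k)) ^ 7 / real (2 ^ k))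
        \<le> exp (- (p * q / 2 * (b * real k) powr (lp * \<epsilon>))) + (poisson_const + 1) * (ln 2 * real k) ^ 7 / 2 ^ k"
      using eventually_ge_at_top[of 1]
    proof eventually_elim
      case (elim k)
      have "p powr (- \<epsilon> * ln (b * real k)) = (b * real k) powr (lp * \<epsilon>)"
        unfolding powr_lp using elim b by (simp add: powr_def)
      moreover have "poisson_const * (ln (real (2 ^ k)) ^ 7 / real (2 ^ k)) \<le> (poisson_const + 1) * (ln 2 * real k) ^ 7 / 2 ^ k"
        unfolding ln_pow2 by (simp add: divide_right_mono mult_right_mono)
      ultimately show ?case by simp
    qed
  qed (use e b lp_pos in auto)
  then show ?thesis unfolding ln_pow2 by simp
qed

text \<open>Any positive multiple of ln ln 2^k already sends the upper tail to 0, so W stays below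
  this level for infinitely many k.\<close>

theorem pow2_frequently_low:
  assumes e: "0 < \<epsilon>"
  shows "AE \<omega> in M. \<exists>\<^sub>F k in sequentially. real (Wn (2 ^ k) \<omega>) < 2 / lp * (ln 2 * real k) + \<epsilon> * ln (ln 2 * real k)"
proof -
  have C: "0 < 2 / lp" using lp_pos by simp
  let ?y = "\<lambda>k. 2 / lp * ln (real (2 ^ k)) + \<epsilon> * ln (ln 2 * real k)"
  have m1: "(2::nat) ^ k \<ge> 1" for k by simp
  have pos: "\<forall>\<^sub>F k in sequentially. 0 < ?y k" unfolding ln_pow2 using C e by real_asymp
  define B where "B k = (if 0 < ?y k then {\<omega> \<in> space M. real (Wn (2 ^ k) \<omega>) < ?y k} else {})" for k
  have ev: "B k \<in> events" for k unfolding B_def using Wn_less_real_events[OF m1] by auto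
  have "(\<lambda>k. prob (B k)) \<longlonglongrightarrow> 1"
  proof (rule tendsto_sandwich[of "\<lambda>k. 1 - (ln 2 * real k) powr (- (lp * \<epsilon>))" _ _ "\<lambda>_. 1"])
    show "\<forall>\<^sub>F k in sequentially. 1 - (ln 2 * real k) powr (- (lp * \<epsilon>)) \<le> prob (B k)"
      using pos eventually_ge_at_top[of 1]
    proof eventually_elim
      case (elim k)
      have "space M - B k = {\<omega> \<in> space M. ?y k \<le> real (Wn (2 ^ k) \<omega>)}" using elim by (auto simp: B_def)
      then have "prob (space M - B k) \<le> p powr (\<epsilon> * ln (ln 2 * real k))"
        using upper_tail_shift[OF m1 elim(1)] by simp
      also have "\<dots> = (ln 2 * real k) powr (- (lp * \<epsilon>))" unfolding powr_lp using elim by (simp add: powr_def)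
      finally show ?case using prob_compl[OF ev, of k] by simp
    qed
    have "0 < lp * \<epsilon>" using lp_pos e by simp
    then show "(\<lambda>k. 1 - (ln 2 * real k) powr (- (lp * \<epsilon>))) \<longlonglongrightarrow> 1" by real_asymp
  qed (auto simp: prob_le_1)
  from AE_frequently_of_prob_tendsto_1[OF ev this] AE_space show ?thesis
  proof eventually_elim
    case (elim \<omega>)
    show ?case by (rule frequently_elim1[OF elim(1)]) (auto simp: B_def ln_pow2 split: if_splits)
  qed
qed

text \<open>Large positive deviations of \<^term>\<open>W\<close> occur along a set of exponents of counting function
  \<^term>\<open>n powr (1 - \<eta>)\<close>, and all deviations are of logarithmic size.\<close>

lemma pow2_sum_bound:
  assumes d: "0 < \<delta>"
  shows "AE \<omega> in M. \<forall>\<^sub>F n in sequentially.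
    \<bar>1 / (real n * ln (real n)) * (\<Sum>k=1..n. real (Wn (2 ^ k) \<omega>) - 2 / lp * (ln 2 * real k))\<bar> \<le> 2 * \<delta>"
proof -
  have C: "0 < 2 / lp" using lp_pos by simp
  \<comment> \<open>With this coefficient of ln k the upper tail is k^(-1 - \<open>lp\<close>), so
    eventually every deviation is below c ln k.\<close>
  define c where "c = 1 / lp + 1"
  have c0: "0 < c" using lp_pos by (simp add: c_def add_pos_pos)
  have m1: "(2::nat) ^ k \<ge> 1" for k by simp
  let ?d = "\<lambda>\<omega> k. real (Wn (2 ^ k) \<omega>) - 2 / lp * (ln 2 * real k)"
  have A: "AE \<omega> in M. \<forall>\<^sub>F k in sequentially. real (Wn (2 ^ k) \<omega>) < 2 / lp * ln (real (2 ^ k)) + c * ln (real k)"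
  proof (rule AE_eventually_upper[where b = "\<lambda>k. (1 * real k) powr (- 1 - lp)"])
    show "\<forall>\<^sub>F k in sequentially. 0 < 2 / lp * ln (real (2 ^ k)) + c * ln (real k)"
      unfolding ln_pow2 using C c0 by real_asymp
    show "summable (\<lambda>k. (1 * real k) powr (- 1 - lp))" by (rule summable_powr_less) (use lp_pos in auto)
    show "\<forall>\<^sub>F k in sequentially. p powr (c * ln (real k)) \<le> (1 * real k) powr (- 1 - lp)"
      using eventually_ge_at_top[of 1]
    proof eventually_elim
      case (elim k)
      have "- lp * (c * ln (real k)) = (- 1 - lp) * ln (real k)" using lp_pos by (simp add: c_def field_simps)
      then show ?case unfolding powr_lp using elim by (simp add: powr_def)
    qed
  qed simp
  have B: "AE \<omega> in M. \<forall>\<^sub>F k in sequentially. 2 / lp * (ln 2 * real k) - \<delta> * ln (1 * real k) \<le> real (Wn (2 ^ k) \<omega>)"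
    using d by (intro AE_pow2_lower) auto
  define F where "F k = (if k \<ge> 1 then {\<omega> \<in> space M. 2 / lp * ln (real (2 ^ k)) + \<delta> * ln (real k) \<le> real (Wn (2 ^ k) \<omega>)} else {})" for k :: nat
  have ypos: "0 < 2 / lp * ln (real (2 ^ k)) + \<delta> * ln (real k)" if "k \<ge> 1" for k :: nat
    using that C d by (intro add_pos_nonneg) (auto simp: ln_pow2)
  have evF: "F k \<in> events" for k unfolding F_def using Wn_ge_real_events[OF m1 ypos, of k] by auto
  \<comment> \<open>Any exponent below 1 and below \<open>lp\<close> \<delta> serves: the weights
    k^(\<eta> - 1) then make the expected weighted number of k with \<open>F k\<close>
    finite.\<close>
  define \<eta> where "\<eta> = min 1 (lp * \<delta>) / 2"
  have ld: "0 < lp * \<delta>" using lp_pos d by simp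
  have "0 < min 1 x / 2 \<and> min 1 x / 2 < 1 \<and> min 1 x / 2 < x" if "0 < x" for x :: real
    using that by (cases "x \<le> 1") (auto simp: min_def)
  from this[OF ld] have \<eta>: "0 < \<eta>" "\<eta> < 1" "\<eta> < lp * \<delta>" unfolding \<eta>_def by blast+
  have PF: "prob (F k) \<le> real k powr (- (lp * \<delta>))" for k
  proof (cases "k \<ge> 1")
    case True
    have "prob (F k) \<le> p powr (\<delta> * ln (real k))"
      unfolding F_def using True upper_tail_shift[OF m1 ypos[OF True]] by simp
    also have "\<dots> = real k powr (- (lp * \<delta>))" unfolding powr_lp using True by (simp add: powr_def)
    finally show ?thesis .
  qed (simp add: F_def)
  have "summable (\<lambda>k. real k powr (\<eta> - 1) * prob (F k))"
  proof (rule summable_comparison_test)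
    show "summable (\<lambda>k. (1 * real k) powr (\<eta> - 1 - lp * \<delta>))" by (rule summable_powr_less) (use \<eta> in auto)
    have "real k powr (\<eta> - 1) * prob (F k) \<le> real k powr (\<eta> - 1) * real k powr (- (lp * \<delta>))" for k
      by (intro mult_left_mono PF) simp
    then show "\<exists>N. \<forall>k\<ge>N. norm (real k powr (\<eta> - 1) * prob (F k)) \<le> (1 * real k) powr (\<eta> - 1 - lp * \<delta>)"
      by (simp add: powr_add [symmetric])
  qed
  then have S: "AE \<omega> in M. summable (\<lambda>k. real k powr (\<eta> - 1) * indicator (F k) \<omega> :: real)"
    by (intro AE_summable_indicators evF) auto
  from A B S AE_space show ?thesis
  proof eventually_elim
    case (elim \<omega>)
    define S where "S = (\<Sum>k. real k powr (\<eta> - 1) * indicator (F k) \<omega> :: real)"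
    have "\<forall>\<^sub>F k in sequentially. \<bar>?d \<omega> k\<bar> \<le> (\<delta> + c * indicator (F k) \<omega>) * ln (real k)"
      using elim(1,2) eventually_ge_at_top[of 1]
    proof eventually_elim
      case (elim k)
      have ln0: "0 \<le> ln (real k)" using elim by simp
      have k1: "1 \<le> k" using elim by simp
      have lo: "- (\<delta> * ln (real k)) \<le> ?d \<omega> k" using elim by simp
      have up: "?d \<omega> k \<le> (\<delta> + c * indicator (F k) \<omega>) * ln (real k)"
      proof (cases "\<omega> \<in> F k")
        case True
        have "?d \<omega> k \<le> c * ln (real k)" using elim(1) unfolding ln_pow2 by simp
        also have "\<dots> \<le> (\<delta> + c) * ln (real k)" using ln0 d by (intro mult_right_mono) auto
        finally show ?thesis using True by simp
      next
        case False
        then have "?d \<omega> k \<le> \<delta> * ln (real k)"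
          using \<open>\<omega> \<in> space M\<close> k1 unfolding F_def ln_pow2 by auto
        then show ?thesis using False by simp
      qed
      have "\<delta> * ln (real k) \<le> (\<delta> + c * indicator (F k) \<omega>) * ln (real k)"
        using ln0 c0 by (intro mult_right_mono) (auto simp: indicator_def)
      then show ?case using lo up by (intro abs_leI) linarith+
    qed
    then obtain k0 where k0: "\<And>k. k \<ge> k0 \<Longrightarrow> \<bar>?d \<omega> k\<bar> \<le> (\<delta> + c * indicator (F k) \<omega>) * ln (real k)"
      by (auto simp: eventually_sequentially)
    define A where "A = (\<Sum>k\<le>k0. \<bar>?d \<omega> k\<bar>)"
    have A0: "0 \<le> A" by (simp add: A_def sum_nonneg)
    have S0: "0 \<le> S" unfolding S_def using elim(3) by (intro suminf_nonneg) auto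
    have bound: "\<bar>1 / (real n * ln (real n)) * (\<Sum>k=1..n. ?d \<omega> k)\<bar> \<le> A / (real n * ln (real n)) + \<delta> + c * S * real n powr (- \<eta>)"
      if n: "n \<ge> 2" for n
    proof -
      have n0: "0 < real n" "0 < ln (real n)" using n by auto
      \<comment> \<open>For k <= n the weight k^(\<eta> - 1) is at least n^(\<eta> - 1), so the
        convergent weighted sum bounds the plain count by n^(1 - \<eta>) times its value.\<close>
      have cnt: "(\<Sum>k=1..n. indicator (F k) \<omega>) \<le> real n powr (1 - \<eta>) * S"
      proof -
        have "(\<Sum>k=1..n. indicator (F k) \<omega>) \<le> (\<Sum>k=1..n. real n powr (1 - \<eta>) * (real k powr (\<eta> - 1) * indicator (F k) \<omega>))"
        proof (rule sum_mono)
          fix k assume k: "k \<in> {1..n}"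
          have "1 = real k powr (1 - \<eta>) * real k powr (\<eta> - 1)" using k by (simp flip: powr_add)
          also have "\<dots> \<le> real n powr (1 - \<eta>) * real k powr (\<eta> - 1)"
            using k \<eta> by (intro mult_right_mono powr_mono2) auto
          finally show "indicator (F k) \<omega> \<le> real n powr (1 - \<eta>) * (real k powr (\<eta> - 1) * indicator (F k) \<omega>)"
            by (auto simp: indicator_def)
        qed
        also have "\<dots> = real n powr (1 - \<eta>) * (\<Sum>k=1..n. real k powr (\<eta> - 1) * indicator (F k) \<omega>)"
          by (rule sum_distrib_left [symmetric])
        also have "\<dots> \<le> real n powr (1 - \<eta>) * S"
          unfolding S_def using elim(3) by (intro mult_left_mono sum_le_suminf) auto
        finally show ?thesis .
      qed
      define z where "z = (\<Sum>k=1..n. ?d \<omega> k)"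
      have "\<bar>z\<bar> \<le> (\<Sum>k=1..n. \<bar>?d \<omega> k\<bar>)" unfolding z_def by (rule sum_abs)
      also have "\<dots> \<le> (\<Sum>k=1..n. (if k \<le> k0 then \<bar>?d \<omega> k\<bar> else 0) + (\<delta> + c * indicator (F k) \<omega>) * ln (real n))"
      proof (rule sum_mono)
        fix k assume k: "k \<in> {1..n}"
        have nn: "0 \<le> \<delta> + c * indicator (F k) \<omega>" using d c0 by (auto simp: indicator_def)
        then have "0 \<le> (\<delta> + c * indicator (F k) \<omega>) * ln (real n)" using n0 by simp
        moreover have "\<bar>?d \<omega> k\<bar> \<le> (\<delta> + c * indicator (F k) \<omega>) * ln (real n)" if "\<not> k \<le> k0"
        proof -
          have "(\<delta> + c * indicator (F k) \<omega>) * ln (real k) \<le> (\<delta> + c * indicator (F k) \<omega>) * ln (real n)"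
            using k by (intro mult_left_mono nn) auto
          then show ?thesis using k0[of k] that by linarith
        qed
        ultimately show "\<bar>?d \<omega> k\<bar> \<le> (if k \<le> k0 then \<bar>?d \<omega> k\<bar> else 0) + (\<delta> + c * indicator (F k) \<omega>) * ln (real n)"
          by auto
      qed
      also have "\<dots> = (\<Sum>k=1..n. if k \<le> k0 then \<bar>?d \<omega> k\<bar> else 0) + (real n * \<delta> + c * (\<Sum>k=1..n. indicator (F k) \<omega>)) * ln (real n)"
      proof -
        have "(\<Sum>k=1..n. \<delta> + c * indicator (F k) \<omega>) = real n * \<delta> + c * (\<Sum>k=1..n. indicator (F k) \<omega>)"
          by (simp only: sum.distrib sum_constant card_atLeastAtMost sum_distrib_left) simp
        then show ?thesis by (simp only: sum.distrib sum_distrib_right [symmetric])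
      qed
      finally have z1: "\<bar>z\<bar> \<le> (\<Sum>k=1..n. if k \<le> k0 then \<bar>?d \<omega> k\<bar> else 0) + (real n * \<delta> + c * (\<Sum>k=1..n. indicator (F k) \<omega>)) * ln (real n)" .
      have z2: "(\<Sum>k=1..n. if k \<le> k0 then \<bar>?d \<omega> k\<bar> else 0) \<le> A"
      proof -
        have "(\<Sum>k=1..n. if k \<le> k0 then \<bar>?d \<omega> k\<bar> else 0) = (\<Sum>k\<in>{1..n} \<inter> {..k0}. \<bar>?d \<omega> k\<bar>)"
          by (subst sum.inter_restrict) simp_all
        also have "\<dots> \<le> A" unfolding A_def by (intro sum_mono2) auto
        finally show ?thesis .
      qed
      have z3: "(real n * \<delta> + c * (\<Sum>k=1..n. indicator (F k) \<omega>)) * ln (real n) \<le> (real n * \<delta> + c * (real n powr (1 - \<eta>) * S)) * ln (real n)"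
        using cnt c0 n0 by (intro mult_right_mono add_left_mono mult_left_mono) auto
      have 1: "\<bar>z\<bar> \<le> A + (real n * \<delta> + c * (real n powr (1 - \<eta>) * S)) * ln (real n)"
        by (rule order_trans[OF z1 add_mono[OF z2 z3]])
      have "\<bar>1 / (real n * ln (real n)) * z\<bar> = \<bar>z\<bar> / (real n * ln (real n))"
        using n0 by (simp add: abs_mult)
      also have "\<dots> \<le> (A + (real n * \<delta> + c * (real n powr (1 - \<eta>) * S)) * ln (real n)) / (real n * ln (real n))"
        using n0 1 by (intro divide_right_mono) auto
      also have "\<dots> = A / (real n * ln (real n)) + \<delta> + c * S * (real n powr (1 - \<eta>) / real n)"
        using n0 by (simp add: add_divide_distrib distrib_right)
      also have "real n powr (1 - \<eta>) / real n = real n powr (- \<eta>)"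
        using n0 by (simp add: powr_diff powr_minus divide_inverse)
      finally show ?thesis unfolding z_def .
    qed
    have "(\<lambda>n. A / (real n * ln (real n)) + \<delta> + c * S * real n powr (- \<eta>)) \<longlonglongrightarrow> 0 + \<delta> + 0"
    proof (intro tendsto_add tendsto_const)
      have "(\<lambda>n. 1 / (real n * ln (real n))) \<longlonglongrightarrow> 0" by real_asymp
      from tendsto_mult_right_zero[OF this, of A] show "(\<lambda>n. A / (real n * ln (real n))) \<longlonglongrightarrow> 0" by simp
      have "(\<lambda>n. real n powr (- \<eta>)) \<longlonglongrightarrow> 0" using \<eta>(1) by real_asymp
      then show "(\<lambda>n. c * S * real n powr (- \<eta>)) \<longlonglongrightarrow> 0" by (rule tendsto_mult_right_zero)
    qed
    then have "\<forall>\<^sub>F n in sequentially. A / (real n * ln (real n)) + \<delta> + c * S * real n powr (- \<eta>) < 2 * \<delta>"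
      by (rule order_tendstoD) (use d in simp)
    then show ?case using eventually_ge_at_top[of 2]
      by eventually_elim (rule order_trans[OF bound less_imp_le])
  qed
qed

text \<open>These progressions stay below \<^term>\<open>n\<close>, hence are progressions for every larger modulus too.\<close>

definition nonwrap_index :: "nat \<Rightarrow> nat \<Rightarrow> (nat \<times> int \<times> int) set" where
  "nonwrap_index n r = {n} \<times> {1..int n div 2} \<times> {s\<in>{1..int n div (2 * int r)}. good_step n (r\<^sup>2) s}"

lemma nonwrap_props:
  assumes r: "r \<ge> 2" and i: "(m, b, s) \<in> nonwrap_index n r"
  shows "m = n" "1 \<le> b" "2 * b \<le> int n" "1 \<le> s" "2 * (int r * s) \<le> int n" "2 * s < int n" "good_step n (r\<^sup>2) s"
    "u \<le> r \<Longrightarrow> n \<le> N \<Longrightarrow> ap_term N b s u = nat (b + int u * s)"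
proof -
  show m: "m = n" and b: "1 \<le> b" "2 * b \<le> int n" and s: "1 \<le> s" and g: "good_step n (r\<^sup>2) s"
    using i by (auto simp: nonwrap_index_def)
  have "s \<le> int n div (2 * int r)" using i by (auto simp: nonwrap_index_def)
  then have "s * (2 * int r) \<le> int n div (2 * int r) * (2 * int r)" using r by (intro mult_right_mono) auto
  also have "\<dots> \<le> int n" using div_mult_mod_eq[of "int n" "2 * int r"] pos_mod_sign[of "2 * int r" "int n"] r by linarith
  finally show rs: "2 * (int r * s) \<le> int n" by (simp add: mult_ac)
  have "2 * s \<le> int r * s" using r s by (intro mult_right_mono) auto
  then show "2 * s < int n" using rs s by linarith
  assume u: "u \<le> r" and N: "n \<le> N"
  have "int u * s \<le> int r * s" using u s by (intro mult_right_mono) auto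
  moreover have "0 \<le> int u * s" using s by simp
  ultimately have "1 \<le> b + int u * s" "b + int u * s \<le> int N" using b rs N by linarith+
  then show "ap_term N b s u = nat (b + int u * s)" unfolding ap_term_def by (rule res_idem)
qed

lemma nonwrap_subset: "r \<ge> 2 \<Longrightarrow> nonwrap_index n r \<subseteq> half_index n r"
proof
  fix i assume r: "r \<ge> 2" and i: "i \<in> nonwrap_index n r"
  obtain m b s where e: "i = (m, b, s)" by (cases i)
  note P = nonwrap_props[OF r i[unfolded e]]
  show "i \<in> half_index n r" using P(1-7) by (auto simp: half_index_def e)
qed

text \<open>All terms are at most n <= N, so reduction modulo N does not change them; multiples k s
  with k < r lie strictly between 0 and N, so the step stays good.\<close>

lemma nonwrap_has_ap:
  assumes r: "r \<ge> 2" and i: "i \<in> nonwrap_index n r" and e: "ap_ev r i Y" and N: "n \<le> N"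
  shows "has_ap N r Y"
proof -
  obtain m b s where ib: "i = (m, b, s)" by (cases i)
  note P = nonwrap_props[OF r i[unfolded ib]]
  have rs: "0 < int r * s" using P(4) r by simp
  have "ap_term N (b + s) s j \<in> Y" if j: "j < r" for j
  proof -
    have "ap_term N (b + s) s j = ap_term N b s (Suc j)" by (simp add: ap_term_def algebra_simps)
    also have "\<dots> = ap_term n b s (Suc j)" using P(8)[of "Suc j" N] P(8)[of "Suc j" n] j N by simp
    also have "\<dots> \<in> ones r i" using j P(1) by (auto simp: ones_def ib)
    finally show ?thesis using e by (auto simp: ap_ev_def)
  qed
  moreover have "good_step N (r - 1) s" unfolding good_step_def
  proof (intro allI impI notI)
    fix k assume k: "1 \<le> k \<and> k \<le> r - 1" and dv: "int N dvd int k * s"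
    have "int k * s \<le> int r * s" using k P(4) by (intro mult_right_mono) auto
    then have "int k * s < int N" using P(5) rs N by linarith
    moreover have "0 < int k * s" using k P(4) by simp
    ultimately show False using dv zdvd_imp_le by fastforce
  qed
  moreover have "s \<le> int r * s" using r P(4) by simp
  then have "s \<in> {1..int N}" "b + s \<in> {1..int N}" using P N rs by auto
  ultimately show ?thesis unfolding has_ap_def by blast
qed

text \<open>There are about n / 2 bases and n / (2 r) steps; the hypothesis on n lets the bad steps
  and the rounding consume at most half of the steps.\<close>

lemma card_nonwrap:
  assumes r: "r \<ge> 2" and n: "8 * r * (1 + r ^ 4) \<le> n"
  shows "(real n)\<^sup>2 / (16 * real r) \<le> real (card (nonwrap_index n r))"
proof -
  define G where "G = {s\<in>{1..int n div (2 * int r)}. good_step n (r\<^sup>2) s}"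
  define B where "B = {s\<in>{1..int n}. \<not> good_step n (r\<^sup>2) s}"
  have n1: "n \<ge> 2" using n r by (cases r) auto
  have c: "card (nonwrap_index n r) = nat (int n div 2) * card G"
    by (simp add: nonwrap_index_def G_def card_cartesian_product)
  have cB: "card B \<le> r ^ 4" using card_not_good[of n "r\<^sup>2"] n1 by (simp add: B_def power_mult [symmetric])
  have "int n div (2 * int r) = int (n div (2 * r))" by (simp add: zdiv_int)
  then have "int n div (2 * int r) \<le> int n" using div_le_dividend[of n "2 * r"] by linarith
  then have "card {1..int n div (2 * int r)} \<le> card (G \<union> B)"
    by (intro card_mono) (auto simp: G_def B_def)
  also have "\<dots> \<le> card G + r ^ 4" using card_Un_le[of G B] cB by linarith
  finally have "nat (int n div (2 * int r)) \<le> card G + r ^ 4" by simp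
  then have "int n div (2 * int r) \<le> int (card G + r ^ 4)" by linarith
  moreover have "int n < (int n div (2 * int r) + 1) * (2 * int r)"
  proof -
    have "int n mod (2 * int r) < 2 * int r" using r by (intro pos_mod_bound) simp
    then show ?thesis using div_mult_mod_eq[of "int n" "2 * int r"]
      by (simp only: distrib_right mult_1_left)
  qed
  moreover have "(int n div (2 * int r) + 1) * (2 * int r) \<le> (int (card G + r ^ 4) + 1) * (2 * int r)"
    using calculation(1) r by (intro mult_right_mono) auto
  ultimately have "int n \<le> (int (card G + r ^ 4) + 1) * (2 * int r)" by linarith
  then have "real_of_int (int n) \<le> real_of_int ((int (card G + r ^ 4) + 1) * (2 * int r))" by (simp only: of_int_le_iff)
  then have g: "real n \<le> 2 * real r * real (card G) + 2 * real r * (1 + real r ^ 4)"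
    by (simp add: algebra_simps)
  have "real (8 * r * (1 + r ^ 4)) \<le> real n" using n by (rule of_nat_mono)
  then have n': "8 * real r * (1 + real r ^ 4) \<le> real n" by (simp add: algebra_simps)
  then have g2: "real n / (4 * real r) \<le> real (card G)"
    using g r by (simp add: pos_divide_le_eq algebra_simps)
  have "int n \<le> 2 * (int n div 2) + 1" by linarith
  then have "real n / 4 \<le> real (nat (int n div 2))" using n1 by linarith
  then have "real n / 4 * (real n / (4 * real r)) \<le> real (nat (int n div 2)) * real (card G)"
    using g2 by (intro mult_mono) auto
  then show ?thesis by (simp add: c power2_eq_square)
qed

text \<open>The mean is smaller than for all progressions by a factor of order r, hence the division
  by r in the exponent.\<close>

lemma nonwrap_tail:
  assumes r: "r \<ge> 2" and n: "8 * r * (1 + r ^ 4) \<le> n" and Q: "(real n)\<^sup>2 * p ^ r \<le> Q" "1 \<le> Q" and R: "real r + 1 \<le> R"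
  shows "Pr (\<lambda>Y. \<forall>i\<in>nonwrap_index n r. \<not> ap_ev r i Y)
    \<le> exp (- (q / 16 * ((real n)\<^sup>2 * p ^ r / real r))) + 5 * (R ^ 5 * Q\<^sup>2 / (p * real n))"
proof -
  have n1: "n \<ge> 1" using n r by (cases r) auto
  have fam: "family {n} (\<lambda>_. r) (nonwrap_index n r)"
    by (rule family_subset[OF family_half_index[OF n1 r] nonwrap_subset[OF r]])
  let ?c = "real (card (nonwrap_index n r))"
  have "card (nonwrap_index n r) \<le> card (half_index n r)"
    using nonwrap_subset[OF r] finite_family[OF family_half_index[OF n1 r]] by (intro card_mono)
  then have "?c \<le> (real n)\<^sup>2 / 2" using card_half_index(1)[OF n1, of r] by linarith
  also have "\<dots> \<le> (real n)\<^sup>2" by simp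
  finally have c1: "?c / (real n)\<^sup>2 \<le> 1" using n1 by (simp add: divide_le_eq)
  have c2: "(real n)\<^sup>2 / (16 * real r) \<le> ?c" by (rule card_nonwrap[OF r n])
  have R1: "1 \<le> R" using R by simp
  define E where "E = R ^ 5 * Q\<^sup>2 / (p * real n)"
  have E0: "0 \<le> E" using p0 R1 Q by (simp add: E_def)
  have "Pr (\<lambda>Y. \<forall>i\<in>nonwrap_index n r. \<not> ap_ev r i Y) \<le> exp (- (?c * (q * p ^ r))) + ?c / (real n)\<^sup>2 * (5 * E)"
    using family_sieve_le[OF fam, of n Q R] n1 r Q R by (simp add: E_def abs_le_iff)
  also have "?c / (real n)\<^sup>2 * (5 * E) \<le> 1 * (5 * E)" using c1 E0 by (intro mult_right_mono) auto
  also have "exp (- (?c * (q * p ^ r))) \<le> exp (- (q / 16 * ((real n)\<^sup>2 * p ^ r / real r)))"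
  proof -
    have "(real n)\<^sup>2 / (16 * real r) * (q * p ^ r) \<le> ?c * (q * p ^ r)"
      using c2 q01 p0 by (intro mult_right_mono) auto
    then show ?thesis by (simp add: mult_ac)
  qed
  finally show ?thesis by (simp add: E_def)
qed

end

section \<open>Almost sure bounds by the second moment method\<close>

text \<open>A step of at least \<open>2 n / r\<close> makes the progression wrap around, which excludes the case \<open>w = 0\<close>
  in the definition of \<^const>\<open>rare\<close>.\<close>

definition wide_index :: "nat set \<Rightarrow> nat \<Rightarrow> nat \<Rightarrow> (nat \<times> int \<times> int) set" where
  "wide_index Ms r n = {n} \<times> {1..int n} \<times> {s\<in>{1..int n}. 2 * s < int n \<and> 2 * int n \<le> int r * s
      \<and> good_step n (r\<^sup>2) s \<and> (\<forall>m\<in>Ms. m \<noteq> n \<longrightarrow> \<not> rare r m n s)}"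

definition wide_family :: "nat set \<Rightarrow> nat \<Rightarrow> (nat \<times> int \<times> int) set" where
  "wide_family Ms r = (\<Union>n\<in>Ms. wide_index Ms r n)"

lemma wide_subset_half: "wide_index Ms r n \<subseteq> half_index n r"
  by (auto simp: wide_index_def half_index_def)

text \<open>From about n / 2 steps three sets are removed: those below 2 n / r, those not good at
  level r^2, and for each other modulus at most 16 r^5 rare ones. Only the first removal is a
  proportion of n, namely of order 1/r.\<close>

lemma card_wide_index:
  assumes n: "n \<ge> 1" and r: "r \<ge> 1" and Ms: "finite Ms" "n \<in> Ms"
    and d: "\<And>m. m \<in> Ms \<Longrightarrow> m \<noteq> n \<Longrightarrow> int r * \<bar>int m - int n\<bar> < int n"
  shows "(real n)\<^sup>2 / 2 - 2 * (real n)\<^sup>2 / real r - 19 * real (card Ms) * real n * real r ^ 5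
    \<le> real (card (wide_index Ms r n))"
proof -
  define G where "G = {s\<in>{1..int n}. 2 * s < int n \<and> 2 * int n \<le> int r * s
      \<and> good_step n (r\<^sup>2) s \<and> (\<forall>m\<in>Ms. m \<noteq> n \<longrightarrow> \<not> rare r m n s)}"
  define T where "T = {s\<in>{1..int n}. 2 * s < int n}"
  define S where "S = {s\<in>{1..int n}. int r * s < 2 * int n}"
  define B where "B = {s\<in>{1..int n}. \<not> good_step n (r\<^sup>2) s}"
  define Ra where "Ra = (\<Union>m\<in>Ms - {n}. {s\<in>{1..int n}. rare r m n s})"
  have c: "card (wide_index Ms r n) = n * card G" by (simp add: wide_index_def G_def card_cartesian_product)
  have "T = {1..(int n - 1) div 2}" by (auto simp: T_def)
  then have cT: "card T = nat ((int n - 1) div 2)" by simp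
  have cB: "card B \<le> r ^ 4" using card_not_good[OF n, of "r\<^sup>2"] by (simp add: B_def power_mult [symmetric])
  have "S \<subseteq> {1..int (2 * n div r)}"
  proof
    fix s assume s: "s \<in> S"
    then have "int (r * nat s) \<le> int (2 * n)" by (simp add: S_def)
    then have "r * nat s \<le> 2 * n" by (simp only: of_nat_le_iff)
    then have "nat s \<le> 2 * n div r" using r by (simp add: less_eq_div_iff_mult_less_eq mult.commute)
    then show "s \<in> {1..int (2 * n div r)}" using s by (auto simp: S_def)
  qed
  then have "card S \<le> card {1..int (2 * n div r)}" by (intro card_mono) auto
  then have cS: "card S \<le> 2 * n div r" by simp
  have finMs: "finite (Ms - {n})" using Ms by simp
  have "card Ra \<le> (\<Sum>m\<in>Ms - {n}. card {s\<in>{1..int n}. rare r m n s})"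
    unfolding Ra_def by (rule card_UN_le[OF finMs])
  also have "\<dots> \<le> (\<Sum>m\<in>Ms - {n}. 16 * r ^ 5)"
    using d by (intro sum_mono card_rare n) auto
  also have "\<dots> \<le> card Ms * (16 * r ^ 5)" using Ms by (simp add: card_Diff_singleton)
  finally have cR: "card Ra \<le> card Ms * (16 * r ^ 5)" .
  have fin: "finite G" "finite S" "finite B" "finite Ra"
    using finMs by (simp_all add: G_def S_def B_def Ra_def)
  have "T \<subseteq> G \<union> (S \<union> (B \<union> Ra))"
  proof
    fix s assume s: "s \<in> T"
    show "s \<in> G \<union> (S \<union> (B \<union> Ra))"
    proof (cases "s \<in> S \<union> (B \<union> Ra)")
      case False
      then have "2 * int n \<le> int r * s" "good_step n (r\<^sup>2) s" "\<forall>m\<in>Ms. m \<noteq> n \<longrightarrow> \<not> rare r m n s"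
        using s by (auto simp: S_def B_def Ra_def T_def)
      then show ?thesis using s by (simp add: G_def T_def)
    qed simp
  qed
  then have "card T \<le> card (G \<union> (S \<union> (B \<union> Ra)))" using fin by (intro card_mono) auto
  also have "\<dots> \<le> card G + (card S + (card B + card Ra))"
    by (intro order_trans[OF card_Un_le] add_left_mono order_refl) 
  finally have "card T \<le> card G + (2 * n div r + (r ^ 4 + card Ms * (16 * r ^ 5)))" using cS cB cR by linarith
  then have "int (card T) \<le> int (card G + (2 * n div r + (r ^ 4 + card Ms * (16 * r ^ 5))))" by (rule of_nat_mono)
  then have "(int n - 1) div 2 \<le> int (card G + (2 * n div r + (r ^ 4 + card Ms * (16 * r ^ 5))))" using cT n by simp
  moreover have "int n \<le> 2 * x + 2" if "(int n - 1) div 2 \<le> x" for x using that by presburger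
  ultimately have "int n \<le> 2 * int (card G + (2 * n div r + (r ^ 4 + card Ms * (16 * r ^ 5)))) + 2" by blast
  then have "n \<le> 2 * (card G + (2 * n div r + (r ^ 4 + card Ms * (16 * r ^ 5)))) + 2" by linarith
  then have "real n \<le> real (2 * (card G + (2 * n div r + (r ^ 4 + card Ms * (16 * r ^ 5)))) + 2)" by (rule of_nat_mono)
  also have "\<dots> = 2 * real (card G) + 2 * real (2 * n div r) + 2 * real r ^ 4 + 32 * (real (card Ms) * real r ^ 5) + 2" by simp
  finally have 1: "real n / 2 \<le> real (card G) + real (2 * n div r) + real r ^ 4 + 16 * (real (card Ms) * real r ^ 5) + 1"
    by simp
  have 2: "real (2 * n div r) \<le> 2 * real n / real r"
    using of_nat_div_le_of_nat[where 'a = real, of "2 * n" r] by simp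
  have r5: "real r ^ 4 \<le> real r ^ 5" "1 \<le> real r ^ 5" using r by (auto intro: power_increasing)
  have "1 \<le> card Ms" using Ms by (auto simp: Suc_le_eq card_gt_0_iff)
  then have "1 * real r ^ 5 \<le> real (card Ms) * real r ^ 5" by (intro mult_right_mono) auto
  then have "real n / 2 - 2 * real n / real r - 19 * (real (card Ms) * real r ^ 5) \<le> real (card G)"
    using 1 2 r5 by linarith
  then have "real n * (real n / 2 - 2 * real n / real r - 19 * (real (card Ms) * real r ^ 5)) \<le> real n * real (card G)"
    by (rule mult_left_mono) simp
  then show ?thesis by (simp add: c power2_eq_square algebra_simps)
qed

lemma eventually_exp_ln_powr_le:
  assumes "0 < e" "e < 1" "0 < c" "0 < b"
  shows "\<forall>\<^sub>F N in sequentially. exp (c * ln (real N) powr e) \<le> real N powr b"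
proof -
  have "(\<lambda>N. c * ln (real N) powr e / ln (real N)) \<longlonglongrightarrow> 0" using assms by real_asymp
  then have "\<forall>\<^sub>F N in sequentially. c * ln (real N) powr e / ln (real N) < b" by (rule order_tendstoD) (rule assms)
  then show ?thesis using eventually_ge_at_top[of 2]
  proof eventually_elim
    case (elim N)
    then have "c * ln (real N) powr e \<le> b * ln (real N)" by (simp add: divide_less_eq)
    then show ?case using elim by (simp add: powr_def)
  qed
qed

section \<open>Blocks of consecutive moduli and the lower bound of the limsup\<close>

context bernoulli_sequence
begin

text \<open>Within one modulus the pairs exclude each other or overlap little; across moduli, wide
  steps that are not rare bound the overlap.\<close>

lemma family_wide:
  assumes "finite Ms" "\<And>n. n \<in> Ms \<Longrightarrow> n \<ge> 1" and r: "r \<ge> 3"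
  shows "family Ms (\<lambda>_. r) (wide_family Ms r)"
proof -
  have rr: "r \<le> r\<^sup>2" by (simp add: power2_eq_square)
  have "compatible_bound r i r j r" if ij: "i \<in> wide_family Ms r" "j \<in> wide_family Ms r" "i \<noteq> j" for i j
  proof -
    obtain n b s m c t where e: "i = (n,b,s)" "j = (m,c,t)" by (cases i, cases j)
    have n: "n \<in> Ms" "(n,b,s) \<in> wide_index Ms r n" using ij(1) by (auto simp: e wide_family_def wide_index_def)
    have m: "m \<in> Ms" "(m,c,t) \<in> wide_index Ms r m" using ij(2) by (auto simp: e wide_family_def wide_index_def)
    show ?thesis
    proof (cases "n = m")
      case True
      then show ?thesis
        using same_modulus_overlap[of n r b s c t] n m assms(2)[OF n(1)] r ij(3)
        unfolding compatible_bound_def e wide_index_def by auto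
    next
      case False
      have "good_step n r s" using n good_step_mono[OF _ rr] by (auto simp: wide_index_def)
      then have "2 * card (ones r (n,b,s) \<inter> ones r (m,c,t)) \<le> r + 1"
        using n m False assms(2) r by (intro cross_modulus_overlap) (auto simp: wide_index_def)
      then show ?thesis by (simp add: compatible_bound_def e)
    qed
  qed
  then show ?thesis
    using assms good_step_mono[OF _ rr] unfolding family_def
    by (auto simp: wide_family_def wide_index_def pr_index_def)
qed

lemma card_wide_family:
  assumes "finite Ms"
  shows "card (wide_family Ms r) = (\<Sum>n\<in>Ms. card (wide_index Ms r n))"
  unfolding wide_family_def using assms
  by (intro card_UN_disjoint) (auto simp: wide_index_def)

lemma wide_ap_ev_imp_has_ap:
  assumes "n \<ge> 1" "(n,b,s) \<in> wide_index Ms r n" "ap_ev r (n,b,s) Y" "r \<ge> 1"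
  shows "has_ap n r Y"
proof -
  have "r - 1 \<le> r\<^sup>2" by (cases r) (auto simp: power2_eq_square)
  then show ?thesis using assms by (intro ap_ev_imp_has_ap[of n r s b]) (auto simp: wide_index_def intro: good_step_mono)
qed

lemma no_ap_imp_no_wide_ap_ev:
  assumes "\<And>n. n \<in> Ms \<Longrightarrow> n \<ge> 1" "r \<ge> 1" "\<forall>n\<in>Ms. \<not> has_ap n r Y"
  shows "\<forall>i\<in>wide_family Ms r. \<not> ap_ev r i Y"
proof (intro ballI notI)
  fix i assume i: "i \<in> wide_family Ms r" "ap_ev r i Y"
  then obtain n b s where "i = (n,b,s)" "n \<in> Ms" "(n,b,s) \<in> wide_index Ms r n"
    by (auto simp: wide_family_def wide_index_def)
  then show False using wide_ap_ev_imp_has_ap[of n b s Ms r Y] assms i by auto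
qed

text \<open>The numerical hypotheses keep at least N^2 / 4 indices per modulus: r >= 16 makes the
  loss from narrow steps at most n^2 / 8, and 152 = 8 * 19 does the same for the bad and rare ones.
  The first term of the bound is the reciprocal of the mean, the second is the pair sum divided by
  its square.\<close>

lemma block_second_moment:
  assumes T: "1 \<le> T" "T \<le> N" and r: "16 \<le> r" and s: "152 * T * r ^ 5 \<le> N"
  shows "Pr (\<lambda>Y. \<forall>n\<in>{N+1..N+T}. \<not> has_ap n r Y)
    \<le> 4 / (real T * (real N)\<^sup>2 * q * p ^ r)
      + 8 / (q\<^sup>2 * (real N)\<^sup>2) * ((real r + 1)\<^sup>2 * (2 * real N) / p + (real r + 1) ^ 5 * p powr (- (real r + 1) / 2))"
proof -
  define Ms where "Ms = {N+1..N+T}"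
  define I where "I = wide_family Ms r"
  define P where "P = p ^ r"
  have N1: "1 \<le> N" using T by simp
  have Ms: "finite Ms" "\<And>n. n \<in> Ms \<Longrightarrow> n \<ge> 1" "card Ms = T" by (auto simp: Ms_def)
  have P0: "0 < P" using p0 by (simp add: P_def)
  have fam: "family Ms (\<lambda>_. r) I" unfolding I_def using r by (intro family_wide Ms) auto
  have rT: "r * T \<le> N"
  proof -
    have "r * T * 1 \<le> r * T * (152 * r ^ 4)" using r by (intro mult_left_mono) auto
    also have "\<dots> = 152 * T * r ^ 5" by (simp add: power_numeral_reduce)
    finally show ?thesis using s by linarith
  qed
  have cn: "(real N)\<^sup>2 / 4 \<le> real (card (wide_index Ms r n))" if n: "n \<in> Ms" for n
  proof -
    have nN: "N < n" using n by (simp add: Ms_def)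
    have "int r * \<bar>int m - int n\<bar> < int n" if m: "m \<in> Ms" for m
    proof -
      have "\<bar>int m - int n\<bar> \<le> int T" using m n by (auto simp: Ms_def)
      then have "int r * \<bar>int m - int n\<bar> \<le> int r * int T" by (intro mult_left_mono) auto
      also have "\<dots> \<le> int N" using rT by (metis of_nat_le_iff of_nat_mult)
      finally show ?thesis using nN by linarith
    qed
    then have L: "(real n)\<^sup>2 / 2 - 2 * (real n)\<^sup>2 / real r - 19 * real (card Ms) * real n * real r ^ 5 \<le> real (card (wide_index Ms r n))"
      using n r Ms by (intro card_wide_index) auto
    have a: "2 * (real n)\<^sup>2 / real r \<le> 2 * (real n)\<^sup>2 / 16" using r by (intro divide_left_mono) auto
    have "real (152 * T * r ^ 5) \<le> real n" using s nN by (intro of_nat_mono) linarith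
    then have "152 * (real T * real r ^ 5) \<le> real n" by simp
    then have "real n * (152 * (real T * real r ^ 5)) \<le> real n * real n" by (intro mult_left_mono) auto
    then have b: "19 * real T * real n * real r ^ 5 \<le> (real n)\<^sup>2 / 8" by (simp add: power2_eq_square mult_ac)
    have "(real N)\<^sup>2 \<le> (real n)\<^sup>2" using nN by (intro power_mono) auto
    then show ?thesis using L a b unfolding Ms(3) by linarith
  qed
  define cI where "cI = real (card I)"
  have cI: "real T * ((real N)\<^sup>2 / 4) \<le> cI"
  proof -
    have "real T * ((real N)\<^sup>2 / 4) = (\<Sum>n\<in>Ms. (real N)\<^sup>2 / 4)" using Ms by simp
    also have "\<dots> \<le> (\<Sum>n\<in>Ms. real (card (wide_index Ms r n)))" by (intro sum_mono cn)
    also have "\<dots> = cI" by (simp add: cI_def I_def card_wide_family[OF Ms(1)])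
    finally show ?thesis .
  qed
  have TN: "0 < real T * ((real N)\<^sup>2 / 4)" using T N1 by simp
  then have cI0: "0 < cI" using cI by linarith
  then have "I \<noteq> {}" by (auto simp: cI_def)
  define PB where "PB = pair_bound r r (2 * N) r"
  have PB: "pair_bound r r m r \<le> PB" if "m \<in> Ms" for m
  proof -
    have "(r + 1) * (r + 1) * m \<le> (r + 1) * (r + 1) * (2 * N)" using that T by (intro mult_le_mono2) (auto simp: Ms_def)
    then show ?thesis unfolding pair_bound_def PB_def
      using p0 by (intro add_mono mult_right_mono of_nat_mono) auto
  qed
  have "Pr (\<lambda>Y. \<forall>n\<in>{N+1..N+T}. \<not> has_ap n r Y) \<le> Pr (\<lambda>Y. \<forall>i\<in>I. \<not> ap_ev r i Y)"
  proof (rule Pr_mono)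
    show "depends_on (\<Union>i\<in>I. supp r i) (\<lambda>Y. \<forall>i\<in>I. \<not> ap_ev r i Y)"
      using familyD(2)[OF fam] by (intro depends_on_all depends_on_not depends_on_ap_ev finite_family[OF fam]) auto
    show "\<forall>i\<in>I. \<not> ap_ev r i Y" if "\<forall>n\<in>{N+1..N+T}. \<not> has_ap n r Y" for Y
      unfolding I_def using that r Ms(2) by (intro no_ap_imp_no_wide_ap_ev) (auto simp: Ms_def)
  qed
  also have "\<dots> \<le> ((\<Sum>i\<in>I. q * P) + 2 * (\<Sum>i\<in>I. \<Sum>m\<in>{m\<in>Ms. fst i \<le> m}. pair_bound r r m r)) / (\<Sum>i\<in>I. q * P)\<^sup>2"
    unfolding P_def by (rule family_second_moment[OF fam \<open>I \<noteq> {}\<close>])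
  also have "\<dots> \<le> (cI * (q * P) + 2 * (cI * (real T * PB))) / (cI * (q * P))\<^sup>2"
  proof -
    have "(\<Sum>m\<in>{m\<in>Ms. fst i \<le> m}. pair_bound r r m r) \<le> real T * PB" for i :: "nat \<times> int \<times> int"
    proof -
      have "(\<Sum>m\<in>{m\<in>Ms. fst i \<le> m}. pair_bound r r m r) \<le> (\<Sum>m\<in>Ms. pair_bound r r m r)"
        using Ms by (intro sum_mono2) (auto simp: pair_bound_nonneg)
      also have "\<dots> \<le> (\<Sum>m\<in>Ms. PB)" by (intro sum_mono PB)
      finally show ?thesis using Ms by simp
    qed
    then have "(\<Sum>i\<in>I. \<Sum>m\<in>{m\<in>Ms. fst i \<le> m}. pair_bound r r m r) \<le> (\<Sum>i\<in>I. real T * PB)" by (intro sum_mono)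
    also have "\<dots> = cI * (real T * PB)" by (simp add: cI_def)
    finally have le: "(\<Sum>i\<in>I. \<Sum>m\<in>{m\<in>Ms. fst i \<le> m}. pair_bound r r m r) \<le> cI * (real T * PB)" .
    have eq: "(\<Sum>i\<in>I. q * P) = cI * (q * P)" by (simp add: cI_def)
    show ?thesis unfolding eq by (intro divide_right_mono add_left_mono mult_left_mono le) simp_all
  qed
  also have "\<dots> = 1 / (cI * (q * P)) + 2 * real T * PB / (cI * q\<^sup>2 * P\<^sup>2)"
    using cI0 q01 P0 by (simp add: power2_eq_square field_simps)
  also have "\<dots> \<le> 1 / (real T * ((real N)\<^sup>2 / 4) * (q * P)) + 2 * real T * PB / (real T * ((real N)\<^sup>2 / 4) * q\<^sup>2 * P\<^sup>2)"
  proof (intro add_mono divide_left_mono mult_right_mono cI mult_pos_pos cI0 TN)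
    show "0 \<le> 2 * real T * PB" unfolding PB_def by (simp add: pair_bound_nonneg)
  qed (use q01 P0 T N1 in auto)
  also have "1 / (real T * ((real N)\<^sup>2 / 4) * (q * P)) = 4 / (real T * (real N)\<^sup>2 * q * P)" by simp
  \<comment> \<open>The number of moduli cancels: it enters the neighbours of one index and the
    total mean alike, so long blocks do no harm here.\<close>
  also have "2 * real T * PB / (real T * ((real N)\<^sup>2 / 4) * q\<^sup>2 * P\<^sup>2) = 8 / (q\<^sup>2 * (real N)\<^sup>2) * (PB / P\<^sup>2)"
    using T by simp
  finally have main: "Pr (\<lambda>Y. \<forall>n\<in>{N+1..N+T}. \<not> has_ap n r Y)
    \<le> 4 / (real T * (real N)\<^sup>2 * q * P) + 8 / (q\<^sup>2 * (real N)\<^sup>2) * (PB / P\<^sup>2)" .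
  have "PB / P\<^sup>2 \<le> (real r + 1)\<^sup>2 * (2 * real N) / p + (real r + 1) ^ 5 * p powr (- (real r + 1) / 2)"
  proof -
    define k where "k = (r + 1) div 2"
    have k: "k \<le> r" "2 * k \<le> r + 1" using r by (auto simp: k_def)
    have e1: "p ^ (r + r - 1) = P\<^sup>2 / p"
    proof -
      have "p ^ (r + r - 1) * p = P\<^sup>2" unfolding P_def power2_eq_square using r by (simp add: power_add [symmetric] flip: power_Suc2)
      then show ?thesis using p0 by (simp add: field_simps)
    qed
    have e2: "p ^ (r + r - k) \<le> P\<^sup>2 * p powr (- (real r + 1) / 2)"
    proof -
      have "p ^ (r + r - k) = p powr (real r + real r - real k)"
        using k p0 by (subst powr_realpow [symmetric]) (auto simp: of_nat_diff)
      also have "\<dots> \<le> p powr (real r + real r + (- (real r + 1) / 2))"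
      proof -
        have "real (2 * k) \<le> real (r + 1)" using k(2) by (rule of_nat_mono)
        then show ?thesis unfolding powr_lp using lp_pos by simp
      qed
      also have "\<dots> = P\<^sup>2 * p powr (- (real r + 1) / 2)"
        by (simp only: powr_add powr_realpow[OF p0] P_def power2_eq_square)
      finally show ?thesis .
    qed
    have r5: "real ((r + 1)\<^sup>2 * (r + 1)\<^sup>2 * r) \<le> (real r + 1) ^ 5"
    proof -
      have "(r + 1)\<^sup>2 * (r + 1)\<^sup>2 * r \<le> (r + 1)\<^sup>2 * (r + 1)\<^sup>2 * (r + 1)" by simp
      also have "\<dots> = (r + 1) ^ 5"
      proof -
        have "x\<^sup>2 * x\<^sup>2 * x = x ^ 5" for x :: nat by (simp add: power_numeral_reduce)
        then show ?thesis .
      qed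
      finally have "real ((r + 1)\<^sup>2 * (r + 1)\<^sup>2 * r) \<le> real ((r + 1) ^ 5)" by (rule of_nat_mono)
      then show ?thesis by (simp add: add.commute)
    qed
    have "PB \<le> real ((r + 1) * (r + 1) * (2 * N)) * (P\<^sup>2 / p) + (real r + 1) ^ 5 * (P\<^sup>2 * p powr (- (real r + 1) / 2))"
      unfolding PB_def pair_bound_def k_def [symmetric] e1
      using e2 r5 p0 by (intro add_mono mult_mono order_refl) auto
    also have "real ((r + 1) * (r + 1) * (2 * N)) = (real r + 1)\<^sup>2 * (2 * real N)"
      by (simp add: power2_eq_square algebra_simps)
    finally have "PB \<le> ((real r + 1)\<^sup>2 * (2 * real N) / p + (real r + 1) ^ 5 * p powr (- (real r + 1) / 2)) * P\<^sup>2"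
      by (simp add: algebra_simps)
    then show ?thesis using P0 by (simp add: pos_divide_le_eq)
  qed
  then have "8 / (q\<^sup>2 * (real N)\<^sup>2) * (PB / P\<^sup>2) \<le> 8 / (q\<^sup>2 * (real N)\<^sup>2)
      * ((real r + 1)\<^sup>2 * (2 * real N) / p + (real r + 1) ^ 5 * p powr (- (real r + 1) / 2))"
    by (rule mult_left_mono) simp
  then show ?thesis using main unfolding P_def by linarith
qed

text \<open>The events of about N^(1 - \<eta>) moduli are nearly pairwise independent, so their N^2
  progressions each add up to a mean of order N^(3 - \<eta>) p^r.\<close>

theorem limsup_lower:
  assumes e: "0 < \<eta>" "\<eta> < 1"
  shows "AE \<omega> in M. \<exists>\<^sub>F n in sequentially. (3 / 2 - \<eta>) * (2 / lp * ln (real n)) \<le> real (Wn n \<omega>)"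
proof -
  \<comment> \<open>With p^r about (2 N)^(-a), the block mean is about N^(1 - \<eta>) N^2 N^(-a) =
    N^\<eta>. The factor 2 in \<open>y\<close> covers all moduli up to 2 N, and the block length
    N^(1 - \<eta>) leaves room for the factor r^5 of rare steps.\<close>
  define a where "a = 3 - 2 * \<eta>"
  define c where "c = a / lp"
  have a: "0 < a" "0 < c" using e lp_pos by (auto simp: a_def c_def)
  define y where "y N = c * ln (2 * real N)" for N :: nat
  define r where "r N = nat \<lceil>y N\<rceil>" for N
  define T where "T N = nat \<lfloor>real N powr (1 - \<eta>)\<rfloor>" for N :: nat
  define B where "B N = event (\<lambda>Y. \<not> (\<forall>n\<in>{N+1..N+T N}. \<not> has_ap n (r N) Y))" for N
  have dep: "depends_on (\<Union>n\<in>{N+1..N+T N}. {1..n}) (\<lambda>Y. \<forall>n\<in>{N+1..N+T N}. \<not> has_ap n (r N) Y)" for N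
    by (intro depends_on_all depends_on_not depends_on_has_ap) auto
  have ev: "B N \<in> events" for N unfolding B_def using event_measurable depends_on_not dep by blast
  let ?U = "\<lambda>N. 8 * 2 powr a / (q * p) * real N powr (- \<eta>)
      + 8 / q\<^sup>2 * (2 / p * ((y N + 2)\<^sup>2 / real N) + 2 powr (a / 2) / p * ((y N + 2) ^ 5 * real N powr (- 1 / 2)))"
  have y: "filterlim y at_top sequentially" unfolding y_def using a by real_asymp
  have ev1: "\<forall>\<^sub>F N in sequentially. 16 \<le> y N" using y by (simp add: filterlim_at_top)
  have ev2: "\<forall>\<^sub>F N in sequentially. 2 \<le> real N powr (1 - \<eta>)"
  proof -
    have "filterlim (\<lambda>N. real N powr (1 - \<eta>)) at_top sequentially" using e by real_asymp
    then show ?thesis by (simp add: filterlim_at_top)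
  qed
  have ev3: "\<forall>\<^sub>F N in sequentially. 152 * real N powr (1 - \<eta>) * (y N + 1) ^ 5 \<le> real N"
  proof -
    have "(\<lambda>N. 152 * (y N + 1) ^ 5 * real N powr (- \<eta>)) \<longlonglongrightarrow> 0" unfolding y_def using a e by real_asymp
    then have "\<forall>\<^sub>F N in sequentially. 152 * (y N + 1) ^ 5 * real N powr (- \<eta>) < 1" by (rule order_tendstoD) simp
    then show ?thesis using eventually_ge_at_top[of 1]
    proof eventually_elim
      case (elim N)
      have "152 * real N powr (1 - \<eta>) * (y N + 1) ^ 5 = real N * (152 * (y N + 1) ^ 5 * real N powr (- \<eta>))"
        using elim by (simp add: powr_diff powr_minus divide_inverse)
      also have "\<dots> \<le> real N * 1" using elim by (intro mult_left_mono) auto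
      finally show ?case by simp
    qed
  qed
  have facts: "\<forall>\<^sub>F N in sequentially. 16 \<le> y N \<and> 1 \<le> T N \<and> T N \<le> N \<and> 152 * T N * r N ^ 5 \<le> N
     \<and> real N powr (1 - \<eta>) / 2 \<le> real (T N)"
    using ev1 ev2 ev3 eventually_ge_at_top[of 2]
  proof eventually_elim
    case (elim N)
    let ?t = "real N powr (1 - \<eta>)"
    have t: "?t - 1 \<le> real (T N)" "real (T N) \<le> ?t" unfolding T_def using elim(2) by linarith+
    have T1: "1 \<le> T N" unfolding T_def using elim(2) by (simp add: le_nat_floor)
    have rr: "real (r N) \<le> y N + 1" unfolding r_def using elim(1) by linarith
    have "152 * real (T N) * real (r N) ^ 5 \<le> 152 * ?t * (y N + 1) ^ 5"
      using t rr by (intro mult_mono power_mono) auto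
    also note elim(3)
    finally have "real (152 * T N * r N ^ 5) \<le> real N" by simp
    then have s: "152 * T N * r N ^ 5 \<le> N" by (simp only: of_nat_le_iff)
    have "?t \<le> real N powr 1" using elim e by (intro powr_mono) auto
    then have "T N \<le> N" using t(2) elim by simp
    moreover have "?t / 2 \<le> real (T N)" using t(1) elim(2) by linarith
    ultimately show ?case using elim s T1 by simp
  qed
  have "(\<lambda>N. prob (B N)) \<longlonglongrightarrow> 1"
  proof (rule tendsto_sandwich[of "\<lambda>N. 1 - ?U N" _ _ "\<lambda>_. 1"])
    show "\<forall>\<^sub>F N in sequentially. 1 - ?U N \<le> prob (B N)"
      using facts eventually_ge_at_top[of 2]
    proof eventually_elim
      case (elim N)
      have N0: "0 < real N" using elim by simp
      have r: "y N \<le> real (r N)" "real (r N) \<le> y N + 1" "16 \<le> r N" unfolding r_def using elim(1) by linarith+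
      have y2: "2 * real N > 0" using N0 by simp
      have py: "p powr y N = (2 * real N) powr (- a)"
        unfolding powr_lp y_def c_def using lp_pos N0 by (simp add: powr_def)
      have P: "p * (2 * real N) powr (- a) \<le> p ^ r N"
      proof -
        have "p powr (y N + 1) \<le> p powr (real (r N))" unfolding powr_lp using r lp_pos by simp
        then show ?thesis using p0 py by (simp add: powr_add powr_realpow mult.commute)
      qed
      have P2: "p powr (- (real (r N) + 1) / 2) \<le> (2 * real N) powr (a / 2) / p"
      proof -
        have "p powr (- (real (r N) + 1) / 2) \<le> p powr (- y N / 2 + (- 1))"
          unfolding powr_lp using r lp_pos by simp
        also have "\<dots> = (2 * real N) powr (a / 2) / p"
        proof -
          have "p powr (- y N / 2) = (p powr y N) powr (- 1 / 2)" by (simp add: powr_powr)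
          also have "\<dots> = (2 * real N) powr (a / 2)" unfolding py by (simp add: powr_powr)
          finally have key: "p powr (- y N / 2) = (2 * real N) powr (a / 2)" .
          have "p powr (- 1) = 1 / p" using p0 by (simp add: powr_minus_divide)
          then show ?thesis by (simp only: powr_add key times_divide_eq_right mult_1_right)
        qed
        finally show ?thesis .
      qed
      have pc: "prob (B N) = 1 - Pr (\<lambda>Y. \<forall>n\<in>{N+1..N+T N}. \<not> has_ap n (r N) Y)"
        unfolding B_def by (rule Pr_not[OF dep])
      have main: "Pr (\<lambda>Y. \<forall>n\<in>{N+1..N+T N}. \<not> has_ap n (r N) Y)
        \<le> 4 / (real (T N) * (real N)\<^sup>2 * q * p ^ r N)
          + 8 / (q\<^sup>2 * (real N)\<^sup>2) * ((real (r N) + 1)\<^sup>2 * (2 * real N) / p + (real (r N) + 1) ^ 5 * p powr (- (real (r N) + 1) / 2))"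
        using elim r by (intro block_second_moment) auto
      have first: "4 / (real (T N) * (real N)\<^sup>2 * q * p ^ r N) \<le> 8 * 2 powr a / (q * p) * real N powr (- \<eta>)"
      proof -
        have "(real N powr (1 - \<eta>) / 2) * (real N)\<^sup>2 * q * (p * (2 * real N) powr (- a)) \<le> real (T N) * (real N)\<^sup>2 * q * p ^ r N"
          using elim P q01 p0 by (intro mult_mono) auto
        moreover have "(real N powr (1 - \<eta>) / 2) * (real N)\<^sup>2 * q * (p * (2 * real N) powr (- a))
            = q * p / (2 * 2 powr a) * real N powr \<eta>"
        proof -
          have "(real N)\<^sup>2 = real N powr 2" using N0 by simp
          then have "real N powr (1 - \<eta>) * (real N)\<^sup>2 * real N powr (- a) = real N powr ((1 - \<eta>) + 2 + (- a))"
            by (simp only: powr_add)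
          also have "(1 - \<eta>) + 2 + (- a) = \<eta>" by (simp add: a_def)
          finally have "real N powr (1 - \<eta>) * (real N)\<^sup>2 * real N powr (- a) = real N powr \<eta>" .
          note key = this
          have Z: "(2 * real N) powr (- a) = real N powr (- a) / 2 powr a" by (simp add: powr_mult powr_minus divide_inverse)
          have "(real N powr (1 - \<eta>) / 2) * (real N)\<^sup>2 * q * (p * (2 * real N) powr (- a))
            = q * p / (2 * 2 powr a) * (real N powr (1 - \<eta>) * (real N)\<^sup>2 * real N powr (- a))"
            unfolding Z by simp
          then show ?thesis unfolding key .
        qed
        ultimately have "q * p / (2 * 2 powr a) * real N powr \<eta> \<le> real (T N) * (real N)\<^sup>2 * q * p ^ r N" by (simp only:)
        then have "4 / (real (T N) * (real N)\<^sup>2 * q * p ^ r N) \<le> 4 / (q * p / (2 * 2 powr a) * real N powr \<eta>)"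
        proof (rule divide_left_mono)
          have "0 < real (T N)" using elim(1) by simp
          then show "0 < real (T N) * (real N)\<^sup>2 * q * p ^ r N * (q * p / (2 * 2 powr a) * real N powr \<eta>)"
            using q01(1) p0 N0 by (intro mult_pos_pos divide_pos_pos zero_less_power) simp_all
        qed simp_all
        also have "\<dots> = 8 * 2 powr a / (q * p) * real N powr (- \<eta>)"
        proof -
          have "4 / (k / (2 * h) * z) = 8 * h / k * (1 / z)" for k h z :: real by simp
          then show ?thesis unfolding powr_minus_divide .
        qed
        finally show ?thesis .
      qed
      have "8 / (q\<^sup>2 * (real N)\<^sup>2) * ((real (r N) + 1)\<^sup>2 * (2 * real N) / p + (real (r N) + 1) ^ 5 * p powr (- (real (r N) + 1) / 2))
        \<le> 8 / (q\<^sup>2 * (real N)\<^sup>2) * ((y N + 2)\<^sup>2 * (2 * real N) / p + (y N + 2) ^ 5 * ((2 * real N) powr (a / 2) / p))"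
      proof -
        have "(real (r N) + 1)\<^sup>2 * (2 * real N) / p \<le> (y N + 2)\<^sup>2 * (2 * real N) / p"
          using r p0 by (intro divide_right_mono mult_right_mono power_mono) auto
        moreover have "(real (r N) + 1) ^ 5 * p powr (- (real (r N) + 1) / 2) \<le> (y N + 2) ^ 5 * ((2 * real N) powr (a / 2) / p)"
          using r by (intro mult_mono power_mono P2) auto
        ultimately show ?thesis by (intro mult_left_mono add_mono) auto
      qed
      also have "\<dots> = 8 / q\<^sup>2 * (2 / p * ((y N + 2)\<^sup>2 / real N) + 2 powr (a / 2) / p * ((y N + 2) ^ 5 * (real N powr (a / 2) / (real N)\<^sup>2)))"
      proof -
        have "8 / (q\<^sup>2 * n\<^sup>2) * (x * (2 * n) / p + w * (h * z / p)) = 8 / q\<^sup>2 * (2 / p * (x / n) + h / p * (w * (z / n\<^sup>2)))"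
          if "n > 0" for x w h z n :: real
          using that p0 q01 by (simp add: field_simps power2_eq_square)
        from this[OF N0] show ?thesis by (simp only: powr_mult)
      qed
      also have "\<dots> \<le> 8 / q\<^sup>2 * (2 / p * ((y N + 2)\<^sup>2 / real N) + 2 powr (a / 2) / p * ((y N + 2) ^ 5 * real N powr (- 1 / 2)))"
      proof -
        have "real N powr (a / 2) / (real N)\<^sup>2 = real N powr (a / 2 - 2)" using N0 by (simp add: powr_diff)
        also have "\<dots> \<le> real N powr (- 1 / 2)"
        proof (rule powr_mono)
          \<comment> \<open>Half overlaps cost p^(-r/2), about N^(a/2), against N^2 in the square of
            the mean; this is harmless because a < 3.\<close>
          show "a / 2 - 2 \<le> - 1 / 2" using e by (simp add: a_def field_simps)
        qed (use elim(2) in simp)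
        finally show ?thesis using elim(1) p0 by (intro mult_left_mono add_left_mono) auto
      qed
      finally have second: "8 / (q\<^sup>2 * (real N)\<^sup>2) * ((real (r N) + 1)\<^sup>2 * (2 * real N) / p + (real (r N) + 1) ^ 5 * p powr (- (real (r N) + 1) / 2))
        \<le> 8 / q\<^sup>2 * (2 / p * ((y N + 2)\<^sup>2 / real N) + 2 powr (a / 2) / p * ((y N + 2) ^ 5 * real N powr (- 1 / 2)))" .
      show ?case unfolding pc
        by (rule diff_left_mono[OF order_trans[OF main add_mono[OF first second]]])
    qed
    show "(\<lambda>N. 1 - ?U N) \<longlonglongrightarrow> 1"
    proof -
      have 1: "(\<lambda>N. real N powr (- \<eta>)) \<longlonglongrightarrow> 0" using e by real_asymp
      have 2: "(\<lambda>N. (y N + 2)\<^sup>2 / real N) \<longlonglongrightarrow> 0" unfolding y_def using a by real_asymp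
      have 3: "(\<lambda>N. (y N + 2) ^ 5 * real N powr (- 1 / 2)) \<longlonglongrightarrow> 0" unfolding y_def using a by real_asymp
      have "?U \<longlonglongrightarrow> 8 * 2 powr a / (q * p) * 0 + 8 / q\<^sup>2 * (2 / p * 0 + 2 powr (a / 2) / p * 0)"
        by (intro tendsto_intros 1 2 3)
      then have "?U \<longlonglongrightarrow> 0" by (simp only: mult_zero_right add_0_right)
      from tendsto_diff[OF tendsto_const[of 1] this] show ?thesis by (simp only: diff_zero)
    qed
  qed (auto simp: prob_le_1)
  from AE_frequently_of_prob_tendsto_1[OF ev this] show ?thesis
  proof eventually_elim
    case (elim \<omega>)
    have "\<exists>\<^sub>F N in sequentially. \<omega> \<in> B N \<and> (16 \<le> y N \<and> 1 \<le> T N \<and> T N \<le> N)"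
      by (rule frequently_rev_mp[OF elim(1)], rule eventually_mono[OF facts]) blast
    then show ?case unfolding frequently_sequentially
    proof (intro allI)
      fix n0 assume "\<forall>m. \<exists>N\<ge>m. \<omega> \<in> B N \<and> (16 \<le> y N \<and> 1 \<le> T N \<and> T N \<le> N)"
      then obtain N where N: "N \<ge> max n0 1" "\<omega> \<in> B N" "16 \<le> y N" "T N \<le> N" by blast
      then obtain n where n: "n \<in> {N+1..N+T N}" "has_ap n (r N) (X \<omega>)" by (auto simp: B_def event_def)
      have "r N \<ge> 1" unfolding r_def using N(3) by linarith
      then have W: "r N \<le> Wn n \<omega>" using n Wn_ge_iff[of n "r N"] by auto
      have "(3 / 2 - \<eta>) * (2 / lp * ln (real n)) = ((3 / 2 - \<eta>) * 2) / lp * ln (real n)" by simp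
      also have "(3 / 2 - \<eta>) * 2 = a" by (simp add: a_def)
      also have "a / lp * ln (real n) = c * ln (real n)" by (simp add: c_def)
      also have "\<dots> \<le> y N" unfolding y_def using n N a by (intro mult_left_mono) auto
      also have "\<dots> \<le> real (r N)" unfolding r_def by linarith
      also have "\<dots> \<le> real (Wn n \<omega>)" using W by simp
      finally show "\<exists>n\<ge>n0. (3 / 2 - \<eta>) * (2 / lp * ln (real n)) \<le> real (Wn n \<omega>)"
        using n N by (intro exI[of _ n]) auto
    qed
  qed
qed

end

text \<open>The bound is small when there are many events, each of probability at least x, and y /
  x^2 is close to 1, that is, when pairs are nearly independent. It is applied to the absence of
  long progressions for each modulus of a block, rather than to single progressions.\<close>

lemma (in prob_space) second_moment_uniform:
  assumes fin: "finite I" and ev: "\<And>i. i \<in> I \<Longrightarrow> A i \<in> events" and ne: "I \<noteq> {}"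
    and x: "0 < x" "\<And>i. i \<in> I \<Longrightarrow> x \<le> prob (A i)"
    and y: "0 \<le> y" "\<And>i j. i \<in> I \<Longrightarrow> j \<in> I \<Longrightarrow> i \<noteq> j \<Longrightarrow> prob (A i \<inter> A j) \<le> y"
  shows "prob (space M - (\<Union>i\<in>I. A i)) \<le> 1 / (real (card I) * x) + y / x\<^sup>2 - 1"
proof -
  define S where "S = (\<Sum>i\<in>I. prob (A i))"
  define T where "T = real (card I)"
  have T0: "0 < T" using fin ne by (simp add: T_def card_gt_0_iff)
  have "(\<Sum>i\<in>I. x) \<le> S" unfolding S_def by (intro sum_mono x)
  then have SL: "T * x \<le> S" by (simp add: T_def)
  have Tx: "0 < T * x" using T0 x by simp
  then have S0: "0 < S" using SL by linarith
  have "(\<Sum>i\<in>I. \<Sum>j\<in>I. prob (A i \<inter> A j)) \<le> (\<Sum>i\<in>I. \<Sum>j\<in>I. (if i = j then prob (A i) else 0) + y)"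
  proof (intro sum_mono)
    fix i j assume "i \<in> I" "j \<in> I"
    then show "prob (A i \<inter> A j) \<le> (if i = j then prob (A i) else 0) + y"
      using y by (cases "i = j") auto
  qed
  also have "\<dots> = S + T * (T * y)" using fin by (simp add: sum.distrib S_def T_def)
  finally have "(\<Sum>i\<in>I. \<Sum>j\<in>I. prob (A i \<inter> A j)) / S\<^sup>2 \<le> (S + T * (T * y)) / S\<^sup>2"
    by (intro divide_right_mono) auto
  also have "\<dots> = 1 / S + y * (T / S)\<^sup>2"
    using S0 by (simp add: add_divide_distrib power2_eq_square)
  also have "\<dots> \<le> 1 / (T * x) + y * (1 / x)\<^sup>2"
  proof -
    have "T / S \<le> 1 / x" using SL S0 x(1) by (simp add: field_simps)
    then show ?thesis using SL Tx S0 T0 y(1)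
      by (intro add_mono mult_left_mono power_mono divide_left_mono) auto
  qed
  also have "y * (1 / x)\<^sup>2 = y / x\<^sup>2" by (simp add: power_divide)
  finally show ?thesis using second_moment[OF fin ev] S0 unfolding S_def T_def by fastforce
qed

text \<open>With a step between \<open>n / 4\<close> and \<open>n / 2\<close>, two consecutive terms cannot both be at most \<open>n / 4\<close>.\<close>

definition quarter_index :: "nat \<Rightarrow> nat \<Rightarrow> (nat \<times> int \<times> int) set" where
  "quarter_index n r = {n} \<times> {1..int n} \<times> {s\<in>{1..int n}. int n < 4 * s \<and> 2 * s < int n \<and> good_step n (r\<^sup>2) s}"

lemma card_quarter_index:
  assumes n: "n \<ge> 1" and s: "8 * (1 + r ^ 4) \<le> n"
  shows "(real n)\<^sup>2 / 8 \<le> real (card (quarter_index n r))" "card (quarter_index n r) \<le> n\<^sup>2"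
proof -
  define G where "G = {s\<in>{1..int n}. int n < 4 * s \<and> 2 * s < int n \<and> good_step n (r\<^sup>2) s}"
  define B where "B = {s\<in>{1..int n}. \<not> good_step n (r\<^sup>2) s}"
  have c: "card (quarter_index n r) = n * card G" by (simp add: quarter_index_def G_def card_cartesian_product)
  have cB: "card B \<le> r ^ 4" using card_not_good[OF n, of "r\<^sup>2"] by (simp add: B_def power_mult [symmetric])
  have "card {int n div 4 + 1..(int n - 1) div 2} \<le> card (G \<union> B)"
    by (intro card_mono) (auto simp: G_def B_def)
  also have "\<dots> \<le> card G + r ^ 4" using card_Un_le[of G B] cB by linarith
  finally have "int (card {int n div 4 + 1..(int n - 1) div 2}) \<le> int (card G + r ^ 4)" by (rule of_nat_mono)
  moreover have "(int n - 1) div 2 - int n div 4 \<le> int (card {int n div 4 + 1..(int n - 1) div 2})"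
    unfolding card_atLeastAtMost_int by linarith
  ultimately have "(int n - 1) div 2 - int n div 4 \<le> int (card G + r ^ 4)" by linarith
  moreover have "int n \<le> 4 * x + 4" if "(int n - 1) div 2 - int n div 4 \<le> x" for x using that by presburger
  ultimately have "int n \<le> 4 * int (card G + r ^ 4) + 4" by blast
  then have "n \<le> 4 * (card G + r ^ 4) + 4" by linarith
  then have "n \<le> 8 * card G" using s by (simp add: algebra_simps)
  then have "real n \<le> real (8 * card G)" by (rule of_nat_mono)
  then have "real n / 8 \<le> real (card G)" by simp
  then have "real n * (real n / 8) \<le> real n * real (card G)" by (intro mult_left_mono) auto
  then show "(real n)\<^sup>2 / 8 \<le> real (card (quarter_index n r))" by (simp add: c power2_eq_square)
  have "card G \<le> card {1..int n}" by (intro card_mono) (auto simp: G_def)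
  then show "card (quarter_index n r) \<le> n\<^sup>2" by (simp add: c power2_eq_square)
qed

section \<open>The liminf along all moduli\<close>

context bernoulli_sequence
begin

text \<open>For the modulus 2^k a size (ln 2^k)^(1 + e) of n^2 p^r still leaves about (ln 2^k)^e
  after division by r, enough for summability over k. A modulus N with 2^k <= N < 2^(k+1) inherits
  the progression; the additive constant pays for ln N - ln 2^k <= ln 2 and for rounding the
  length.\<close>

theorem liminf_lower:
  assumes e: "0 < e" "e \<le> 1"
  shows "AE \<omega> in M. \<forall>\<^sub>F N in sequentially.
    2 / lp * ln (real N) - (1 + e) / lp * ln (ln (real N)) - (2 / lp * ln 2 + 1) \<le> real (Wn N \<omega>)"
proof -
  define L where "L k = ln 2 * real k" for k :: nat
  \<comment> \<open>This shift makes 4^k p^(\<open>y k\<close>) = (\<open>L k\<close>)^(1 + e);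
    rounding the length down then only increases the mean.\<close>
  define x where "x k = - ((1 + e) / lp * ln (L k))" for k
  define y where "y k = 2 / lp * L k + x k" for k
  define r where "r k = nat \<lfloor>y k\<rfloor>" for k
  define c where "c = 2 / lp + 1"
  define C where "C = 5 * (c ^ 5 / p ^ 3)"
  have c0: "0 < c" "0 < C" "0 < 2 / lp" "0 < (1 + e) / lp" "0 < q * lp / 32"
    using lp_pos p0 q01 e by (simp_all add: c_def C_def add_pos_pos)
  define V where "V k = event (\<lambda>Y. \<forall>i\<in>nonwrap_index (2 ^ k) (r k). \<not> ap_ev (r k) i Y)" for k
  have fin: "finite (nonwrap_index n s)" for n s by (simp add: nonwrap_index_def)
  have ev: "V k \<in> events" for k
    unfolding V_def
    by (rule event_measurable[OF depends_on_all[OF fin]], rule depends_on_not, rule depends_on_ap_ev)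
      (auto simp: nonwrap_index_def)
  have ytop: "filterlim y at_top sequentially"
  proof -
    define c1 where "c1 = 2 / lp"
    define c2 where "c2 = (1 + e) / lp"
    have "0 < c1" "0 < c2" using c0 by (simp_all add: c1_def c2_def)
    then have "filterlim (\<lambda>k. c1 * (ln 2 * real k) - c2 * ln (ln 2 * real k)) at_top sequentially" by real_asymp
    then show ?thesis by (simp add: y_def[abs_def] x_def L_def c1_def c2_def)
  qed
  have b: "\<forall>\<^sub>F k in sequentially. prob (V k) \<le> exp (- (q * lp / 32 * (ln 2 * real k) powr e)) + C * (ln 2 * real k) ^ 9 / 2 ^ k"
  proof -
    from ytop have 1: "\<forall>\<^sub>F k in sequentially. 3 \<le> y k" by (simp add: filterlim_at_top)
    have 2: "\<forall>\<^sub>F k in sequentially. 1 \<le> L k" unfolding L_def by real_asymp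
    have 3: "\<forall>\<^sub>F k in sequentially. 16 * (c * L k) ^ 5 \<le> 2 ^ k" unfolding L_def using c0(1) by real_asymp
    from 1 2 3 show ?thesis
    proof eventually_elim
      case (elim k)
      let ?n = "(2::nat) ^ k"
      have lnn: "ln (real ?n) = L k" by (simp only: ln_pow2 L_def)
      have lL: "0 \<le> ln (L k)" using elim by simp
      have r: "2 \<le> r k" "real (r k) \<le> y k" "y k - 1 \<le> real (r k)" unfolding r_def using elim(1) by linarith+
      have "x k \<le> 0" unfolding x_def using mult_nonneg_nonneg[OF less_imp_le[OF c0(4)] lL] by linarith
      then have yL: "y k \<le> 2 / lp * L k" by (simp add: y_def)
      have R: "real (r k) + 1 \<le> c * L k" using r yL elim(2) by (simp add: c_def distrib_right)
      have n5: "8 * r k * (1 + r k ^ 4) \<le> ?n"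
      proof -
        have "8 * r k * (1 + r k ^ 4) \<le> 8 * (r k + 1) * (2 * (r k + 1) ^ 4)"
        proof (intro mult_mono)
          have "r k ^ 4 \<le> (r k + 1) ^ 4" by (intro power_mono) auto
          moreover have "1 \<le> (r k + 1) ^ 4" by simp
          ultimately show "1 + r k ^ 4 \<le> 2 * (r k + 1) ^ 4" by linarith
        qed auto
        also have "\<dots> = 16 * (r k + 1) ^ 5"
        proof -
          have "8 * x * (2 * x ^ 4) = 16 * x ^ 5" for x :: nat by (simp add: power_numeral_reduce)
          then show ?thesis .
        qed
        finally have "real (8 * r k * (1 + r k ^ 4)) \<le> real (16 * (r k + 1) ^ 5)" by (rule of_nat_mono)
        also have "\<dots> = 16 * (real (r k) + 1) ^ 5" by (simp add: add.commute)
        also have "\<dots> \<le> 16 * (c * L k) ^ 5" using R by (intro mult_left_mono power_mono) auto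
        also have "\<dots> \<le> real ?n" using elim(3) by simp
        finally show ?thesis by (simp only: of_nat_le_iff)
      qed
      have u: "(real ?n)\<^sup>2 * p powr y k = L k powr (1 + e)"
      proof -
        have "(real ?n)\<^sup>2 * p powr y k = p powr x k"
          using sq_mult_powr[of "real ?n" "x k"] unfolding lnn y_def by simp
        also have "- lp * x k = (1 + e) * ln (L k)" using lp_pos by (simp add: x_def)
        then have "p powr x k = L k powr (1 + e)" unfolding powr_lp using elim(2) by (simp add: powr_def)
        finally show ?thesis .
      qed
      have lo: "L k powr (1 + e) \<le> (real ?n)\<^sup>2 * p ^ r k"
      proof -
        have "p powr y k \<le> p powr real (r k)" unfolding powr_lp using r lp_pos by simp
        then have "p powr y k \<le> p ^ r k" using p0 by (simp add: powr_realpow)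
        then show ?thesis unfolding u[symmetric] by (rule mult_left_mono) simp
      qed
      have up: "(real ?n)\<^sup>2 * p ^ r k \<le> (L k)\<^sup>2 / p"
      proof -
        have "p powr real (r k) \<le> p powr (y k - 1)" unfolding powr_lp using r lp_pos by simp
        then have "p ^ r k \<le> p powr y k / p" using p0 by (simp add: powr_realpow powr_diff)
        then have "(real ?n)\<^sup>2 * p ^ r k \<le> (real ?n)\<^sup>2 * (p powr y k / p)" by (rule mult_left_mono) simp
        also have "\<dots> = L k powr (1 + e) / p" unfolding u[symmetric] by simp
        also have "\<dots> \<le> L k powr 2 / p" using elim(2) e p0 by (intro divide_right_mono powr_mono) auto
        finally show ?thesis using elim(2) by simp
      qed
      have Q1: "1 \<le> (L k)\<^sup>2 / p"
      proof -
        have "p * 1 \<le> 1 * (L k)\<^sup>2" using elim(2) p0 p1 by (intro mult_mono) auto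
        then show ?thesis using p0 by (simp add: pos_le_divide_eq)
      qed
      have "prob (V k) \<le> exp (- (q / 16 * ((real ?n)\<^sup>2 * p ^ r k / real (r k)))) + 5 * ((c * L k) ^ 5 * ((L k)\<^sup>2 / p)\<^sup>2 / (p * real ?n))"
        unfolding V_def by (rule nonwrap_tail[OF r(1) n5 up Q1 R])
      moreover have "5 * ((c * L k) ^ 5 * ((L k)\<^sup>2 / p)\<^sup>2 / (p * real ?n)) = C * L k ^ 9 / 2 ^ k"
      proof -
        have "5 * ((c * l) ^ 5 * (l\<^sup>2 / p)\<^sup>2 / (p * t)) = 5 * (c ^ 5 / p ^ 3) * l ^ 9 / t" for l t :: real
          by (simp add: power_mult_distrib power_divide power_numeral_reduce mult_ac)
        then show ?thesis unfolding C_def of_nat_power of_nat_numeral .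
      qed
      moreover have "exp (- (q / 16 * ((real ?n)\<^sup>2 * p ^ r k / real (r k)))) \<le> exp (- (q * lp / 32 * L k powr e))"
      proof -
        have r0: "0 < real (r k)" using r(1) by simp
        have "lp / 2 * L k powr e \<le> (real ?n)\<^sup>2 * p ^ r k / real (r k)"
        proof -
          have "lp / 2 * L k powr e * real (r k) \<le> lp / 2 * L k powr e * (2 / lp * L k)"
            using r(2) yL lp_pos by (intro mult_left_mono) auto
          also have "\<dots> = L k powr (1 + e)" using lp_pos elim(2) by (simp add: powr_add)
          also note lo
          finally show ?thesis using r0 by (simp add: pos_le_divide_eq)
        qed
        then have "q / 16 * (lp / 2 * L k powr e) \<le> q / 16 * ((real ?n)\<^sup>2 * p ^ r k / real (r k))"
          using q01 by (intro mult_left_mono) auto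
        then show ?thesis by simp
      qed
      ultimately show ?case unfolding L_def by linarith
    qed
  qed
  have s: "summable (\<lambda>k. exp (- (q * lp / 32 * (ln 2 * real k) powr e)) + C * (ln 2 * real k) ^ 9 / 2 ^ k)"
    using c0 e by (intro summable_add summable_exp_powr summable_power_over_exp) auto
  have L1: "\<forall>\<^sub>F k in sequentially. 3 \<le> y k \<and> 1 \<le> L k"
  proof -
    from ytop have "\<forall>\<^sub>F k in sequentially. 3 \<le> y k" by (simp add: filterlim_at_top)
    moreover have "\<forall>\<^sub>F k in sequentially. 1 \<le> L k" unfolding L_def by real_asymp
    ultimately show ?thesis by eventually_elim simp
  qed
  from AE_eventually_not[OF ev s b] AE_space show ?thesis
  proof eventually_elim
    case (elim \<omega>)
    from eventually_conj[OF elim(1) L1] obtain k0 where k0: "\<And>k. k \<ge> k0 \<Longrightarrow> \<omega> \<notin> V k \<and> 3 \<le> y k \<and> 1 \<le> L k"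
      by (auto simp: eventually_sequentially)
    show ?case
    proof (rule eventually_sequentiallyI)
      fix N :: nat assume N: "2 ^ k0 \<le> N"
      then have N1: "1 \<le> N" by (meson one_le_numeral one_le_power order_trans)
      obtain k where k: "2 ^ k \<le> N" "N < 2 ^ (k + 1)" using ex_power_ivl1[of 2 N] N1 by auto
      have "(2::nat) ^ k0 < 2 ^ (k + 1)" using N k by linarith
      then have "k0 < k + 1" by (rule power_less_imp_less_exp[rotated]) simp
      then have kk: "\<omega> \<notin> V k" "3 \<le> y k" "1 \<le> L k" using k0[of k] by auto
      have r: "2 \<le> r k" "y k - 1 \<le> real (r k)" unfolding r_def using kk(2) by linarith+
      obtain i where i: "i \<in> nonwrap_index (2 ^ k) (r k)" "ap_ev (r k) i (X \<omega>)"
        using kk(1) elim(2) by (auto simp: V_def event_def)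
      have "has_ap N (r k) (X \<omega>)" by (rule nonwrap_has_ap[OF r(1) i k(1)])
      then have W: "r k \<le> Wn N \<omega>" using Wn_ge_iff[of N "r k" \<omega>] N1 r by auto
      have "ln (real N) \<le> ln (real (2 ^ (k + 1)))"
        by (rule ln_le_cancel_iff[THEN iffD2], use N1 in simp, simp, rule of_nat_mono) (use k in linarith)
      also have "\<dots> = L k + ln 2" unfolding ln_pow2 L_def by (simp add: algebra_simps)
      finally have 1: "ln (real N) - ln 2 \<le> L k" by simp
      have "ln (real (2 ^ k)) \<le> ln (real N)"
        by (rule ln_le_cancel_iff[THEN iffD2], simp, use N1 in simp, rule of_nat_mono[OF k(1)])
      then have "L k \<le> ln (real N)" unfolding ln_pow2 L_def .
      then have 2: "ln (L k) \<le> ln (ln (real N))" using kk(3) by simp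
      have "2 / lp * (ln (real N) - ln 2) + - ((1 + e) / lp * ln (ln (real N))) \<le> 2 / lp * L k + - ((1 + e) / lp * ln (L k))"
        using 1 2 c0 by (intro add_mono le_imp_neg_le mult_left_mono) auto
      also have "\<dots> = y k" by (simp add: y_def x_def)
      finally show "2 / lp * ln (real N) - (1 + e) / lp * ln (ln (real N)) - (2 / lp * ln 2 + 1) \<le> real (Wn N \<omega>)"
        using r(2) W by (simp only: right_diff_distrib)
    qed
  qed
qed

text \<open>The sieve for two moduli at once shows that the joint absence has nearly the product
  probability: the family has at least N^2 members up to lower order terms, twice N^2 / 2. The
  factor 80 is 5 per modulus times 8, since with 2 N and 4 Q the error unit is eight times the one
  for N and Q.\<close>

lemma pair_no_ap_le:
  assumes T: "T \<le> N" "1 \<le> N" and r: "3 \<le> r" "r * T \<le> N"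
    and nm: "n \<in> {N+1..N+T}" "m \<in> {N+1..N+T}" "n \<noteq> m"
    and Q: "(real N)\<^sup>2 * p ^ r \<le> Q" "1 \<le> Q" and R: "real r + 1 \<le> R"
  shows "Pr (\<lambda>Y. \<not> has_ap n r Y \<and> \<not> has_ap m r Y)
    \<le> exp (- (q * p ^ r * ((real N)\<^sup>2 - 16 * (real N)\<^sup>2 / real r - 152 * real N * real r ^ 5))) + 80 * (R ^ 5 * Q\<^sup>2 / (p * real N))"
proof -
  define Ms where "Ms = {n, m}"
  define I where "I = wide_family Ms r"
  have Ms: "finite Ms" "card Ms = 2" "Ms \<noteq> {}" "\<And>k. k \<in> Ms \<Longrightarrow> k \<ge> 1" "\<And>k. k \<in> Ms \<Longrightarrow> N < k \<and> k \<le> 2 * N"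
    using nm T by (auto simp: Ms_def)
  have fam: "family Ms (\<lambda>_. r) I" unfolding I_def using r by (intro family_wide Ms) auto
  have lowk: "(real N)\<^sup>2 / 2 - 8 * (real N)\<^sup>2 / real r - 76 * real N * real r ^ 5 \<le> real (card (wide_index Ms r k))"
    if k: "k \<in> Ms" for k
  proof -
    have kN: "N < k" "k \<le> 2 * N" using Ms(5)[OF k] by auto
    have "int r * \<bar>int l - int k\<bar> < int k" if l: "l \<in> Ms" for l
    proof -
      have "\<bar>int l - int k\<bar> \<le> int T" using k l nm by (auto simp: Ms_def)
      then have "int r * \<bar>int l - int k\<bar> \<le> int r * int T" by (intro mult_left_mono) auto
      also have "\<dots> \<le> int N" using r(2) by (metis of_nat_le_iff of_nat_mult)
      finally show ?thesis using kN by linarith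
    qed
    then have L: "(real k)\<^sup>2 / 2 - 2 * (real k)\<^sup>2 / real r - 19 * real (card Ms) * real k * real r ^ 5 \<le> real (card (wide_index Ms r k))"
      using k r Ms by (intro card_wide_index) auto
    have k2: "real k \<le> 2 * real N" using kN by linarith
    have "(real k)\<^sup>2 \<le> (2 * real N)\<^sup>2" using k2 by (intro power_mono) auto
    then have "2 * (real k)\<^sup>2 / real r \<le> 8 * (real N)\<^sup>2 / real r" by (intro divide_right_mono) (auto simp: power_mult_distrib)
    moreover have "19 * 2 * real k * real r ^ 5 \<le> 19 * 2 * (2 * real N) * real r ^ 5"
      using k2 by (intro mult_right_mono mult_left_mono) auto
    moreover have "(real N)\<^sup>2 \<le> (real k)\<^sup>2" using kN by (intro power_mono) auto
    ultimately show ?thesis using L unfolding Ms(2) of_nat_numeral by linarith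
  qed
  have cardI: "real (card I) = (\<Sum>k\<in>Ms. real (card (wide_index Ms r k)))"
    by (simp add: I_def card_wide_family[OF Ms(1)])
  have lowI: "(real N)\<^sup>2 - 16 * (real N)\<^sup>2 / real r - 152 * real N * real r ^ 5 \<le> real (card I)"
  proof -
    have "(\<Sum>k\<in>Ms. (real N)\<^sup>2 / 2 - 8 * (real N)\<^sup>2 / real r - 76 * real N * real r ^ 5) \<le> real (card I)"
      unfolding cardI by (intro sum_mono lowk)
    then show ?thesis using Ms(2) by (simp add: algebra_simps)
  qed
  have upI: "real (card I) \<le> (real (2 * N))\<^sup>2"
  proof -
    have "real (card I) \<le> (\<Sum>k\<in>Ms. (real (2 * N))\<^sup>2 / 2)" unfolding cardI
    proof (rule sum_mono)
      fix k assume k: "k \<in> Ms"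
      have "card (wide_index Ms r k) \<le> card (half_index k r)"
        by (intro card_mono wide_subset_half) (simp add: half_index_def)
      then have "real (card (wide_index Ms r k)) \<le> (real k)\<^sup>2 / 2"
        using card_half_index(1)[OF Ms(4)[OF k], of r] by linarith
      also have "\<dots> \<le> (real (2 * N))\<^sup>2 / 2" using Ms(5)[OF k] by (intro divide_right_mono power_mono) auto
      finally show "real (card (wide_index Ms r k)) \<le> (real (2 * N))\<^sup>2 / 2" .
    qed
    then show ?thesis using Ms(2) by simp
  qed
  define E where "E = R ^ 5 * (4 * Q)\<^sup>2 / (p * real (2 * N))"
  have E: "0 \<le> E" "E = 8 * (R ^ 5 * Q\<^sup>2 / (p * real N))"
    using R Q p0 T by (auto simp: E_def power_mult_distrib)
  have sv: "\<bar>Pr (\<lambda>Y. \<forall>i\<in>I. \<not> ap_ev r i Y) - exp (- (real (card I) * (q * p ^ r)))\<bar>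
     \<le> real (card I) / (real (2 * N))\<^sup>2 * (5 * real (card Ms) * E)"
    unfolding E_def
  proof (rule family_sieve_le[OF fam])
    show "(real (2 * N))\<^sup>2 * p ^ r \<le> 4 * Q" using Q by (simp add: power_mult_distrib)
  qed (use Ms T r Q R in auto)
  have "Pr (\<lambda>Y. \<not> has_ap n r Y \<and> \<not> has_ap m r Y) \<le> Pr (\<lambda>Y. \<forall>i\<in>I. \<not> ap_ev r i Y)"
  proof (rule Pr_mono)
    show "depends_on (\<Union>i\<in>I. supp r i) (\<lambda>Y. \<forall>i\<in>I. \<not> ap_ev r i Y)"
      using familyD(2)[OF fam] by (intro depends_on_all depends_on_not depends_on_ap_ev finite_family[OF fam]) auto
    show "\<forall>i\<in>I. \<not> ap_ev r i Y" if "\<not> has_ap n r Y \<and> \<not> has_ap m r Y" for Y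
      unfolding I_def using that r Ms(4) by (intro no_ap_imp_no_wide_ap_ev) (auto simp: Ms_def)
  qed
  also have "\<dots> \<le> exp (- (real (card I) * (q * p ^ r))) + real (card I) / (real (2 * N))\<^sup>2 * (5 * real (card Ms) * E)"
    using sv by (simp add: abs_le_iff)
  also have "\<dots> \<le> exp (- (q * p ^ r * ((real N)\<^sup>2 - 16 * (real N)\<^sup>2 / real r - 152 * real N * real r ^ 5))) + 1 * (5 * real (card Ms) * E)"
  proof (intro add_mono mult_right_mono)
    have "q * p ^ r * ((real N)\<^sup>2 - 16 * (real N)\<^sup>2 / real r - 152 * real N * real r ^ 5) \<le> q * p ^ r * real (card I)"
      using lowI q01 p0 by (intro mult_left_mono) auto
    then show "exp (- (real (card I) * (q * p ^ r))) \<le> exp (- (q * p ^ r * ((real N)\<^sup>2 - 16 * (real N)\<^sup>2 / real r - 152 * real N * real r ^ 5)))"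
      by (simp add: mult_ac)
    show "real (card I) / (real (2 * N))\<^sup>2 \<le> 1" using upI T by (intro divide_le_eq_1[THEN iffD2] disjI1) auto
  qed (use E(1) in simp)
  finally show ?thesis using E Ms(2) by simp
qed

text \<open>All probabilities here may tend to 0, so errors must be small relative to the square of
  exp(-mean). The number \<open>g\<close> majorises the reciprocal of that square, \<beta> is the
  relative Poisson error for one modulus, and d bounds the discrepancy between twice the single mean
  and the joint mean.\<close>

lemma block_low_bound:
  assumes T: "1 \<le> T" "T \<le> N" and N: "3 \<le> N" and r: "3 \<le> r" "r * T \<le> N"
    and Q: "(real N)\<^sup>2 * p ^ r \<le> Q" "1 \<le> Q" and R: "real r + 1 \<le> R"
    and g: "exp (4 * (q * Q)) \<le> g"
    and \<beta>: "poisson_const * (ln (2 * real N) ^ 7 / real N) * g \<le> \<beta>" "\<beta> < 1"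
    and d: "q * Q * (3 * (real T / real N) + 16 / real r + 152 * real r ^ 5 / real N) \<le> d"
  shows "Pr (\<lambda>Y. \<forall>n\<in>{N+1..N+T}. has_ap n r Y)
    \<le> g / (real T * (1 - \<beta>)) + (exp d + 80 * (R ^ 5 * Q\<^sup>2 / (p * real N)) * g) / (1 - \<beta>)\<^sup>2 - 1"
proof -
  let ?A = "\<lambda>n. event (\<lambda>Y. \<not> has_ap n r Y)"
  define u where "u = (real N)\<^sup>2 * p ^ r"
  define t where "t = real T / real N"
  define a where "a = q * u / 2 * (1 + t)\<^sup>2"
  define b where "b = q * p ^ r * ((real N)\<^sup>2 - 16 * (real N)\<^sup>2 / real r - 152 * real N * real r ^ 5)"
  define e1 where "e1 = poisson_const * (ln (2 * real N) ^ 7 / real N)"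
  define e2 where "e2 = 80 * (R ^ 5 * Q\<^sup>2 / (p * real N))"
  \<comment> \<open>Worst cases over the block: n <= N + T for a single modulus, and the smallest
    mean, computed with N, for a pair. Then 2 a - b <= d is what makes y / x^2 close to 1.\<close>
  define x where "x = exp (- a) * (1 - \<beta>)"
  define y where "y = exp (- b) + e2"
  have N0: "0 < real N" using N by simp
  have u0: "0 < u" "u \<le> Q" using N0 p0 Q by (simp_all add: u_def)
  have t: "0 \<le> t" "t \<le> 1" using T N0 by (simp_all add: t_def)
  have e12: "0 \<le> e1" "0 \<le> e2" using poisson_const(1) N Q R p0 by (simp_all add: e1_def e2_def)
  have a0: "0 \<le> a" using u0 q01 by (simp add: a_def)
  have a2: "2 * a \<le> 4 * (q * Q)"
  proof -
    have "(1 + t)\<^sup>2 \<le> 2\<^sup>2" using t by (intro power_mono) auto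
    then have "q * u * (1 + t)\<^sup>2 \<le> q * Q * 4" using u0 q01 by (intro mult_mono) auto
    then show ?thesis by (simp add: a_def)
  qed
  have ga: "exp (2 * a) \<le> g" using a2 g by (intro order_trans[OF _ g]) simp
  have ga1: "exp a \<le> g" using ga a0 by (intro order_trans[OF _ ga]) simp
  have g0: "0 < g" using ga1 exp_gt_zero[of a] by linarith
  have x0: "0 < x" using \<beta>(2) by (simp add: x_def)
  have y0: "0 \<le> y" using e12 by (simp add: y_def add_nonneg_nonneg)
  have low: "x \<le> prob (?A n)" if n: "n \<in> {N+1..N+T}" for n
  proof -
    have n3: "3 \<le> n" "2 \<le> r" using n N r by auto
    have "exp (- (q * (real n)\<^sup>2 * p ^ r / 2)) - poisson_const * (ln (real n) ^ 7 / real n) \<le> prob (?A n)"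
      using poisson_const(2)[OF n3] by (simp add: abs_le_iff)
    moreover have "poisson_const * (ln (real n) ^ 7 / real n) \<le> e1"
      unfolding e1_def using n N T poisson_const(1) by (intro mult_left_mono frac_le power_mono) auto
    moreover have "exp (- a) \<le> exp (- (q * (real n)\<^sup>2 * p ^ r / 2))"
    proof -
      have "real N * (1 + t) = real N + real T" using N0 by (simp add: t_def distrib_left)
      moreover have "real n \<le> real (N + T)" using n by (intro of_nat_mono) simp
      ultimately have "real n \<le> real N * (1 + t)" by simp
      then have "(real n)\<^sup>2 \<le> (real N * (1 + t))\<^sup>2" by (intro power_mono) auto
      then have "(q * p ^ r / 2) * (real n)\<^sup>2 \<le> (q * p ^ r / 2) * (real N * (1 + t))\<^sup>2"
        using q01 p0 by (intro mult_left_mono) auto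
      then show ?thesis by (simp add: a_def u_def power_mult_distrib mult_ac)
    qed
    moreover have "e1 \<le> exp (- a) * \<beta>"
    proof -
      have "e1 * exp a \<le> e1 * g" using ga1 e12 by (intro mult_left_mono)
      also have "\<dots> \<le> \<beta>" using \<beta>(1) by (simp add: e1_def)
      finally have "exp (- a) * (e1 * exp a) \<le> exp (- a) * \<beta>" by (intro mult_left_mono) auto
      then show ?thesis by (simp add: mult.left_commute exp_minus_inverse mult.commute[of "exp (- a)"] flip: exp_add)
    qed
    ultimately show ?thesis unfolding x_def right_diff_distrib by linarith
  qed
  have pair: "prob (?A n \<inter> ?A m) \<le> y" if "n \<in> {N+1..N+T}" "m \<in> {N+1..N+T}" "n \<noteq> m" for n m
    unfolding event_Int y_def b_def e2_def using N by (intro pair_no_ap_le[OF T(2) _ r that Q R]) auto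
  have ev: "?A n \<in> events" if "n \<in> {N+1..N+T}" for n
    using event_measurable[OF depends_on_not[OF depends_on_has_ap]] that by auto
  have "prob (space M - (\<Union>n\<in>{N+1..N+T}. ?A n)) \<le> 1 / (real (card {N+1..N+T}) * x) + y / x\<^sup>2 - 1"
    by (rule second_moment_uniform[OF _ ev _ x0 low y0 pair]) (use T in auto)
  moreover have "space M - (\<Union>n\<in>{N+1..N+T}. ?A n) = event (\<lambda>Y. \<forall>n\<in>{N+1..N+T}. has_ap n r Y)"
    by (auto simp: event_def)
  ultimately have main: "Pr (\<lambda>Y. \<forall>n\<in>{N+1..N+T}. has_ap n r Y) \<le> 1 / (real T * x) + y / x\<^sup>2 - 1" by simp
  have "1 / (real T * x) \<le> g / (real T * (1 - \<beta>))"
  proof -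
    have "1 / (real T * x) = exp a / (real T * (1 - \<beta>))" by (simp add: x_def exp_minus field_simps)
    also have "\<dots> \<le> g / (real T * (1 - \<beta>))" using ga1 T \<beta>(2) by (intro divide_right_mono) auto
    finally show ?thesis .
  qed
  moreover have "y / x\<^sup>2 \<le> (exp d + e2 * g) / (1 - \<beta>)\<^sup>2"
  proof -
    have "y / x\<^sup>2 = (exp (2 * a) * y) / (1 - \<beta>)\<^sup>2"
      unfolding exp_double by (simp add: x_def power_mult_distrib exp_minus field_simps)
    also have "exp (2 * a) * y = exp (2 * a - b) + e2 * exp (2 * a)" by (simp add: y_def algebra_simps flip: exp_add)
    also have "(exp (2 * a - b) + e2 * exp (2 * a)) / (1 - \<beta>)\<^sup>2 \<le> (exp d + e2 * g) / (1 - \<beta>)\<^sup>2"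
    proof (intro divide_right_mono add_mono mult_left_mono ga e12)
      have "2 * a - b = q * u * ((1 + t)\<^sup>2 - 1 + 16 / real r + 152 * real r ^ 5 / real N)"
        using N0 r by (simp add: a_def b_def u_def power2_eq_square field_simps)
      also have "\<dots> \<le> q * Q * (3 * t + 16 / real r + 152 * real r ^ 5 / real N)"
      proof (intro mult_mono)
        have "t * t \<le> 1 * t" using t by (intro mult_right_mono) auto
        then show "(1 + t)\<^sup>2 - 1 + 16 / real r + 152 * real r ^ 5 / real N \<le> 3 * t + 16 / real r + 152 * real r ^ 5 / real N"
          by (simp add: power2_eq_square algebra_simps)
        show "0 \<le> (1 + t)\<^sup>2 - 1 + 16 / real r + 152 * real r ^ 5 / real N"
          using t by (intro add_nonneg_nonneg) (auto simp: power2_eq_square algebra_simps)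
      qed (use u0 q01 Q in auto)
      also have "\<dots> \<le> d" using d by (simp add: t_def)
      finally show "exp (2 * a - b) \<le> exp d" by simp
    qed simp
    finally show ?thesis .
  qed
  ultimately show ?thesis using main unfolding e2_def by linarith
qed

text \<open>With n^2 p^r of order (ln N)^e and e < 1, a modulus has no progression of length r with
  probability larger than any negative power of N, so N^(1/4) moduli suffice to find one, and errors
  of order 1/N stay relatively small. The condition e < 1 enters again through the narrow steps:
  they remove a proportion 1/r of the mean, an amount (ln N)^(e - 1) that tends to 0.\<close>

theorem liminf_upper:
  assumes e: "0 < e" "e < 1"
  shows "AE \<omega> in M. \<exists>\<^sub>F n in sequentially. real (Wn n \<omega>) < 2 / lp * ln (real n) - e\<^sup>2 / lp * ln (ln (real n))"
proof -
  define x where "x N = - e / lp * ln (ln (real N))" for N :: nat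
  define y where "y N = 2 / lp * ln (real N) + x N" for N
  define r where "r N = nat \<lfloor>y N\<rfloor>" for N
  define T where "T N = nat \<lfloor>real N powr (1 / 4)\<rfloor>" for N :: nat
  define c where "c = 2 / lp + 1"
  define B where "B N = event (\<lambda>Y. \<not> (\<forall>n\<in>{N+1..N+T N}. has_ap n (r N) Y))" for N
  have dep: "depends_on (\<Union>n\<in>{N+1..N+T N}. {1..n}) (\<lambda>Y. \<forall>n\<in>{N+1..N+T N}. has_ap n (r N) Y)" for N
    by (intro depends_on_all depends_on_has_ap) auto
  have ev: "B N \<in> events" for N unfolding B_def using event_measurable depends_on_not dep by blast
  define Q where "Q N = ln (real N) powr e / p" for N :: nat
  define \<beta> where "\<beta> N = poisson_const * (ln (2 * real N) ^ 7 / real N * real N powr (1 / 8))" for N :: nat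
  define d where "d N = q / p * (3 * (ln (real N) powr e * real N powr (- 3 / 4)) + 16 * lp * ln (real N) powr (e - 1)
      + 152 * (2 / lp) ^ 5 * (ln (real N) powr e * ln (real N) ^ 5 / real N))" for N :: nat
  define h where "h N = 80 * c ^ 5 / p ^ 3 * (ln (real N) ^ 5 * (ln (real N) powr e)\<^sup>2 / real N * real N powr (1 / 8))" for N :: nat
  let ?U = "\<lambda>N. 2 / (1 - \<beta> N) * real N powr (- 1 / 8) + (exp (d N) + h N) / (1 - \<beta> N)\<^sup>2 - 1"
  have c0: "0 < c" "0 < 2 / lp" "0 < e / lp" using lp_pos e by (simp_all add: c_def add_pos_pos)
  have lim\<beta>: "\<beta> \<longlonglongrightarrow> 0"
  proof -
    have "(\<lambda>N. ln (2 * real N) ^ 7 / real N * real N powr (1 / 8)) \<longlonglongrightarrow> 0" by real_asymp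
    from tendsto_mult_right_zero[OF this, of poisson_const] show ?thesis unfolding \<beta>_def .
  qed
  have limd: "d \<longlonglongrightarrow> 0"
  proof -
    have "(\<lambda>N. ln (real N) powr e * real N powr (- 3 / 4)) \<longlonglongrightarrow> 0" using e by real_asymp
    moreover have "(\<lambda>N. ln (real N) powr (e - 1)) \<longlonglongrightarrow> 0"
    proof -
      have "0 < 1 - e" using e by simp
      then have "(\<lambda>N. ln (real N) powr (- (1 - e))) \<longlonglongrightarrow> 0" by real_asymp
      then show ?thesis by simp
    qed
    moreover have "(\<lambda>N. ln (real N) powr e * ln (real N) ^ 5 / real N) \<longlonglongrightarrow> 0" using e by real_asymp
    ultimately have "d \<longlonglongrightarrow> q / p * (3 * 0 + 16 * lp * 0 + 152 * (2 / lp) ^ 5 * 0)"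
      unfolding d_def by (intro tendsto_intros)
    then show ?thesis by simp
  qed
  have limh: "h \<longlonglongrightarrow> 0"
  proof -
    have "(\<lambda>N. ln (real N) ^ 5 * (ln (real N) powr e)\<^sup>2 / real N * real N powr (1 / 8)) \<longlonglongrightarrow> 0" using e by real_asymp
    from tendsto_mult_right_zero[OF this, of "80 * c ^ 5 / p ^ 3"] show ?thesis unfolding h_def .
  qed
  have limU: "?U \<longlonglongrightarrow> 0"
  proof -
    have 1: "(\<lambda>N. real N powr (- 1 / 8)) \<longlonglongrightarrow> 0" by real_asymp
    have "?U \<longlonglongrightarrow> 2 / (1 - 0) * 0 + (exp 0 + 0) / (1 - 0)\<^sup>2 - 1"
      by (intro tendsto_intros lim\<beta> limd limh 1) simp_all
    then show ?thesis by simp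
  qed
  have y1: "\<forall>\<^sub>F N in sequentially. ln (real N) / lp + 1 \<le> y N"
  proof -
    define k where "k = 1 / lp"
    define k' where "k' = e / lp"
    have "0 < k" "0 < k'" using lp_pos e by (simp_all add: k_def k'_def)
    then have "filterlim (\<lambda>N. k * ln (real N) - k' * ln (ln (real N))) at_top sequentially" by real_asymp
    then have "\<forall>\<^sub>F N in sequentially. 1 \<le> k * ln (real N) - k' * ln (ln (real N))" by (simp add: filterlim_at_top)
    then show ?thesis
    proof eventually_elim
      case (elim N)
      have "y N = 2 * (k * ln (real N)) - k' * ln (ln (real N))" by (simp add: y_def x_def k_def k'_def)
      moreover have "ln (real N) / lp = k * ln (real N)" by (simp add: k_def)
      ultimately show ?case using elim by linarith
    qed
  qed
  have y2: "\<forall>\<^sub>F N in sequentially. 4 \<le> ln (real N) / lp + 1"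
  proof -
    define k where "k = 1 / lp"
    have "0 < k" using lp_pos by (simp add: k_def)
    then have "filterlim (\<lambda>N. k * ln (real N)) at_top sequentially" by real_asymp
    then have "\<forall>\<^sub>F N in sequentially. 3 \<le> k * ln (real N)" by (simp add: filterlim_at_top)
    then show ?thesis by eventually_elim (simp add: k_def)
  qed
  have rT: "\<forall>\<^sub>F N in sequentially. c * ln (real N) * real N powr (1 / 4) \<le> real N"
  proof -
    have "(\<lambda>N. c * ln (real N) * real N powr (1 / 4) / real N) \<longlonglongrightarrow> 0" using c0 by real_asymp
    then have "\<forall>\<^sub>F N in sequentially. c * ln (real N) * real N powr (1 / 4) / real N < 1" by (rule order_tendstoD) simp
    then show ?thesis using eventually_gt_at_top[of 0] by eventually_elim (simp add: divide_less_eq)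
  qed
  have T2: "\<forall>\<^sub>F N in sequentially. 2 \<le> real N powr (1 / 4)"
  proof -
    have "filterlim (\<lambda>N. real N powr (1 / 4)) at_top sequentially" by real_asymp
    then show ?thesis by (simp add: filterlim_at_top)
  qed
  have l1: "\<forall>\<^sub>F N in sequentially. 1 \<le> ln (real N)" by real_asymp
  have gg: "\<forall>\<^sub>F N in sequentially. exp (4 * q / p * ln (real N) powr e) \<le> real N powr (1 / 8)"
    using e q01 p0 by (intro eventually_exp_ln_powr_le) auto
  have b1: "\<forall>\<^sub>F N in sequentially. \<beta> N < 1" using lim\<beta> by (rule order_tendstoD) simp
  \<comment> \<open>The length is chosen from N, but the exceptional modulus n may be as large as 2
    N. One factor e is given up to compare the iterated logarithms, hence e^2 in the
    statement.\<close>
  have llg: "\<forall>\<^sub>F N in sequentially. e * ln (ln (2 * real N)) \<le> ln (ln (real N))"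
  proof -
    have "(\<lambda>N. ln (ln (2 * real N)) / ln (ln (real N))) \<longlonglongrightarrow> 1" by real_asymp
    moreover have "1 < 1 / e" using e by simp
    ultimately have "\<forall>\<^sub>F N in sequentially. ln (ln (2 * real N)) / ln (ln (real N)) < 1 / e" by (rule order_tendstoD)
    moreover have "\<forall>\<^sub>F N in sequentially. 0 < ln (ln (real N))" by real_asymp
    ultimately show ?thesis
    proof eventually_elim
      case (elim N)
      then have "ln (ln (2 * real N)) < 1 / e * ln (ln (real N))" by (simp add: pos_divide_less_eq)
      then have "e * ln (ln (2 * real N)) \<le> e * (1 / e * ln (ln (real N)))" using e by (intro mult_left_mono) auto
      then show ?case using e by simp
    qed
  qed
  have facts: "\<forall>\<^sub>F N in sequentially. 1 \<le> T N \<and> T N \<le> N \<and> 3 \<le> r N \<and> real (r N) \<le> y N \<and> 1 \<le> ln (real N) \<and> 3 \<le> N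
     \<and> e * ln (ln (2 * real N)) \<le> ln (ln (real N))"
    using y1 y2 rT T2 l1 llg eventually_ge_at_top[of 3]
  proof eventually_elim
    case (elim N)
    have "real N powr (1 / 4) \<le> real N powr 1" using elim by (intro powr_mono) auto
    also have "\<dots> = real N" by simp
    finally have "T N \<le> N" unfolding T_def by linarith
    moreover have "1 \<le> T N" unfolding T_def using elim(4) by (simp add: le_nat_floor)
    moreover have "3 \<le> r N" "real (r N) \<le> y N" unfolding r_def using elim(1,2) by linarith+
    ultimately show ?case using elim by simp
  qed
  have "(\<lambda>N. prob (B N)) \<longlonglongrightarrow> 1"
  proof (rule tendsto_sandwich[of "\<lambda>N. 1 - ?U N" _ _ "\<lambda>_. 1"])
    show "\<forall>\<^sub>F N in sequentially. 1 - ?U N \<le> prob (B N)"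
      using facts y1 rT T2 gg b1
    proof eventually_elim
      case (elim N)
      define L where "L = ln (real N)"
      have N0: "0 < real N" "3 \<le> N" using elim by auto
      have L1: "1 \<le> L" using elim by (simp add: L_def)
      have r: "3 \<le> r N" "real (r N) \<le> y N" "y N - 1 \<le> real (r N)" using elim(1) unfolding r_def by linarith+
      have rlow: "L / lp \<le> real (r N)" using elim(2) r(3) by (simp add: L_def)
      have "x N \<le> 0" unfolding x_def using e lp_pos L1 unfolding L_def by (simp add: mult_nonneg_nonneg)
      then have yL: "y N \<le> 2 / lp * L" by (simp add: y_def L_def)
      have rup: "real (r N) \<le> 2 / lp * L" using r yL by linarith
      have R: "real (r N) + 1 \<le> c * L" using rup L1 by (simp add: c_def distrib_right)
      have Tu: "real (T N) \<le> real N powr (1 / 4)" "real N powr (1 / 4) / 2 \<le> real (T N)"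
        unfolding T_def using elim(4) by linarith+
      have TN: "1 \<le> T N" "T N \<le> N" using elim(1) by auto
      have rTN: "r N * T N \<le> N"
      proof -
        have "real (r N) * real (T N) \<le> c * L * real N powr (1 / 4)" using R Tu r L1 c0 by (intro mult_mono) auto
        also have "\<dots> \<le> real N" using elim(3) by (simp add: L_def)
        finally have "real (r N * T N) \<le> real N" by simp
        then show ?thesis by (simp only: of_nat_le_iff)
      qed
      have u: "(real N)\<^sup>2 * p powr y N = L powr e"
      proof -
        have "(real N)\<^sup>2 * p powr y N = p powr x N" unfolding y_def by (rule sq_mult_powr[OF N0(1)])
        also have "- lp * x N = e * ln L" using lp_pos by (simp add: x_def L_def)
        then have "p powr x N = L powr e" unfolding powr_lp using L1 by (simp add: powr_def)
        finally show ?thesis .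
      qed
      have QN: "(real N)\<^sup>2 * p ^ r N \<le> Q N"
      proof -
        have "p powr real (r N) \<le> p powr (y N - 1)" unfolding powr_lp using r lp_pos by simp
        then have "p ^ r N \<le> p powr y N / p" using p0 by (simp add: powr_realpow powr_diff)
        then have "(real N)\<^sup>2 * p ^ r N \<le> (real N)\<^sup>2 * (p powr y N / p)" by (rule mult_left_mono) simp
        also have "\<dots> = Q N" unfolding Q_def L_def[symmetric] u[symmetric] by simp
        finally show ?thesis .
      qed
      have Q1: "1 \<le> Q N"
      proof -
        have "p * 1 \<le> 1 * L powr e" using L1 p0 p1 e by (intro mult_mono ge_one_powr_ge_zero) auto
        then show ?thesis using p0 by (simp add: Q_def L_def pos_le_divide_eq)
      qed
      have pc: "prob (B N) = 1 - Pr (\<lambda>Y. \<forall>n\<in>{N+1..N+T N}. has_ap n (r N) Y)"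
        unfolding B_def by (rule Pr_not[OF dep])
      have ge: "exp (4 * (q * Q N)) \<le> real N powr (1 / 8)" using elim(5) by (simp add: Q_def mult.assoc)
      have be: "poisson_const * (ln (2 * real N) ^ 7 / real N) * real N powr (1 / 8) \<le> \<beta> N" by (simp add: \<beta>_def)
      have de: "q * Q N * (3 * (real (T N) / real N) + 16 / real (r N) + 152 * real (r N) ^ 5 / real N) \<le> d N"
      proof -
        have t1: "real (T N) / real N \<le> real N powr (- 3 / 4)"
        proof -
          have "real (T N) / real N \<le> real N powr (1 / 4) / real N powr 1" using Tu N0 by (simp add: divide_right_mono)
          also have "\<dots> = real N powr (1 / 4 - 1)" by (rule powr_diff [symmetric])
          finally show ?thesis by simp
        qed
        have t2: "16 / real (r N) \<le> 16 / (L / lp)" using rlow L1 lp_pos r by (intro divide_left_mono) auto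
        have t3: "152 * real (r N) ^ 5 / real N \<le> 152 * (2 / lp * L) ^ 5 / real N"
          using rup by (intro divide_right_mono mult_left_mono power_mono) auto
        have "q * Q N * (3 * (real (T N) / real N) + 16 / real (r N) + 152 * real (r N) ^ 5 / real N)
          \<le> q * Q N * (3 * real N powr (- 3 / 4) + 16 / (L / lp) + 152 * (2 / lp * L) ^ 5 / real N)"
          using t1 t2 t3 q01 Q1 by (intro mult_left_mono add_mono) auto
        also have "\<dots> = d N"
        proof -
          have "L powr (e - 1) = L powr e / L" using L1 by (simp add: powr_diff)
          moreover have "q * (l / p) * (3 * z + 16 / (k / lp) + 152 * (2 / lp * k) ^ 5 / n)
            = q / p * (3 * (l * z) + 16 * lp * (l / k) + 152 * (2 / lp) ^ 5 * (l * k ^ 5 / n))" for l z k n :: real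
            by (simp add: algebra_simps power_mult_distrib power_divide add_divide_distrib)
          ultimately show ?thesis unfolding d_def Q_def L_def[symmetric] by simp
        qed
        finally show ?thesis .
      qed
      have main: "Pr (\<lambda>Y. \<forall>n\<in>{N+1..N+T N}. has_ap n (r N) Y)
        \<le> real N powr (1 / 8) / (real (T N) * (1 - \<beta> N)) + (exp (d N) + 80 * ((c * L) ^ 5 * (Q N)\<^sup>2 / (p * real N)) * real N powr (1 / 8)) / (1 - \<beta> N)\<^sup>2 - 1"
        by (rule block_low_bound[OF TN N0(2) r(1) rTN QN Q1 R ge be elim(6) de])
      have h: "80 * ((c * L) ^ 5 * (Q N)\<^sup>2 / (p * real N)) * real N powr (1 / 8) = h N"
      proof -
        have "80 * ((c * k) ^ 5 * (l / p)\<^sup>2 / (p * n)) * z = 80 * c ^ 5 / p ^ 3 * (k ^ 5 * l\<^sup>2 / n * z)" for k l n z :: real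
          by (simp add: power_mult_distrib power_divide power_numeral_reduce mult_ac)
        then show ?thesis unfolding h_def Q_def L_def[symmetric] .
      qed
      have first: "real N powr (1 / 8) / (real (T N) * (1 - \<beta> N)) \<le> 2 / (1 - \<beta> N) * real N powr (- 1 / 8)"
      proof -
        have b: "0 < 1 - \<beta> N" using elim(6) by simp
        have z: "0 < real N powr (1 / 8)" using N0 by simp
        have "real N powr (1 / 4) = real N powr (1 / 8) * real N powr (1 / 8)" by (simp flip: powr_add)
        then have "real N powr (1 / 8) * real N powr (1 / 8) / 2 * (1 - \<beta> N) \<le> real (T N) * (1 - \<beta> N)"
          using Tu b by (intro mult_right_mono) auto
        then have "real N powr (1 / 8) / (real (T N) * (1 - \<beta> N)) \<le> real N powr (1 / 8) / (real N powr (1 / 8) * real N powr (1 / 8) / 2 * (1 - \<beta> N))"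
          using TN b z by (intro divide_left_mono mult_pos_pos) auto
        also have "\<dots> = 2 / (1 - \<beta> N) * (1 / real N powr (1 / 8))" using z by simp
        also have "1 / real N powr (1 / 8) = real N powr (- 1 / 8)" by (simp add: powr_minus_divide [symmetric])
        finally show ?thesis .
      qed
      show ?case unfolding pc using main first unfolding h by linarith
    qed
    show "(\<lambda>N. 1 - ?U N) \<longlonglongrightarrow> 1"
      using tendsto_diff[OF tendsto_const[of 1] limU] by (simp only: diff_zero)
  qed (auto simp: prob_le_1)
  from AE_frequently_of_prob_tendsto_1[OF ev this] show ?thesis
  proof eventually_elim
    case (elim \<omega>)
    show ?case unfolding frequently_sequentially
    proof (intro allI)
      fix n0
      have "\<exists>\<^sub>F N in sequentially. \<omega> \<in> B N \<and> ((1 \<le> T N \<and> T N \<le> N \<and> 3 \<le> r N \<and> real (r N) \<le> y N \<and> 1 \<le> ln (real N) \<and> 3 \<le> N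
     \<and> e * ln (ln (2 * real N)) \<le> ln (ln (real N))) \<and> n0 \<le> N)"
        by (rule frequently_eventually_frequently[OF elim eventually_conj[OF facts eventually_ge_at_top]])
      then obtain N where N: "\<omega> \<in> B N" "T N \<le> N" "3 \<le> r N" "real (r N) \<le> y N" "1 \<le> ln (real N)" "3 \<le> N"
        "e * ln (ln (2 * real N)) \<le> ln (ln (real N))" "n0 \<le> N" by (blast dest: frequently_ex)
      then obtain n where n: "n \<in> {N+1..N+T N}" "\<not> has_ap n (r N) (X \<omega>)" by (auto simp: B_def event_def)
      have W: "Wn n \<omega> < r N" using n N(3) Wn_ge_iff[of n "r N" \<omega>] by (simp add: not_le [symmetric])
      have Nn: "real N \<le> real n" "real n \<le> 2 * real N" "3 \<le> n" using n N(2,6) by auto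
      have lnn: "ln (real N) \<le> ln (real n)" using Nn N(6) by simp
      have "ln (real n) \<le> ln (2 * real N)" using Nn N(6) by simp
      moreover have "1 \<le> ln (real n)" using lnn N(5) by linarith
      ultimately have "ln (ln (real n)) \<le> ln (ln (2 * real N))" by simp
      then have "e * ln (ln (real n)) \<le> e * ln (ln (2 * real N))" using e by (intro mult_left_mono) auto
      also note N(7)
      finally have "e * (e * ln (ln (real n))) \<le> e * ln (ln (real N))" using e by (intro mult_left_mono) auto
      then have "e * (e * ln (ln (real n))) / lp \<le> e * ln (ln (real N)) / lp" using lp_pos by (intro divide_right_mono) auto
      then have 1: "e\<^sup>2 / lp * ln (ln (real n)) \<le> e / lp * ln (ln (real N))" by (simp add: power2_eq_square)
      have 2: "2 / lp * ln (real N) \<le> 2 / lp * ln (real n)" using lnn lp_pos by (intro mult_left_mono) auto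
      have "y N = 2 / lp * ln (real N) - e / lp * ln (ln (real N))" by (simp add: y_def x_def)
      then have "real (Wn n \<omega>) < 2 / lp * ln (real n) - e\<^sup>2 / lp * ln (ln (real n))"
        using W N(4) 1 2 by linarith
      then show "\<exists>n\<ge>n0. real (Wn n \<omega>) < 2 / lp * ln (real n) - e\<^sup>2 / lp * ln (ln (real n))"
        using n N(8) by (intro exI[of _ n]) auto
    qed
  qed
qed

end

lemma small_mult_le:
  fixes S s z Z :: real
  assumes "0 < s" "s \<le> S" "0 \<le> Z" "Z \<le> z"
  shows "(S + 2 * Z) / S\<^sup>2 \<le> 1 / s + 2 * z / s\<^sup>2"
proof -
  have "(S + 2 * Z) / S\<^sup>2 = 1 / S + 2 * Z / S\<^sup>2"
    using assms by (simp add: add_divide_distrib power2_eq_square)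
  also have "\<dots> \<le> 1 / s + 2 * z / s\<^sup>2"
    using assms by (intro add_mono frac_le power_mono) auto
  finally show ?thesis .
qed

section \<open>Powers of four and the limsup along powers of two\<close>

context bernoulli_sequence
begin

text \<open>The ratio 4 between successive moduli is what \<open>small_modulus_overlap\<close> asks
  for. The K moduli contribute a mean of at least K q \<sigma> / 8, while the pair sum has at most
  K^2 terms of order R^5 / 4^K.\<close>

lemma pow4_block:
  fixes \<rho> :: "nat \<Rightarrow> nat" and K :: nat
  assumes K: "1 \<le> K" and \<sigma>: "0 < \<sigma>" and R: "1 \<le> R"
    and k: "\<And>k. k \<in> {K+1..2*K} \<Longrightarrow> 2 \<le> \<rho> (4 ^ k) \<and> real (\<rho> (4 ^ k)) + 1 \<le> R \<and> 8 * (1 + \<rho> (4 ^ k) ^ 4) \<le> 4 ^ k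
      \<and> (real (4 ^ k))\<^sup>2 * p ^ \<rho> (4 ^ k) \<le> 1 \<and> \<sigma> \<le> (real (4 ^ k))\<^sup>2 * p ^ \<rho> (4 ^ k)"
  shows "Pr (\<lambda>Y. \<forall>k\<in>{K+1..2*K}. \<not> has_ap (4 ^ k) (\<rho> (4 ^ k)) Y)
    \<le> 1 / (real K * (q / 8 * \<sigma>)) + 2 * (real K * (real K * (2 * (R ^ 5 / (p * 4 ^ K))))) / (real K * (q / 8 * \<sigma>))\<^sup>2"
proof -
  define Ms where "Ms = (\<lambda>k. (4::nat) ^ k) ` {K+1..2*K}"
  define I where "I = (\<Union>n\<in>Ms. quarter_index n (\<rho> n))"
  have inj: "inj_on (\<lambda>k. (4::nat) ^ k) {K+1..2*K}" by (auto simp: inj_on_def)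
  have Ms: "finite Ms" "card Ms = K" unfolding Ms_def by (simp, subst card_image[OF inj], simp)
  have P: "1 \<le> n" "2 \<le> \<rho> n" "real (\<rho> n) + 1 \<le> R" "8 * (1 + \<rho> n ^ 4) \<le> n" "(real n)\<^sup>2 * p ^ \<rho> n \<le> 1" "\<sigma> \<le> (real n)\<^sup>2 * p ^ \<rho> n"
      "4 ^ K \<le> n" if nM: "n \<in> Ms" for n
  proof -
    obtain l where l: "l \<in> {K+1..2*K}" "n = 4 ^ l" using nM unfolding Ms_def by blast
    show "1 \<le> n" "2 \<le> \<rho> n" "real (\<rho> n) + 1 \<le> R" "8 * (1 + \<rho> n ^ 4) \<le> n" "(real n)\<^sup>2 * p ^ \<rho> n \<le> 1" "\<sigma> \<le> (real n)\<^sup>2 * p ^ \<rho> n"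
      using k[OF l(1)] by (auto simp: l(2))
    show "4 ^ K \<le> n" unfolding l(2) using l(1) by (intro power_increasing) auto
  qed
  have fam: "family Ms \<rho> I"
  proof -
    have gm: "good_step n (\<rho> n) s" if "good_step n ((\<rho> n)\<^sup>2) s" for n s
      using that by (rule good_step_mono) (simp add: power2_eq_square)
    have "compatible_bound (\<rho> (fst i)) i (\<rho> (fst j)) j (\<rho> (fst j))"
      if ij: "i \<in> I" "j \<in> I" "i \<noteq> j" "fst i \<le> fst j" for i j
    proof -
      obtain n b s m c t where e: "i = (n,b,s)" "j = (m,c,t)" by (cases i, cases j)
      have n: "n \<in> Ms" "(n,b,s) \<in> quarter_index n (\<rho> n)" using ij(1) by (auto simp: e I_def quarter_index_def)
      have m: "m \<in> Ms" "(m,c,t) \<in> quarter_index m (\<rho> m)" using ij(2) by (auto simp: e I_def quarter_index_def)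
      show ?thesis
      proof (cases "n = m")
        case True
        then show ?thesis
          using same_modulus_overlap[of n "\<rho> n" b s c t] n m P(1,2)[OF n(1)] ij(3)
          unfolding compatible_bound_def e quarter_index_def by auto
      next
        case False
        then have nm: "n < m" using ij(4) by (simp add: e)
        obtain k l where kl: "n = 4 ^ k" "m = 4 ^ l" using n(1) m(1) by (auto simp: Ms_def)
        have "k < l" using nm unfolding kl by (rule power_less_imp_less_exp[rotated]) simp
        then have "(4::nat) ^ (k + 1) \<le> 4 ^ l" by (intro power_increasing) auto
        then have "4 * n \<le> m" by (simp add: kl)
        moreover have "ones (\<rho> n) (n,b,s) \<subseteq> {1..n}"
          using ones_sub_supp[of "\<rho> n" "(n,b,s)"] supp_props(5)[of "(n,b,s)" "\<rho> n"] P(1)[OF n(1)] by auto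
        ultimately have "2 * card (ones (\<rho> n) (n,b,s) \<inter> ones (\<rho> m) (m,c,t)) \<le> \<rho> m + 1"
          using m P(1)[OF m(1)] gm[of m t] by (intro small_modulus_overlap) (auto simp: quarter_index_def)
        then show ?thesis by (simp add: compatible_bound_def e)
      qed
    qed
    moreover have "1 \<le> \<rho> n" if "n \<in> Ms" for n using P(2)[OF that] by linarith
    ultimately show ?thesis
      using Ms P(1) gm unfolding family_def
      by (auto simp: I_def quarter_index_def pr_index_def)
  qed
  have finQ: "finite (quarter_index n r)" for n r by (simp add: quarter_index_def)
  have sumI: "(\<Sum>i\<in>I. f (fst i)) = (\<Sum>n\<in>Ms. real (card (quarter_index n (\<rho> n))) * f n)" for f :: "nat \<Rightarrow> real"
  proof -
    have "(\<Sum>i\<in>I. f (fst i)) = (\<Sum>n\<in>Ms. \<Sum>i\<in>quarter_index n (\<rho> n). f (fst i))"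
      unfolding I_def using Ms finQ by (intro sum.UNION_disjoint) (auto simp: quarter_index_def)
    also have "\<dots> = (\<Sum>n\<in>Ms. \<Sum>i\<in>quarter_index n (\<rho> n). f n)"
      by (intro sum.cong refl) (auto simp: quarter_index_def)
    finally show ?thesis by simp
  qed
  define s where "s = real K * (q / 8 * \<sigma>)"
  define z where "z = real K * (real K * (2 * (R ^ 5 / (p * 4 ^ K))))"
  define S where "S = (\<Sum>i\<in>I. q * p ^ \<rho> (fst i))"
  define Z where "Z = (\<Sum>i\<in>I. \<Sum>m\<in>{m\<in>Ms. fst i \<le> m}. pair_bound (\<rho> (fst i)) (\<rho> m) m (\<rho> m))"
  have s0: "0 < s" using K \<sigma> q01 by (simp add: s_def)
  have sS: "s \<le> S"
  proof -
    have "(\<Sum>n\<in>Ms. q / 8 * \<sigma>) \<le> (\<Sum>n\<in>Ms. real (card (quarter_index n (\<rho> n))) * (q * p ^ \<rho> n))"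
    proof (rule sum_mono)
      fix n assume n: "n \<in> Ms"
      have "q / 8 * \<sigma> \<le> q / 8 * ((real n)\<^sup>2 * p ^ \<rho> n)" using P(6)[OF n] q01 by (intro mult_left_mono) auto
      also have "\<dots> = (real n)\<^sup>2 / 8 * (q * p ^ \<rho> n)" by simp
      also have "\<dots> \<le> real (card (quarter_index n (\<rho> n))) * (q * p ^ \<rho> n)"
        using card_quarter_index(1)[OF P(1,4)[OF n]] q01 p0 by (intro mult_right_mono) auto
      finally show "q / 8 * \<sigma> \<le> real (card (quarter_index n (\<rho> n))) * (q * p ^ \<rho> n)" .
    qed
    then show ?thesis unfolding S_def sumI[of "\<lambda>n. q * p ^ \<rho> n"] s_def by (simp add: Ms)
  qed
  have Z0: "0 \<le> Z" unfolding Z_def by (intro sum_nonneg pair_bound_nonneg)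
  have Zz: "Z \<le> z"
  proof -
    have "Z = (\<Sum>n\<in>Ms. real (card (quarter_index n (\<rho> n))) * (\<Sum>m\<in>{m\<in>Ms. n \<le> m}. pair_bound (\<rho> n) (\<rho> m) m (\<rho> m)))"
      unfolding Z_def by (rule sumI[of "\<lambda>n. \<Sum>m\<in>{m\<in>Ms. n \<le> m}. pair_bound (\<rho> n) (\<rho> m) m (\<rho> m)"])
    also have "\<dots> \<le> (\<Sum>n\<in>Ms. real K * (2 * (R ^ 5 / (p * 4 ^ K))))"
    proof (rule sum_mono)
      fix n assume n: "n \<in> Ms"
      have "real (card (quarter_index n (\<rho> n))) \<le> real (n\<^sup>2)"
        using card_quarter_index(2)[OF P(1,4)[OF n]] by (rule of_nat_mono)
      then have "real (card (quarter_index n (\<rho> n))) * (\<Sum>m\<in>{m\<in>Ms. n \<le> m}. pair_bound (\<rho> n) (\<rho> m) m (\<rho> m))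
        \<le> (real n)\<^sup>2 * (\<Sum>m\<in>{m\<in>Ms. n \<le> m}. pair_bound (\<rho> n) (\<rho> m) m (\<rho> m))"
        by (intro mult_right_mono sum_nonneg pair_bound_nonneg) simp
      also have "\<dots> = (\<Sum>m\<in>{m\<in>Ms. n \<le> m}. (real n)\<^sup>2 * pair_bound (\<rho> n) (\<rho> m) m (\<rho> m))"
        by (rule sum_distrib_left)
      also have "\<dots> \<le> (\<Sum>m\<in>{m\<in>Ms. n \<le> m}. 2 * (R ^ 5 / (p * 4 ^ K)))"
      proof (rule sum_mono)
        fix m assume "m \<in> {m\<in>Ms. n \<le> m}"
        then have m: "m \<in> Ms" by simp
        have "1 \<le> \<rho> n" "1 \<le> \<rho> m" using P(2)[OF n] P(2)[OF m] by linarith+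
        \<comment> \<open>Here Q = 1, as each n^2 p^r is at most 1; the estimate decays with the
          larger modulus m >= 4^K.\<close>
        then have "(real n)\<^sup>2 * pair_bound (\<rho> n) (\<rho> m) m (\<rho> m) \<le> 2 * (R ^ 5 * 1\<^sup>2 / (p * real m))"
          by (intro pair_bound_le P(1)[OF m] P(5)[OF n] P(5)[OF m] P(3)[OF n] P(3)[OF m]) simp_all
        also have "\<dots> \<le> 2 * (R ^ 5 / (p * 4 ^ K))"
        proof -
          have "real (4 ^ K) \<le> real m" by (rule of_nat_mono[OF P(7)[OF m]])
          then have "p * 4 ^ K \<le> p * real m" using p0 by simp
          then have "R ^ 5 / (p * real m) \<le> R ^ 5 / (p * 4 ^ K)" using p0 R P(1)[OF m] by (intro divide_left_mono) auto
          then show ?thesis by simp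
        qed
        finally show "(real n)\<^sup>2 * pair_bound (\<rho> n) (\<rho> m) m (\<rho> m) \<le> 2 * (R ^ 5 / (p * 4 ^ K))" .
      qed
      also have "\<dots> = real (card {m\<in>Ms. n \<le> m}) * (2 * (R ^ 5 / (p * 4 ^ K)))" by simp
      also have "\<dots> \<le> real K * (2 * (R ^ 5 / (p * 4 ^ K)))"
      proof (rule mult_right_mono)
        have "card {m\<in>Ms. n \<le> m} \<le> card Ms" using Ms by (intro card_mono) auto
        then show "real (card {m\<in>Ms. n \<le> m}) \<le> real K" using Ms by simp
      qed (use R p0 in simp)
      finally show "real (card (quarter_index n (\<rho> n))) * (\<Sum>m\<in>{m\<in>Ms. n \<le> m}. pair_bound (\<rho> n) (\<rho> m) m (\<rho> m))
        \<le> real K * (2 * (R ^ 5 / (p * 4 ^ K)))" .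
    qed
    also have "\<dots> = z" by (simp add: z_def Ms)
    finally show ?thesis .
  qed
  have "I \<noteq> {}"
  proof
    assume "I = {}"
    then have "S = 0" by (simp add: S_def)
    then show False using s0 sS by simp
  qed
  have "Pr (\<lambda>Y. \<forall>k\<in>{K+1..2*K}. \<not> has_ap (4 ^ k) (\<rho> (4 ^ k)) Y) \<le> Pr (\<lambda>Y. \<forall>i\<in>I. \<not> ap_ev (\<rho> (fst i)) i Y)"
  proof (rule Pr_mono)
    show "depends_on (\<Union>i\<in>I. supp (\<rho> (fst i)) i) (\<lambda>Y. \<forall>i\<in>I. \<not> ap_ev (\<rho> (fst i)) i Y)"
      using familyD(2)[OF fam] by (intro depends_on_all depends_on_not depends_on_ap_ev finite_family[OF fam]) auto
    show "\<forall>i\<in>I. \<not> ap_ev (\<rho> (fst i)) i Y" if h: "\<forall>k\<in>{K+1..2*K}. \<not> has_ap (4 ^ k) (\<rho> (4 ^ k)) Y" for Y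
    proof (intro ballI notI)
      fix i assume i: "i \<in> I" "ap_ev (\<rho> (fst i)) i Y"
      then obtain n b s where e: "i = (n,b,s)" "n \<in> Ms" "s \<in> {1..int n}" "good_step n ((\<rho> n)\<^sup>2) s"
        by (auto simp: I_def quarter_index_def)
      have "\<rho> n - 1 \<le> (\<rho> n)\<^sup>2" by (cases "\<rho> n") (auto simp: power2_eq_square)
      then have "has_ap n (\<rho> n) Y"
        using ap_ev_imp_has_ap[OF P(1)[OF e(2)] good_step_mono[OF e(4)] e(3)] i e(1) by auto
      then show False using h e(2) by (auto simp: Ms_def)
    qed
  qed
  also have "\<dots> \<le> (S + 2 * Z) / S\<^sup>2" unfolding S_def Z_def by (rule family_second_moment[OF fam \<open>I \<noteq> {}\<close>])
  also have "\<dots> \<le> 1 / s + 2 * z / s\<^sup>2" by (rule small_mult_le[OF s0 sS Z0 Zz])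
  finally show ?thesis by (simp only: s_def z_def)
qed

text \<open>At excess (e / \<open>lp\<close>) ln ln 4^k each modulus has a mean of order k^(-e).
  Since e < 1, the K exponents in (K, 2 K] together have a mean of order K^(1 - e), which tends to
  infinity.\<close>

theorem pow2_limsup_lower:
  assumes e: "0 < e" "e < 1"
  shows "AE \<omega> in M. \<exists>\<^sub>F k in sequentially. 2 / lp * (ln 2 * real k) + e / lp * ln (ln 2 * real k) \<le> real (Wn (2 ^ k) \<omega>)"
proof -
  define y where "y n = 2 / lp * ln (real n) + e / lp * ln (ln (real n))" for n :: nat
  define \<rho> where "\<rho> n = nat \<lceil>y n\<rceil>" for n
  define c where "c = 3 / lp * (2 * ln 4) + 2"
  \<comment> \<open>The smallest value of n^2 p^r in the block: ln 4^k is at most 2 K ln 4, and the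
    factor p pays for rounding the length up.\<close>
  define \<sigma> where "\<sigma> K = p * (2 * ln 4 * real K) powr (- e)" for K :: nat
  define B where "B K = event (\<lambda>Y. \<not> (\<forall>k\<in>{K+1..2*K}. \<not> has_ap (4 ^ k) (\<rho> (4 ^ k)) Y))" for K
  let ?s = "\<lambda>K. real K * (q / 8 * \<sigma> K)"
  let ?U = "\<lambda>K. 1 / ?s K + 2 * (real K * (real K * (2 * ((c * real K) ^ 5 / (p * 4 ^ K))))) / (?s K)\<^sup>2"
  have dep: "depends_on (\<Union>k\<in>{K+1..2*K}. {1..4 ^ k}) (\<lambda>Y. \<forall>k\<in>{K+1..2*K}. \<not> has_ap (4 ^ k) (\<rho> (4 ^ k)) Y)" for K
    by (intro depends_on_all depends_on_not depends_on_has_ap) auto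
  have ev: "B K \<in> events" for K unfolding B_def using event_measurable depends_on_not dep by blast
  have c0: "0 < c" "2 \<le> c" using lp_pos by (simp_all add: c_def add_pos_pos)
  define a where "a = 2 / lp * ln 4"
  have a0: "0 < a" using lp_pos by (simp add: a_def)
  have ya: "\<forall>\<^sub>F K in sequentially. 2 \<le> a * real K" using a0 by real_asymp
  have cK: "\<forall>\<^sub>F K in sequentially. 16 * (c * real K) ^ 5 \<le> 4 ^ K" using c0 by real_asymp
  have limU: "?U \<longlonglongrightarrow> 0"
  proof -
    define h where "h = q / 8 * p"
    have h0: "0 < h" using q01 p0 by (simp add: h_def)
    have e1: "0 < 1 - e" using e by simp
    have sK: "?s K = h * (real K * (2 * ln 4 * real K) powr (- e))" for K by (simp add: \<sigma>_def h_def)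
    have 1: "(\<lambda>K. 1 / (h * (real K * (2 * ln 4 * real K) powr (- e)))) \<longlonglongrightarrow> 0"
      using h0 e e1 by real_asymp
    have 2: "(\<lambda>K. 2 * (real K * (real K * (2 * ((c * real K) ^ 5 / (p * 4 ^ K))))) / (h * (real K * (2 * ln 4 * real K) powr (- e)))\<^sup>2) \<longlonglongrightarrow> 0"
      using h0 e e1 c0(1) p0 by real_asymp
    show ?thesis unfolding sK using tendsto_add[OF 1 2] by (simp only: add_0_left)
  qed
  have "(\<lambda>K. prob (B K)) \<longlonglongrightarrow> 1"
  proof (rule tendsto_sandwich[of "\<lambda>K. 1 - ?U K" _ _ "\<lambda>_. 1"])
    show "\<forall>\<^sub>F K in sequentially. 1 - ?U K \<le> prob (B K)"
      using ya cK eventually_ge_at_top[of 1]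
    proof eventually_elim
      case (elim K)
      have pc: "prob (B K) = 1 - Pr (\<lambda>Y. \<forall>k\<in>{K+1..2*K}. \<not> has_ap (4 ^ k) (\<rho> (4 ^ k)) Y)"
        unfolding B_def by (rule Pr_not[OF dep])
      have "Pr (\<lambda>Y. \<forall>k\<in>{K+1..2*K}. \<not> has_ap (4 ^ k) (\<rho> (4 ^ k)) Y) \<le> ?U K"
      proof (rule pow4_block)
        show "1 \<le> K" by (rule elim(3))
        show "0 < \<sigma> K" using p0 elim(3) by (simp add: \<sigma>_def)
        have "1 * 1 \<le> c * real K" using c0 elim(3) by (intro mult_mono) auto
        then show "1 \<le> c * real K" by simp
        fix k assume k: "k \<in> {K+1..2*K}"
        define n where "n = (4::nat) ^ k"
        define l where "l = ln (real n)"
        have n0: "0 < real n" by (simp add: n_def)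
        have lk: "l = ln 4 * real k" unfolding l_def n_def by (simp add: ln_realpow mult.commute)
        have ln4: "1 \<le> ln (4::real)"
        proof -
          have "exp 1 \<le> (4::real)" using exp_le by simp
          then show ?thesis by (simp add: ln_ge_iff)
        qed
        have k1: "1 \<le> real k" "real K \<le> real k" "real k \<le> 2 * real K" using k by auto
        have "1 * 1 \<le> ln 4 * real k" using ln4 k1 by (intro mult_mono) auto
        then have l1: "1 \<le> l" by (simp add: lk)
        have lK: "l \<le> 2 * ln 4 * real K" using k1 ln4 by (simp add: lk)
        have ll: "0 \<le> ln l" "ln l \<le> l" using l1 ln_le_minus_one[of l] by auto
        have ep: "0 \<le> e / lp" using e lp_pos by simp
        have "a * real K \<le> 2 / lp * l" unfolding a_def lk using k1 lp_pos ln4 by (simp add: mult_left_mono divide_right_mono)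
        also have "\<dots> \<le> y n" unfolding y_def l_def[symmetric] using mult_nonneg_nonneg[OF ep ll(1)] by linarith
        finally have y2: "2 \<le> y n" using elim(1) by linarith
        have yr: "y n \<le> real (\<rho> n)" "real (\<rho> n) \<le> y n + 1" "2 \<le> \<rho> n" unfolding \<rho>_def using y2 by linarith+
        have "e / lp * ln l \<le> 1 / lp * l" using ll e lp_pos by (intro mult_mono divide_right_mono) auto
        then have "y n \<le> 3 / lp * l" unfolding y_def l_def[symmetric] by simp
        also have "\<dots> \<le> 3 / lp * (2 * ln 4 * real K)" using lK lp_pos by (intro mult_left_mono) auto
        finally have R: "real (\<rho> n) + 1 \<le> c * real K"
          using yr(2) elim(3) by (simp add: c_def distrib_right)
        have u: "(real n)\<^sup>2 * p powr y n = l powr (- e)"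
        proof -
          have "(real n)\<^sup>2 * p powr y n = p powr (e / lp * ln l)" unfolding y_def l_def by (rule sq_mult_powr[OF n0])
          also have "- lp * (e / lp * ln l) = - e * ln l" using lp_pos by simp
          then have "p powr (e / lp * ln l) = l powr (- e)" unfolding powr_lp using l1 by (simp add: powr_def)
          finally show ?thesis .
        qed
        have up: "(real n)\<^sup>2 * p ^ \<rho> n \<le> 1"
        proof -
          have "p powr real (\<rho> n) \<le> p powr y n" unfolding powr_lp using yr lp_pos by simp
          then have "p ^ \<rho> n \<le> p powr y n" using p0 by (simp add: powr_realpow)
          then have "(real n)\<^sup>2 * p ^ \<rho> n \<le> l powr (- e)" unfolding u[symmetric] by (rule mult_left_mono) simp
          also have "\<dots> \<le> l powr 0" using l1 e by (intro powr_mono) auto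
          finally show ?thesis using l1 by simp
        qed
        have lo: "\<sigma> K \<le> (real n)\<^sup>2 * p ^ \<rho> n"
        proof -
          have "\<sigma> K \<le> p * l powr (- e)" unfolding \<sigma>_def
            using lK l1 e p0 by (intro mult_left_mono powr_mono2') auto
          also have "\<dots> = (real n)\<^sup>2 * (p powr y n * p)" unfolding u[symmetric] by simp
          also have "\<dots> \<le> (real n)\<^sup>2 * p ^ \<rho> n"
          proof (rule mult_left_mono)
            have "p powr (y n + 1) \<le> p powr real (\<rho> n)" unfolding powr_lp using yr lp_pos by simp
            then show "p powr y n * p \<le> p ^ \<rho> n" using p0 by (simp add: powr_realpow powr_add)
          qed simp
          finally show ?thesis .
        qed
        have n5: "8 * (1 + \<rho> n ^ 4) \<le> n"
        proof -
          have r1: "1 \<le> real (\<rho> n) + 1" by simp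
          have "real (\<rho> n) ^ 4 \<le> (real (\<rho> n) + 1) ^ 4" by (intro power_mono) auto
          also have "\<dots> \<le> (real (\<rho> n) + 1) ^ 5" by (rule power_increasing[OF _ r1]) simp
          finally have h1: "real (\<rho> n) ^ 4 \<le> (real (\<rho> n) + 1) ^ 5" .
          have h2: "1 \<le> (real (\<rho> n) + 1) ^ 5" using r1 by (rule one_le_power)
          have h3: "(real (\<rho> n) + 1) ^ 5 \<le> (c * real K) ^ 5" using R by (intro power_mono) auto
          have "8 * (1 + real (\<rho> n) ^ 4) \<le> 8 * ((c * real K) ^ 5 + (c * real K) ^ 5)"
            by (intro mult_left_mono add_mono order_trans[OF h2 h3] order_trans[OF h1 h3]) simp
          also have "\<dots> \<le> 4 ^ K" using elim(2) by simp
          also have "(4::real) ^ K \<le> 4 ^ k" using k by (intro power_increasing) auto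
          finally have "8 * (1 + real (\<rho> n) ^ 4) \<le> 4 ^ k" .
          then have "real (8 * (1 + \<rho> n ^ 4)) \<le> real n" by (simp add: n_def)
          then show ?thesis by (simp only: of_nat_le_iff)
        qed
        show "2 \<le> \<rho> (4 ^ k) \<and> real (\<rho> (4 ^ k)) + 1 \<le> c * real K \<and> 8 * (1 + \<rho> (4 ^ k) ^ 4) \<le> 4 ^ k
          \<and> (real (4 ^ k))\<^sup>2 * p ^ \<rho> (4 ^ k) \<le> 1 \<and> \<sigma> K \<le> (real (4 ^ k))\<^sup>2 * p ^ \<rho> (4 ^ k)"
          unfolding n_def[symmetric] using yr(3) R n5 up lo by blast
      qed
      then show ?case unfolding pc by linarith
    qed
    show "(\<lambda>K. 1 - ?U K) \<longlonglongrightarrow> 1"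
      using tendsto_diff[OF tendsto_const[of 1] limU] by (simp only: diff_zero)
  qed (auto simp: prob_le_1)
  from AE_frequently_of_prob_tendsto_1[OF ev this] show ?thesis
  proof eventually_elim
    case (elim \<omega>)
    show ?case unfolding frequently_sequentially
    proof (intro allI)
      fix k0
      have "\<exists>\<^sub>F K in sequentially. \<omega> \<in> B K \<and> (k0 \<le> K \<and> 2 \<le> a * real K)"
        by (rule frequently_eventually_frequently[OF elim eventually_conj[OF eventually_ge_at_top ya]])
      then obtain K where K: "\<omega> \<in> B K" "k0 \<le> K" by (blast dest: frequently_ex)
      then obtain k where k: "k \<in> {K+1..2*K}" "has_ap (4 ^ k) (\<rho> (4 ^ k)) (X \<omega>)" by (auto simp: B_def event_def)
      have four: "(4::nat) ^ k = 2 ^ (2 * k)" by (simp add: power_mult)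
      have "y (4 ^ k) \<le> real (Wn (4 ^ k) \<omega>)"
      proof (cases "\<rho> (4 ^ k) \<ge> 1")
        case True
        then have "\<rho> (4 ^ k) \<le> Wn (4 ^ k) \<omega>" using k(2) Wn_ge_iff[of "4 ^ k" "\<rho> (4 ^ k)" \<omega>] by simp
        then show ?thesis unfolding \<rho>_def by linarith
      next
        case False
        then have "y (4 ^ k) \<le> 0" unfolding \<rho>_def by linarith
        then show ?thesis by (meson of_nat_0_le_iff order_trans)
      qed
      then have "2 / lp * (ln 2 * real (2 * k)) + e / lp * ln (ln 2 * real (2 * k)) \<le> real (Wn (2 ^ (2 * k)) \<omega>)"
        unfolding y_def four ln_pow2 .
      then show "\<exists>k\<ge>k0. 2 / lp * (ln 2 * real k) + e / lp * ln (ln 2 * real k) \<le> real (Wn (2 ^ k) \<omega>)"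
        using k(1) K(2) by (intro exI[of _ "2 * k"]) auto
    qed
  qed
qed

end

section \<open>Limits inferior and superior\<close>

text \<open>The tolerances 1 / (k + 1) are countably many, so almost sure statements for each of
  them hold simultaneously outside one null set.\<close>

lemma limsup_ereal_eqI:
  fixes f :: "nat \<Rightarrow> real"
  assumes up: "\<And>k. \<forall>\<^sub>F n in sequentially. f n \<le> c + 1 / real (Suc k)"
    and lo: "\<And>k. \<exists>\<^sub>F n in sequentially. c - 1 / real (Suc k) \<le> f n"
  shows "limsup (\<lambda>n. ereal (f n)) = ereal c"
proof (rule antisym)
  have ub: "limsup (\<lambda>n. ereal (f n)) \<le> ereal (c + 1 / real (Suc k))" for k
    by (rule Limsup_bounded) (use up[of k] in \<open>auto elim: eventually_mono\<close>)
  show "limsup (\<lambda>n. ereal (f n)) \<le> ereal c"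
  proof (rule ereal_le_epsilon2)
    fix d :: real assume "0 < d"
    then obtain k where "inverse (real (Suc k)) < d" using reals_Archimedean by blast
    then have "c + 1 / real (Suc k) \<le> c + d" unfolding inverse_eq_divide by linarith
    then have "ereal (c + 1 / real (Suc k)) \<le> ereal c + ereal d" by (simp only: plus_ereal.simps ereal_less_eq)
    with ub[of k] show "limsup (\<lambda>n. ereal (f n)) \<le> ereal c + ereal d" by (rule order_trans)
  qed
  show "ereal c \<le> limsup (\<lambda>n. ereal (f n))"
  proof (rule ccontr)
    assume "\<not> ?thesis"
    then have "limsup (\<lambda>n. ereal (f n)) < ereal c" by (simp add: not_le)
    then obtain z where z: "limsup (\<lambda>n. ereal (f n)) < ereal z" "ereal z < ereal c"
      using ereal_dense2 by blast
    then have "0 < c - z" by simp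
    then obtain k where k: "inverse (real (Suc k)) < c - z" using reals_Archimedean by blast
    have "\<forall>\<^sub>F n in sequentially. ereal (f n) < ereal z" using z(1) by (rule Limsup_lessD)
    then have "\<forall>\<^sub>F n in sequentially. \<not> c - 1 / real (Suc k) \<le> f n"
    proof eventually_elim
      case (elim n)
      then have "f n < z" by simp
      then show ?case using k unfolding inverse_eq_divide by linarith
    qed
    then show False using lo[of k] by (simp add: frequently_def)
  qed
qed

lemma liminf_ereal_eqI:
  fixes f :: "nat \<Rightarrow> real"
  assumes lo: "\<And>k. \<forall>\<^sub>F n in sequentially. c - 1 / real (Suc k) \<le> f n"
    and up: "\<And>k. \<exists>\<^sub>F n in sequentially. f n \<le> c + 1 / real (Suc k)"
  shows "liminf (\<lambda>n. ereal (f n)) = ereal c"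
proof -
  have "limsup (\<lambda>n. ereal (- f n)) = ereal (- c)"
  proof (rule limsup_ereal_eqI)
    show "\<forall>\<^sub>F n in sequentially. - f n \<le> - c + 1 / real (Suc k)" for k
      using lo[of k] by eventually_elim simp
    show "\<exists>\<^sub>F n in sequentially. - c - 1 / real (Suc k) \<le> - f n" for k
      using up[of k] by (rule frequently_elim1) simp
  qed
  then have "- liminf (\<lambda>n. ereal (f n)) = - ereal c"
    using ereal_Limsup_uminus[of sequentially "\<lambda>n. ereal (f n)"] by simp
  then show ?thesis by (simp only: ereal_uminus_eq_iff)
qed

section \<open>Passage from countably many tolerances to the limits\<close>

context bernoulli_sequence
begin

lemma AE_all_Suc:
  assumes "\<And>k::nat. AE \<omega> in M. P k \<omega>"
  shows "AE \<omega> in M. \<forall>k. P k \<omega>"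
  unfolding AE_all_countable using assms by blast

theorem AE_limsup_ratio:
  "AE \<omega> in M. limsup (\<lambda>n. ereal (real (Wn n \<omega>) / (2 / lp * ln (real n)))) = ereal (3 / 2)"
proof -
  have C: "0 < 2 / lp" using lp_pos by simp
  have U: "AE \<omega> in M. \<forall>k. \<forall>\<^sub>F n in sequentially. real (Wn n \<omega>) < (3 / 2 + 1 / real (Suc k)) * (2 / lp * ln (real n))"
    by (intro AE_all_Suc limsup_upper) simp
  \<comment> \<open>The shift to k + 2 keeps the tolerance strictly below 1, as
    \<open>limsup_lower\<close> requires.\<close>
  have L: "AE \<omega> in M. \<forall>k. \<exists>\<^sub>F n in sequentially. (3 / 2 - 1 / real (Suc (Suc k))) * (2 / lp * ln (real n)) \<le> real (Wn n \<omega>)"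
    by (intro AE_all_Suc limsup_lower) simp_all
  from U L show ?thesis
  proof eventually_elim
    case (elim \<omega>)
    show ?case
    proof (rule limsup_ereal_eqI)
      fix k
      from elim(1) have "\<forall>\<^sub>F n in sequentially. real (Wn n \<omega>) < (3 / 2 + 1 / real (Suc k)) * (2 / lp * ln (real n))" ..
      then show "\<forall>\<^sub>F n in sequentially. real (Wn n \<omega>) / (2 / lp * ln (real n)) \<le> 3 / 2 + 1 / real (Suc k)"
        using eventually_ge_at_top[of 2]
      proof eventually_elim
        case (elim n)
        have "0 < 2 / lp * ln (real n)" using C elim(2) by (intro mult_pos_pos) auto
        then show ?case using less_imp_le[OF elim(1)] by (subst pos_divide_le_eq)
      qed
      from elim(2) have "\<exists>\<^sub>F n in sequentially. (3 / 2 - 1 / real (Suc (Suc k))) * (2 / lp * ln (real n)) \<le> real (Wn n \<omega>)" ..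
      from frequently_eventually_frequently[OF this eventually_ge_at_top[of 2]]
      show "\<exists>\<^sub>F n in sequentially. 3 / 2 - 1 / real (Suc k) \<le> real (Wn n \<omega>) / (2 / lp * ln (real n))"
      proof (rule frequently_elim1)
        fix n assume n: "(3 / 2 - 1 / real (Suc (Suc k))) * (2 / lp * ln (real n)) \<le> real (Wn n \<omega>) \<and> 2 \<le> n"
        have p: "0 < 2 / lp * ln (real n)" using C n by (intro mult_pos_pos) auto
        have "1 / real (Suc (Suc k)) \<le> 1 / real (Suc k)" by (intro divide_left_mono) auto
        moreover have "3 / 2 - 1 / real (Suc (Suc k)) \<le> real (Wn n \<omega>) / (2 / lp * ln (real n))"
          unfolding pos_le_divide_eq[OF p] using n by blast
        ultimately show "3 / 2 - 1 / real (Suc k) \<le> real (Wn n \<omega>) / (2 / lp * ln (real n))" by linarith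
      qed
    qed
  qed
qed

theorem AE_liminf_normalised:
  "AE \<omega> in M. liminf (\<lambda>n. ereal ((real (Wn n \<omega>) - 2 / lp * ln (real n)) / ln (ln (real n)))) = ereal (- 1 / lp)"
proof -
  \<comment> \<open>Half of the tolerance goes to \<open>e k\<close> / \<open>lp\<close>, the other
    half to the additive constant divided by ln ln n. In \<open>\<delta>\<close> the factor 2 comes
    from (1 - \<delta>)^2 >= 1 - 2 \<delta>.\<close>
  define e where "e k = min 1 (lp / (2 * real (Suc k)))" for k
  define \<delta> where "\<delta> k = min (1 / 2) (lp / (2 * real (Suc k)))" for k
  define c where "c = 2 / lp * ln 2 + 1"
  have e: "0 < e k" "e k \<le> 1" "e k / lp \<le> 1 / (2 * real (Suc k))" for k
  proof -
    show "0 < e k" "e k \<le> 1" using lp_pos by (auto simp: e_def)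
    have "e k / lp \<le> (lp / (2 * real (Suc k))) / lp" unfolding e_def using lp_pos by (intro divide_right_mono) auto
    then show "e k / lp \<le> 1 / (2 * real (Suc k))" using lp_pos by simp
  qed
  have d: "0 < \<delta> k" "\<delta> k < 1" "2 * \<delta> k / lp \<le> 1 / real (Suc k)" for k
  proof -
    show "0 < \<delta> k" "\<delta> k < 1" using lp_pos by (auto simp: \<delta>_def min_def)
    have "2 * \<delta> k / lp \<le> 2 * (lp / (2 * real (Suc k))) / lp" unfolding \<delta>_def using lp_pos by (intro divide_right_mono mult_left_mono) auto
    also have "2 * (lp / (2 * x)) / lp = 1 / x" for x using lp_pos by simp
    finally show "2 * \<delta> k / lp \<le> 1 / real (Suc k)" .
  qed
  have lpos: "\<forall>\<^sub>F n in sequentially. 0 < ln (ln (real n))" by real_asymp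
  have L: "AE \<omega> in M. \<forall>k. \<forall>\<^sub>F n in sequentially.
     2 / lp * ln (real n) - (1 + e k) / lp * ln (ln (real n)) - (2 / lp * ln 2 + 1) \<le> real (Wn n \<omega>)"
    by (intro AE_all_Suc liminf_lower e)
  have U: "AE \<omega> in M. \<forall>k. \<exists>\<^sub>F n in sequentially. real (Wn n \<omega>) < 2 / lp * ln (real n) - (1 - \<delta> k)\<^sup>2 / lp * ln (ln (real n))"
    by (intro AE_all_Suc liminf_upper) (use d in auto)
  from L U show ?thesis
  proof eventually_elim
    case (elim \<omega>)
    show ?case
    proof (rule liminf_ereal_eqI)
      fix k
      have "(\<lambda>n::nat. c / ln (ln (real n))) \<longlonglongrightarrow> 0"
      proof -
        have "(\<lambda>n::nat. 1 / ln (ln (real n))) \<longlonglongrightarrow> 0" by real_asymp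
        from tendsto_mult_right_zero[OF this, of c] show ?thesis by simp
      qed
      then have "\<forall>\<^sub>F n in sequentially. c / ln (ln (real n)) < 1 / (2 * real (Suc k))" by (rule order_tendstoD) simp
      moreover from elim(1) have "\<forall>\<^sub>F n in sequentially.
         2 / lp * ln (real n) - (1 + e k) / lp * ln (ln (real n)) - (2 / lp * ln 2 + 1) \<le> real (Wn n \<omega>)" ..
      ultimately show "\<forall>\<^sub>F n in sequentially. - 1 / lp - 1 / real (Suc k) \<le> (real (Wn n \<omega>) - 2 / lp * ln (real n)) / ln (ln (real n))"
        using lpos
      proof eventually_elim
        case (elim n)
        let ?l = "ln (ln (real n))"
        have "(- ((1 + e k) / lp) - c / ?l) * ?l = - ((1 + e k) / lp * ?l) - c" using elim(3) by (simp add: left_diff_distrib)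
        then have "(- ((1 + e k) / lp) - c / ?l) * ?l \<le> real (Wn n \<omega>) - 2 / lp * ln (real n)"
          using elim(2) unfolding c_def by linarith
        then have "- ((1 + e k) / lp) - c / ?l \<le> (real (Wn n \<omega>) - 2 / lp * ln (real n)) / ?l"
          unfolding pos_le_divide_eq[OF elim(3)] .
        moreover have "(1 + e k) / lp = 1 / lp + e k / lp" by (rule add_divide_distrib)
        moreover have "1 / (2 * real (Suc k)) + 1 / (2 * real (Suc k)) = 1 / real (Suc k)"
          by (simp add: field_simps)
        moreover have "- a - u \<le> w" if "- z - v \<le> w" "z = a + b" "h + h = u" "b \<le> h" "v < h" for a b h u v w z :: real
          using that by linarith
        ultimately have "- (1 / lp) - 1 / real (Suc k) \<le> (real (Wn n \<omega>) - 2 / lp * ln (real n)) / ?l"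
          using e(3)[of k] elim(1) by blast
        then show ?case by simp
      qed
      from elim(2) have "\<exists>\<^sub>F n in sequentially. real (Wn n \<omega>) < 2 / lp * ln (real n) - (1 - \<delta> k)\<^sup>2 / lp * ln (ln (real n))" ..
      from frequently_eventually_frequently[OF this lpos]
      show "\<exists>\<^sub>F n in sequentially. (real (Wn n \<omega>) - 2 / lp * ln (real n)) / ln (ln (real n)) \<le> - 1 / lp + 1 / real (Suc k)"
      proof (rule frequently_elim1)
        fix n assume n: "real (Wn n \<omega>) < 2 / lp * ln (real n) - (1 - \<delta> k)\<^sup>2 / lp * ln (ln (real n)) \<and> 0 < ln (ln (real n))"
        let ?l = "ln (ln (real n))"
        have l: "0 < ?l" using n by blast
        have "(1 - 2 * \<delta> k) / lp \<le> (1 - \<delta> k)\<^sup>2 / lp"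
          using lp_pos by (intro divide_right_mono) (auto simp: power2_eq_square algebra_simps)
        moreover have "(1 - 2 * \<delta> k) / lp = 1 / lp - 2 * \<delta> k / lp" by (rule diff_divide_distrib)
        ultimately have z: "- ((1 - \<delta> k)\<^sup>2 / lp) \<le> - 1 / lp + 1 / real (Suc k)" using d(3)[of k] by simp
        have "real (Wn n \<omega>) - 2 / lp * ln (real n) \<le> - ((1 - \<delta> k)\<^sup>2 / lp) * ?l" using n by simp
        also have "\<dots> \<le> (- 1 / lp + 1 / real (Suc k)) * ?l" using z l by (intro mult_right_mono) auto
        finally show "(real (Wn n \<omega>) - 2 / lp * ln (real n)) / ?l \<le> - 1 / lp + 1 / real (Suc k)"
          unfolding pos_divide_le_eq[OF l] .
      qed
    qed
  qed
qed

theorem AE_liminf_pow2: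
  "AE \<omega> in M. liminf (\<lambda>n. ereal ((real (Wn (2 ^ n) \<omega>) - 2 / lp * (ln 2 * real n)) / ln (ln 2 * real n))) = ereal 0"
proof -
  have lpos: "\<forall>\<^sub>F n in sequentially. 0 < ln (ln 2 * real n)" by real_asymp
  have L: "AE \<omega> in M. \<forall>k. \<forall>\<^sub>F n in sequentially. 2 / lp * (ln 2 * real n) - 1 / real (Suc k) * ln (ln 2 * real n) \<le> real (Wn (2 ^ n) \<omega>)"
    by (intro AE_all_Suc AE_pow2_lower) simp_all
  have U: "AE \<omega> in M. \<forall>k. \<exists>\<^sub>F n in sequentially. real (Wn (2 ^ n) \<omega>) < 2 / lp * (ln 2 * real n) + 1 / real (Suc k) * ln (ln 2 * real n)"
    by (intro AE_all_Suc pow2_frequently_low) simp_all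
  from L U show ?thesis
  proof eventually_elim
    case (elim \<omega>)
    show ?case
    proof (rule liminf_ereal_eqI)
      fix k
      from elim(1) have "\<forall>\<^sub>F n in sequentially. 2 / lp * (ln 2 * real n) - 1 / real (Suc k) * ln (ln 2 * real n) \<le> real (Wn (2 ^ n) \<omega>)" ..
      then show "\<forall>\<^sub>F n in sequentially. 0 - 1 / real (Suc k) \<le> (real (Wn (2 ^ n) \<omega>) - 2 / lp * (ln 2 * real n)) / ln (ln 2 * real n)"
        using lpos by eventually_elim (subst pos_le_divide_eq, assumption, simp)
      from elim(2) have "\<exists>\<^sub>F n in sequentially. real (Wn (2 ^ n) \<omega>) < 2 / lp * (ln 2 * real n) + 1 / real (Suc k) * ln (ln 2 * real n)" ..
      from frequently_eventually_frequently[OF this lpos]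
      show "\<exists>\<^sub>F n in sequentially. (real (Wn (2 ^ n) \<omega>) - 2 / lp * (ln 2 * real n)) / ln (ln 2 * real n) \<le> 0 + 1 / real (Suc k)"
        by (rule frequently_elim1) (subst pos_divide_le_eq, auto)
    qed
  qed
qed

theorem AE_limsup_pow2:
  "AE \<omega> in M. limsup (\<lambda>n. ereal ((real (Wn (2 ^ n) \<omega>) - 2 / lp * (ln 2 * real n)) / ln (ln 2 * real n))) = ereal (1 / lp)"
proof -
  define \<delta> where "\<delta> k = min (1 / 2) (lp / real (Suc k))" for k
  have d: "0 < \<delta> k" "\<delta> k < 1" "\<delta> k / lp \<le> 1 / real (Suc k)" for k
  proof -
    show "0 < \<delta> k" "\<delta> k < 1" using lp_pos by (auto simp: \<delta>_def min_def)
    have "\<delta> k / lp \<le> lp / real (Suc k) / lp" unfolding \<delta>_def using lp_pos by (intro divide_right_mono) auto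
    then show "\<delta> k / lp \<le> 1 / real (Suc k)" using lp_pos by simp
  qed
  have lpos: "\<forall>\<^sub>F n in sequentially. 0 < ln (ln 2 * real n)" by real_asymp
  have U: "AE \<omega> in M. \<forall>k. \<forall>\<^sub>F n in sequentially. real (Wn (2 ^ n) \<omega>) < 2 / lp * (ln 2 * real n) + (1 / lp + 1 / real (Suc k)) * ln (ln 2 * real n)"
    by (intro AE_all_Suc pow2_upper) simp_all
  have L: "AE \<omega> in M. \<forall>k. \<exists>\<^sub>F n in sequentially. 2 / lp * (ln 2 * real n) + (1 - \<delta> k) / lp * ln (ln 2 * real n) \<le> real (Wn (2 ^ n) \<omega>)"
    by (intro AE_all_Suc pow2_limsup_lower) (use d in auto)
  from U L show ?thesis
  proof eventually_elim
    case (elim \<omega>)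
    show ?case
    proof (rule limsup_ereal_eqI)
      fix k
      from elim(1) have "\<forall>\<^sub>F n in sequentially. real (Wn (2 ^ n) \<omega>) < 2 / lp * (ln 2 * real n) + (1 / lp + 1 / real (Suc k)) * ln (ln 2 * real n)" ..
      then show "\<forall>\<^sub>F n in sequentially. (real (Wn (2 ^ n) \<omega>) - 2 / lp * (ln 2 * real n)) / ln (ln 2 * real n) \<le> 1 / lp + 1 / real (Suc k)"
        using lpos by eventually_elim (subst pos_divide_le_eq, assumption, linarith)
      from elim(2) have "\<exists>\<^sub>F n in sequentially. 2 / lp * (ln 2 * real n) + (1 - \<delta> k) / lp * ln (ln 2 * real n) \<le> real (Wn (2 ^ n) \<omega>)" ..
      from frequently_eventually_frequently[OF this lpos]
      show "\<exists>\<^sub>F n in sequentially. 1 / lp - 1 / real (Suc k) \<le> (real (Wn (2 ^ n) \<omega>) - 2 / lp * (ln 2 * real n)) / ln (ln 2 * real n)"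
      proof (rule frequently_elim1)
        fix n assume n: "2 / lp * (ln 2 * real n) + (1 - \<delta> k) / lp * ln (ln 2 * real n) \<le> real (Wn (2 ^ n) \<omega>) \<and> 0 < ln (ln 2 * real n)"
        have l: "0 < ln (ln 2 * real n)" using n by blast
        have "(1 - \<delta> k) / lp = 1 / lp - \<delta> k / lp" by (rule diff_divide_distrib)
        then have "1 / lp - 1 / real (Suc k) \<le> (1 - \<delta> k) / lp" using d(3)[of k] by linarith
        then have "(1 / lp - 1 / real (Suc k)) * ln (ln 2 * real n) \<le> (1 - \<delta> k) / lp * ln (ln 2 * real n)"
          using l by (intro mult_right_mono) auto
        then show "1 / lp - 1 / real (Suc k) \<le> (real (Wn (2 ^ n) \<omega>) - 2 / lp * (ln 2 * real n)) / ln (ln 2 * real n)"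
          unfolding pos_le_divide_eq[OF l] using n by linarith
      qed
    qed
  qed
qed

theorem AE_sum_pow2:
  "AE \<omega> in M. (\<lambda>n. 1 / (real n * ln (real n)) * ((\<Sum>k = 1..n. real (Wn (2 ^ k) \<omega>)) + ln 2 / ln p * real n ^ 2)) \<longlonglongrightarrow> 0"
proof -
  let ?A = "\<lambda>\<omega> n. 1 / (real n * ln (real n)) * (\<Sum>k=1..n. real (Wn (2 ^ k) \<omega>) - 2 / lp * (ln 2 * real k))"
  have "AE \<omega> in M. \<forall>j. \<forall>\<^sub>F n in sequentially. \<bar>?A \<omega> n\<bar> \<le> 2 * (1 / (2 * real (Suc j)))"
    by (intro AE_all_Suc pow2_sum_bound) simp
  then show ?thesis
  proof eventually_elim
    case (elim \<omega>)
    have A: "?A \<omega> \<longlonglongrightarrow> 0"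
    proof (rule LIMSEQ_I)
      fix r :: real assume "0 < r"
      then obtain j where j: "inverse (real (Suc j)) < r" using reals_Archimedean by blast
      from elim have "\<forall>\<^sub>F n in sequentially. \<bar>?A \<omega> n\<bar> \<le> 2 * (1 / (2 * real (Suc j)))" ..
      then obtain n0 where n0: "\<And>n. n \<ge> n0 \<Longrightarrow> \<bar>?A \<omega> n\<bar> \<le> 2 * (1 / (2 * real (Suc j)))"
        unfolding eventually_sequentially by blast
      have "2 * (1 / (2 * x)) = inverse x" for x :: real by (simp add: inverse_eq_divide)
      then have "2 * (1 / (2 * real (Suc j))) < r" using j by (simp only:)
      then show "\<exists>no. \<forall>n\<ge>no. norm (?A \<omega> n - 0) < r"
        using n0 unfolding diff_zero real_norm_def by (meson le_less_trans)
    qed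
    \<comment> \<open>The centring terms sum to (ln 2 / \<open>lp\<close>) n (n + 1) rather than (ln
      2 / \<open>lp\<close>) n^2; the linear excess divided by n ln n vanishes.\<close>
    have B: "(\<lambda>n. ln 2 / lp * (1 / ln (real n))) \<longlonglongrightarrow> 0"
      by (rule tendsto_mult_right_zero) real_asymp
    have "\<forall>\<^sub>F n in sequentially. ?A \<omega> n + ln 2 / lp * (1 / ln (real n))
        = 1 / (real n * ln (real n)) * ((\<Sum>k = 1..n. real (Wn (2 ^ k) \<omega>)) + ln 2 / ln p * real n ^ 2)"
      using eventually_ge_at_top[of 2]
    proof eventually_elim
      case (elim n)
      define S where "S = (\<Sum>k = 1..n. real (Wn (2 ^ k) \<omega>))"
      have n0: "0 < real n" "0 < ln (real n)" using elim by auto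
      have "(\<Sum>k=1..n. real (Wn (2 ^ k) \<omega>) - 2 / lp * (ln 2 * real k)) = S - 2 / lp * (ln 2 * (\<Sum>k=1..n. real k))"
        unfolding S_def by (simp only: sum_subtractf sum_distrib_left)
      also have "(\<Sum>k=1..n. real k) = real n * (real n + 1) / 2"
        by (induction n) (simp_all add: field_simps)
      also have "S - 2 / lp * (ln 2 * (real n * (real n + 1) / 2)) = S + ln 2 / ln p * real n ^ 2 - ln 2 / lp * real n"
        unfolding lp_def using p0 p1 by (simp add: field_simps power2_eq_square)
      finally have "?A \<omega> n = 1 / (real n * ln (real n)) * (S + ln 2 / ln p * real n ^ 2 - ln 2 / lp * real n)"
        by (simp only:)
      also have "\<dots> = 1 / (real n * ln (real n)) * (S + ln 2 / ln p * real n ^ 2) - ln 2 / lp * (1 / ln (real n))"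
      proof -
        have "1 / (m * l) * (x - y * m) = 1 / (m * l) * x - y * (1 / l)" if "m > 0" for m l x y :: real
          using that by (simp add: diff_divide_distrib)
        from this[OF n0(1)] show ?thesis .
      qed
      finally show ?case unfolding S_def by (simp only: diff_add_cancel)
    qed
    moreover have "(\<lambda>n. ?A \<omega> n + ln 2 / lp * (1 / ln (real n))) \<longlonglongrightarrow> 0"
      using tendsto_add[OF A B] by (simp only: add_0_left)
    ultimately show ?case by (rule Lim_transform_eventually[rotated])
  qed
qed

end

theorem theorem1p2:
  fixes M :: "'a measure" and \<xi> :: "nat \<Rightarrow> 'a \<Rightarrow> real" and p q C D :: real
    and W :: "nat \<Rightarrow> 'a \<Rightarrow> nat" and \<mu> :: "nat \<Rightarrow> nat \<Rightarrow> real"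
  assumes "prob_space M"
    and "0 < p" and "p < 1" and "q = 1 - p"
    and "prob_space.indep_vars M (\<lambda>_. borel) \<xi> {1..}"
    and "\<And>i. i \<ge> 1 \<Longrightarrow> \<P>(\<omega> in M. \<xi> i \<omega> = 1) = p"
    and "\<And>i. i \<ge> 1 \<Longrightarrow> \<P>(\<omega> in M. \<xi> i \<omega> = 0) = 1 - p"
    and "\<And>n \<omega>. W n \<omega> = longest_ap (\<lambda>i. \<xi> i \<omega>) n"
    and "C = - 2 / ln p" and "D = 1 / ln p"
    and "\<And>n r. \<mu> n r = q * real n ^ 2 * p ^ r / 2"
  shows
    "(\<exists>K. \<forall>\<^sub>F n in sequentially.
        (MAX r\<in>{1<..n}. \<bar>\<P>(\<omega> in M. W n \<omega> < r) - exp (- \<mu> n r)\<bar>) \<le> K * (ln (real n) ^ 7 / real n))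
     \<and> (\<forall>a::real. \<exists>K. \<forall>\<^sub>F n in sequentially.
          \<forall>x::real. x \<ge> D * ln (ln (real n)) + a \<and> C * ln (real n) + x \<in> \<int> \<longrightarrow>
            \<bar>exp (q / 2 * p powr x) * \<P>(\<omega> in M. real (W n \<omega>) < C * ln (real n) + x) - 1\<bar>
              \<le> K * (ln (real n) ^ 7 / real n powr (1 - q * p powr a / 2)))
     \<and> tendsto_in_prob M
          (\<lambda>n \<omega>. (real (W n \<omega>) - C * ln (real n)) / ln (ln (real n))) (\<lambda>_. 0)
     \<and> (AE \<omega> in M. limsup (\<lambda>n. ereal (real (W n \<omega>) / (C * ln (real n)))) = ereal (3 / 2))
     \<and> (AE \<omega> in M.
          liminf (\<lambda>n. ereal ((real (W n \<omega>) - C * ln (real n)) / ln (ln (real n)))) = ereal D)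
     \<and> (AE \<omega> in M.
          let Z = (\<lambda>n. ereal ((real (W (2 ^ n) \<omega>) - C * ln (2 ^ n)) / ln (ln (2 ^ n))))
          in 0 = liminf Z \<and> liminf Z < limsup Z \<and> limsup Z = ereal (- D))
     \<and> (AE \<omega> in M.
          (\<lambda>n. 1 / (real n * ln (real n)) *
                ((\<Sum>k = 1..n. real (W (2 ^ k) \<omega>)) + ln 2 / ln p * real n ^ 2)) \<longlonglongrightarrow> 0)"
proof -
  interpret prob_space M by fact
  interpret bernoulli_sequence M \<xi> p q
    using assms by unfold_locales auto
  have W: "W n \<omega> = Wn n \<omega>" for n \<omega> using assms(8) by (simp add: Wn_def)
  have C: "C = 2 / lp" and D: "D = - 1 / lp" using assms(9,10) by (simp_all add: lp_def)
  have "AE \<omega> in M. let Z = (\<lambda>n. ereal ((real (Wn (2 ^ n) \<omega>) - 2 / lp * ln (2 ^ n)) / ln (ln (2 ^ n))))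
      in 0 = liminf Z \<and> liminf Z < limsup Z \<and> limsup Z = ereal (- (- 1 / lp))"
    using AE_liminf_pow2 AE_limsup_pow2
  proof eventually_elim
    case (elim \<omega>)
    then show ?case using lp_pos unfolding Let_def ln_pow2(2) by (simp add: zero_ereal_def)
  qed
  then show ?thesis
    unfolding W C D assms(11) tendsto_in_prob_def
    by (intro conjI allI impI poisson_error_Max poisson_ratio_error tendsto_in_prob_normalised AE_limsup_ratio AE_liminf_normalised AE_sum_pow2)
qed

end
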